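(* Let $R$ be a commutative ring with unity and let $I$ be an ideal of $R$. Let $M$ be a finitely generated projective $R$-module of rank at least $2$, and let $N = R \oplus M$. Then the relative elementary transvection group $\operatorname{ETrans}(N, IN)$ is a normal subgroup of $\operatorname{Aut}(N)$.
   Context: For an $R$-module $M$, write $M^{*} = \operatorname{Hom}_R(M,R)$, and let $\operatorname{Aut}(M)$ be the group of $R$-linear automorphisms of $M$. Let $N = R\oplus M$. For $x \in M$ let $E_x \in \operatorname{Aut}(N)$ be the map $(a,p) \mapsto (a, p + ax)$, and for $\tau \in M^{*}$ let $E_\tau^{*} \in \operatorname{Aut}(N)$ be the map $(a,p) \mapsto (a + \tau(p), p)$, where $a\in R$, $p\in M$. These are called elementary transvections of $N$. $\operatorname{ETrans}(N)$ is the subgroup of $\operatorname{Aut}(N)$ generated by all $E_x$ ($x\in M$) and all $E_\tau^{*}$ ($\tau\in M^{*}$). $\operatorname{ETrans}(IN)$ is the subgroup generated by all $E_x$ with $x \in IM$ and all $E_\tau^{*}$ with $\tau \in IM^{*}$. $\operatorname{ETrans}(N, IN)$ is the normal closure of $\operatorname{ETrans}(IN)$ in $\operatorname{ETrans}(N)$. *)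

theory Defs
  imports "HOL-Algebra.Module" "HOL-Algebra.Ideal" "HOL-Algebra.Bij" "HOL-Algebra.Generated_Groups"
begin

section \<open>Linear maps, direct sums and duals\<close>

text \<open>The fields \<^const>\<open>mult\<close> and \<^const>\<open>one\<close> of a module record carry no meaning for modules;
  they are left \<^const>\<open>undefined\<close> in the constructions below. As in \<^const>\<open>Bij\<close>, linear maps are
  extensional functions, so that equality of maps is equality on the carrier.\<close>

definition lin_maps ::
  "('a, 'k) ring_scheme \<Rightarrow> ('a, 'b, 'm) module_scheme \<Rightarrow> ('a, 'c, 'n) module_scheme \<Rightarrow> ('b \<Rightarrow> 'c) set"
  where "lin_maps R M N =
    {f \<in> carrier M \<rightarrow>\<^sub>E carrier N.
       (\<forall>x\<in>carrier M. \<forall>y\<in>carrier M. f (x \<oplus>\<^bsub>M\<^esub> y) = f x \<oplus>\<^bsub>N\<^esub> f y) \<and>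
       (\<forall>a\<in>carrier R. \<forall>x\<in>carrier M. f (a \<odot>\<^bsub>M\<^esub> x) = a \<odot>\<^bsub>N\<^esub> f x)}"

definition module_iso ::
  "('a, 'k) ring_scheme \<Rightarrow> ('a, 'b, 'm) module_scheme \<Rightarrow> ('a, 'c, 'n) module_scheme \<Rightarrow> bool"
  where "module_iso R M N \<longleftrightarrow> (\<exists>f\<in>lin_maps R M N. bij_betw f (carrier M) (carrier N))"

definition Aut :: "('a, 'k) ring_scheme \<Rightarrow> ('a, 'b, 'm) module_scheme \<Rightarrow> ('b \<Rightarrow> 'b) monoid"
  where "Aut R M = BijGroup (carrier M) \<lparr>carrier := lin_maps R M M \<inter> Bij (carrier M)\<rparr>"

definition regular_module :: "('a, 'k) ring_scheme \<Rightarrow> ('a, 'a) module"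
  where "regular_module R =
    \<lparr>carrier = carrier R, mult = undefined, one = undefined,
     zero = \<zero>\<^bsub>R\<^esub>, ring.add = (\<oplus>\<^bsub>R\<^esub>), smult = (\<otimes>\<^bsub>R\<^esub>)\<rparr>"

definition module_sum ::
  "('a, 'b, 'm) module_scheme \<Rightarrow> ('a, 'c, 'n) module_scheme \<Rightarrow> ('a, 'b \<times> 'c) module"
  where "module_sum M N =
    \<lparr>carrier = carrier M \<times> carrier N, mult = undefined, one = undefined,
     zero = (\<zero>\<^bsub>M\<^esub>, \<zero>\<^bsub>N\<^esub>),
     add = (\<lambda>(x, y) (x', y'). (x \<oplus>\<^bsub>M\<^esub> x', y \<oplus>\<^bsub>N\<^esub> y')),
     smult = (\<lambda>a (x, y). (a \<odot>\<^bsub>M\<^esub> x, a \<odot>\<^bsub>N\<^esub> y))\<rparr>"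

definition dual_module ::
  "('a, 'k) ring_scheme \<Rightarrow> ('a, 'b, 'm) module_scheme \<Rightarrow> ('a, 'b \<Rightarrow> 'a) module"
  where "dual_module R M =
    \<lparr>carrier = lin_maps R M (regular_module R), mult = undefined, one = undefined,
     zero = (\<lambda>x\<in>carrier M. \<zero>\<^bsub>R\<^esub>),
     add = (\<lambda>f g. \<lambda>x\<in>carrier M. f x \<oplus>\<^bsub>R\<^esub> g x),
     smult = (\<lambda>a f. \<lambda>x\<in>carrier M. a \<otimes>\<^bsub>R\<^esub> f x)\<rparr>"

text \<open>\<open>I M\<close>: the additive subgroup generated by the products \<open>a x\<close> with \<open>a \<in> I\<close> and \<open>x \<in> M\<close>.\<close>

definition ideal_smult :: "'a set \<Rightarrow> ('a, 'b, 'm) module_scheme \<Rightarrow> 'b set"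
  where "ideal_smult I M =
    generate (add_monoid M) {a \<odot>\<^bsub>M\<^esub> x | a x. a \<in> I \<and> x \<in> carrier M}"


section \<open>Finitely generated projective modules\<close>

definition finitely_generated :: "('a, 'k) ring_scheme \<Rightarrow> ('a, 'b, 'm) module_scheme \<Rightarrow> bool"
  where "finitely_generated R M \<longleftrightarrow>
    (\<exists>X. finite X \<and> X \<subseteq> carrier M \<and>
       (\<forall>y\<in>carrier M. \<exists>c\<in>X \<rightarrow> carrier R. y = (\<Oplus>\<^bsub>M\<^esub>x\<in>X. c x \<odot>\<^bsub>M\<^esub> x)))"

text \<open>The free module of finitely supported families in \<open>R\<close> indexed by \<open>J\<close>.\<close>

definition free_module :: "('a, 'k) ring_scheme \<Rightarrow> 'j set \<Rightarrow> ('a, 'j \<Rightarrow> 'a) module"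
  where "free_module R J =
    \<lparr>carrier = {f \<in> J \<rightarrow>\<^sub>E carrier R. finite {j \<in> J. f j \<noteq> \<zero>\<^bsub>R\<^esub>}},
     mult = undefined, one = undefined,
     zero = (\<lambda>j\<in>J. \<zero>\<^bsub>R\<^esub>),
     add = (\<lambda>f g. \<lambda>j\<in>J. f j \<oplus>\<^bsub>R\<^esub> g j),
     smult = (\<lambda>a f. \<lambda>j\<in>J. a \<otimes>\<^bsub>R\<^esub> f j)\<rparr>"

text \<open>\<open>M\<close> is projective iff it is a direct summand of a free module. The types chosen for the
  index set \<open>J\<close> and the complement \<open>Q\<close> are no restriction: if \<open>M\<close> is projective, the canonical
  surjection onto \<open>M\<close> from the free module on the set \<open>carrier M\<close> splits, so that one can take
  \<open>J = carrier M\<close> and for \<open>Q\<close> the kernel of this surjection.\<close>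

definition projective :: "('a, 'k) ring_scheme \<Rightarrow> ('a, 'b, 'm) module_scheme \<Rightarrow> bool"
  where "projective R M \<longleftrightarrow>
    (\<exists>(J :: 'b set) (Q :: ('a, 'b \<Rightarrow> 'a) module).
       module R Q \<and> module_iso R (module_sum M Q) (free_module R J))"


section \<open>Localization and rank\<close>

definition loc_rel ::
  "('a, 'k) ring_scheme \<Rightarrow> 'a set \<Rightarrow> ('a, 'b, 'm) module_scheme \<Rightarrow> (('b \<times> 'a) \<times> ('b \<times> 'a)) set"
  where "loc_rel R S M =
    {((x, s), (y, t)). x \<in> carrier M \<and> s \<in> S \<and> y \<in> carrier M \<and> t \<in> S \<and>
       (\<exists>u\<in>S. u \<odot>\<^bsub>M\<^esub> (t \<odot>\<^bsub>M\<^esub> x) = u \<odot>\<^bsub>M\<^esub> (s \<odot>\<^bsub>M\<^esub> y))}"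

definition fraction ::
  "('a, 'k) ring_scheme \<Rightarrow> 'a set \<Rightarrow> ('a, 'b, 'm) module_scheme \<Rightarrow> 'b \<Rightarrow> 'a \<Rightarrow> ('b \<times> 'a) set"
  where "fraction R S M x s = loc_rel R S M `` {(x, s)}"

text \<open>Operations on fractions are defined as in \<^theory>\<open>HOL.Equiv_Relations\<close>, by a union over all
  representatives; as the operations are well defined, this is a union of equal classes.\<close>

definition loc_ring :: "('a, 'k) ring_scheme \<Rightarrow> 'a set \<Rightarrow> ('a \<times> 'a) set ring"
  where "loc_ring R S =
    (let frac = fraction R S (regular_module R) in
    \<lparr>carrier = (carrier R \<times> S) // loc_rel R S (regular_module R),
     mult = (\<lambda>X Y. \<Union>(a, s)\<in>X. \<Union>(b, t)\<in>Y. frac (a \<otimes>\<^bsub>R\<^esub> b) (s \<otimes>\<^bsub>R\<^esub> t)),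
     one = frac \<one>\<^bsub>R\<^esub> \<one>\<^bsub>R\<^esub>,
     zero = frac \<zero>\<^bsub>R\<^esub> \<one>\<^bsub>R\<^esub>,
     add = (\<lambda>X Y. \<Union>(a, s)\<in>X. \<Union>(b, t)\<in>Y.
       frac (t \<otimes>\<^bsub>R\<^esub> a \<oplus>\<^bsub>R\<^esub> s \<otimes>\<^bsub>R\<^esub> b) (s \<otimes>\<^bsub>R\<^esub> t))\<rparr>)"

definition loc_module ::
  "('a, 'k) ring_scheme \<Rightarrow> 'a set \<Rightarrow> ('a, 'b, 'm) module_scheme \<Rightarrow>
     (('a \<times> 'a) set, ('b \<times> 'a) set) module"
  where "loc_module R S M =
    (let frac = fraction R S M in
    \<lparr>carrier = (carrier M \<times> S) // loc_rel R S M, mult = undefined, one = undefined,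
     zero = frac \<zero>\<^bsub>M\<^esub> \<one>\<^bsub>R\<^esub>,
     add = (\<lambda>X Y. \<Union>(x, s)\<in>X. \<Union>(y, t)\<in>Y.
       frac (t \<odot>\<^bsub>M\<^esub> x \<oplus>\<^bsub>M\<^esub> s \<odot>\<^bsub>M\<^esub> y) (s \<otimes>\<^bsub>R\<^esub> t)),
     smult = (\<lambda>X Y. \<Union>(a, s)\<in>X. \<Union>(y, t)\<in>Y. frac (a \<odot>\<^bsub>M\<^esub> y) (s \<otimes>\<^bsub>R\<^esub> t))\<rparr>)"

definition free_of_rank :: "('a, 'k) ring_scheme \<Rightarrow> ('a, 'b, 'm) module_scheme \<Rightarrow> nat \<Rightarrow> bool"
  where "free_of_rank R M n \<longleftrightarrow> module_iso R M (free_module R {..<n})"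

text \<open>The rank of a finitely generated projective module \<open>M\<close> at a prime \<open>P\<close> is the rank of the
  free \<open>R\<^sub>P\<close>-module \<open>M\<^sub>P\<close>; it need not be the same at all primes.
  That \<open>M\<^sub>P\<close> is free of a unique rank is automatic for such \<open>M\<close>, since \<open>R\<^sub>P\<close> is a local ring.\<close>

definition rank_at_least :: "('a, 'k) ring_scheme \<Rightarrow> ('a, 'b, 'm) module_scheme \<Rightarrow> nat \<Rightarrow> bool"
  where "rank_at_least R M k \<longleftrightarrow>
    (\<forall>P. primeideal P R \<longrightarrow>
       (\<exists>n\<ge>k. free_of_rank (loc_ring R (carrier R - P)) (loc_module R (carrier R - P) M) n))"


section \<open>Elementary transvections\<close>

abbreviation ring_plus ::
  "('a, 'k) ring_scheme \<Rightarrow> ('a, 'b, 'm) module_scheme \<Rightarrow> ('a, 'a \<times> 'b) module"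
  where "ring_plus R M \<equiv> module_sum (regular_module R) M"

definition E_vec ::
  "('a, 'k) ring_scheme \<Rightarrow> ('a, 'b, 'm) module_scheme \<Rightarrow> 'b \<Rightarrow> 'a \<times> 'b \<Rightarrow> 'a \<times> 'b"
  where "E_vec R M x = (\<lambda>(a, p)\<in>carrier (ring_plus R M). (a, p \<oplus>\<^bsub>M\<^esub> a \<odot>\<^bsub>M\<^esub> x))"

definition E_form ::
  "('a, 'k) ring_scheme \<Rightarrow> ('a, 'b, 'm) module_scheme \<Rightarrow> ('b \<Rightarrow> 'a) \<Rightarrow> 'a \<times> 'b \<Rightarrow> 'a \<times> 'b"
  where "E_form R M \<tau> = (\<lambda>(a, p)\<in>carrier (ring_plus R M). (a \<oplus>\<^bsub>R\<^esub> \<tau> p, p))"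

text \<open>In the following, \<open>M\<close> determines \<open>N = R \<oplus> M\<close>: \<open>ETrans R M\<close>, \<open>ETrans_ideal R I M\<close> and
  \<open>ETrans_rel R I M\<close> stand for \<open>ETrans(N)\<close>, \<open>ETrans(IN)\<close> and \<open>ETrans(N, IN)\<close>.\<close>

definition ETrans ::
  "('a, 'k) ring_scheme \<Rightarrow> ('a, 'b, 'm) module_scheme \<Rightarrow> ('a \<times> 'b \<Rightarrow> 'a \<times> 'b) set"
  where "ETrans R M = generate (Aut R (ring_plus R M))
    (E_vec R M ` carrier M \<union> E_form R M ` carrier (dual_module R M))"

definition ETrans_ideal ::
  "('a, 'k) ring_scheme \<Rightarrow> 'a set \<Rightarrow> ('a, 'b, 'm) module_scheme \<Rightarrow> ('a \<times> 'b \<Rightarrow> 'a \<times> 'b) set"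
  where "ETrans_ideal R I M = generate (Aut R (ring_plus R M))
    (E_vec R M ` ideal_smult I M \<union> E_form R M ` ideal_smult I (dual_module R M))"

definition normal_closure :: "('g, 'k) monoid_scheme \<Rightarrow> 'g set \<Rightarrow> 'g set"
  where "normal_closure G H = \<Inter>{K. K \<lhd> G \<and> H \<subseteq> K}"

definition ETrans_rel ::
  "('a, 'k) ring_scheme \<Rightarrow> 'a set \<Rightarrow> ('a, 'b, 'm) module_scheme \<Rightarrow> ('a \<times> 'b \<Rightarrow> 'a \<times> 'b) set"
  where "ETrans_rel R I M =
    normal_closure ((Aut R (ring_plus R M))\<lparr>carrier := ETrans R M\<rparr>) (ETrans_ideal R I M)"

end

theory Submission
  imports Defs
begin

text \<open>
  The group \<open>ETrans(IN)\<close> is generated by transvections \<open>1 + a u \<otimes> \<phi>\<close>, that is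
  \<open>x \<mapsto> x + \<phi>(x) a u\<close>, with \<open>a \<in> I\<close> and \<open>\<phi>(u) = 0\<close>. Here either \<open>\<phi>\<close> is the projection
  \<open>\<pi> : N \<rightarrow> R\<close>, or \<open>u\<close> is the vector \<open>e = (1, 0)\<close>. Conjugation by an automorphism \<open>\<sigma>\<close> gives
  \<open>1 + a \<sigma>(u) \<otimes> \<phi> \<sigma>\<^sup>-\<^sup>1\<close>, in which the form (respectively the vector) is still unimodular.
  So the theorem amounts to: a transvection \<open>1 + a u \<otimes> \<phi>\<close> with \<open>a \<in> I\<close> and one of \<open>\<phi>\<close>, \<open>u\<close>
  unimodular lies in \<open>ETrans(N, IN)\<close> (\<open>rel_unimodular_form\<close>, \<open>rel_unimodular_vec\<close>).

  The tool for membership is the commutator formula \<open>transv_commutator\<close>: if \<open>\<phi>\<close> kills \<open>f\<close> and \<open>u\<close>,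
  and \<open>\<psi>\<close> kills \<open>u\<close>, then \<open>[1 + u \<otimes> \<psi>, 1 + f \<otimes> \<phi>] = 1 + \<psi>(f) u \<otimes> \<phi>\<close>. It
  handles at once all transvections with \<open>\<phi>(e) = 0\<close> (\<open>rel_form_kills_e\<close>) or \<open>\<pi>(u) = 0\<close>
  (\<open>rel_vec_killed_by_\<pi>\<close>). The transvection of a general pair is
  reduced to these by a Koszul relation: if \<open>\<phi>(v) = 1\<close> then \<open>u = \<phi>(v) u - \<phi>(u) v\<close> is the
  contraction of \<open>v \<and> u\<close> with \<open>\<phi>\<close>, and the decomposition
  \<open>\<Lambda>\<^sup>2(R \<oplus> M) = M \<oplus> \<Lambda>\<^sup>2 M\<close> writes \<open>u\<close> as the sum of a vector in \<open>M\<close> and a vector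
  \<open>\<phi>(e) q - \<phi>(q) e\<close> with \<open>q \<in> M\<close>, both killed by \<open>\<phi>\<close>. Dually for forms.

  The vectors \<open>\<phi>(e) q - \<phi>(q) e\<close> are where the rank enters. They depend linearly on \<open>q\<close>, hence the
  \<open>s \<in> R\<close> for which \<open>s (\<phi>(e) q - \<phi>(q) e)\<close> gives elements of \<open>ETrans(N, IN)\<close> form an ideal, and it
  is enough to find one such \<open>s\<close> outside each prime \<open>P\<close>. As \<open>M\<^sub>P\<close> is free of rank \<open>n \<ge> 2\<close>
  and \<open>M\<close> is finitely generated projective, there are \<open>s \<notin> P\<close>, vectors \<open>f\<^sub>i\<close> and
  forms \<open>g\<^sub>i\<close> (\<open>i < n\<close>) with \<open>g\<^sub>i(f\<^sub>j) = s \<delta>\<^sub>i\<^sub>j\<close> and \<open>s q = \<Sum> g\<^sub>i(q) f\<^sub>i\<close>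
  (\<open>basis_lifts\<close>). By linearity one may then take \<open>q = f\<^sub>i\<close>, and a second index \<open>j \<noteq> i\<close>
  supplies a direction \<open>f\<^sub>j\<close> with \<open>g\<^sub>j(f\<^sub>j) = s\<close> in which the vector has no component; the
  commutator formula applied along \<open>f\<^sub>j\<close> shows that \<open>s\<^sup>2\<close> times the vector is good
  (\<open>rel_scaled_vec\<close>, \<open>rel_scaled_form\<close>).
\<close>

section \<open>Automorphisms and transvections of a module\<close>

lemma Aut_carrier: "carrier (Aut R N) = lin_maps R N N \<inter> Bij (carrier N)"
  by (simp add: Aut_def)

lemma Aut_mult:
  "f \<in> carrier (Aut R N) \<Longrightarrow> g \<in> carrier (Aut R N) \<Longrightarrow> f \<otimes>\<^bsub>Aut R N\<^esub> g = compose (carrier N) f g"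
  by (simp add: Aut_def BijGroup_def)

lemma Aut_one: "\<one>\<^bsub>Aut R N\<^esub> = (\<lambda>x\<in>carrier N. x)"
  by (simp add: Aut_def BijGroup_def)

context module
begin

lemma Aut_subgroup: "subgroup (lin_maps R M M \<inter> Bij (carrier M)) (BijGroup (carrier M))"
proof (rule subgroup.intro)
  show "lin_maps R M M \<inter> Bij (carrier M) \<subseteq> carrier (BijGroup (carrier M))"
    by (auto simp: BijGroup_def)
next
  fix f g assume f: "f \<in> lin_maps R M M \<inter> Bij (carrier M)" and g: "g \<in> lin_maps R M M \<inter> Bij (carrier M)"
  have "compose (carrier M) f g \<in> lin_maps R M M"
    using f g by (auto simp: lin_maps_def compose_def PiE_iff)
  with f g show "f \<otimes>\<^bsub>BijGroup (carrier M)\<^esub> g \<in> lin_maps R M M \<inter> Bij (carrier M)"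
    by (simp add: BijGroup_def compose_Bij)
next
  show "\<one>\<^bsub>BijGroup (carrier M)\<^esub> \<in> lin_maps R M M \<inter> Bij (carrier M)"
    using id_Bij[of "carrier M"] by (auto simp: BijGroup_def lin_maps_def)
next
  fix f assume f: "f \<in> lin_maps R M M \<inter> Bij (carrier M)"
  let ?g = "\<lambda>x\<in>carrier M. inv_into (carrier M) f x"
  have B: "f \<in> Bij (carrier M)" using f by simp
  have img: "f ` carrier M = carrier M" and inj: "inj_on f (carrier M)"
    using B by (auto simp: Bij_def bij_betw_def)
  have cl: "inv_into (carrier M) f x \<in> carrier M" if "x \<in> carrier M" for x
    using that B by (rule Bij_inv_into_mem[rotated])
  have hom: "inv_into (carrier M) f (a \<odot>\<^bsub>M\<^esub> x) = a \<odot>\<^bsub>M\<^esub> inv_into (carrier M) f x"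
    if a: "a \<in> carrier R" and x: "x \<in> carrier M" for a x
  proof -
    obtain y where y: "y \<in> carrier M" "x = f y" using x img by blast
    have "a \<odot>\<^bsub>M\<^esub> x = f (a \<odot>\<^bsub>M\<^esub> y)" using f a y by (simp add: lin_maps_def)
    then show ?thesis using y a inj by (simp add: inv_into_f_f)
  qed
  have add: "inv_into (carrier M) f (x \<oplus>\<^bsub>M\<^esub> y) = inv_into (carrier M) f x \<oplus>\<^bsub>M\<^esub> inv_into (carrier M) f y"
    if "x \<in> carrier M" "y \<in> carrier M" for x y
    by (rule Bij_inv_into_lemma) (use f that in \<open>auto simp: lin_maps_def\<close>)
  have "?g \<in> lin_maps R M M"
    using cl hom add by (simp add: lin_maps_def)
  then show "inv\<^bsub>BijGroup (carrier M)\<^esub> f \<in> lin_maps R M M \<inter> Bij (carrier M)"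
    using B by (simp add: inv_BijGroup restrict_inv_into_Bij del: restrict_apply)
qed

lemma Aut_group: "group (Aut R M)"
  unfolding Aut_def by (rule subgroup.subgroup_is_group[OF Aut_subgroup group_BijGroup])

end

text \<open>Unlike the elements of the dual module, forms are not required to be extensional, so that
  multiples, sums and composites with automorphisms are given by plain abstractions.\<close>

definition lin_form :: "('a, 'k) ring_scheme \<Rightarrow> ('a, 'b, 'm) module_scheme \<Rightarrow> ('b \<Rightarrow> 'a) \<Rightarrow> bool"
  where "lin_form R N \<phi> \<longleftrightarrow> \<phi> \<in> carrier N \<rightarrow> carrier R \<and>
    (\<forall>x\<in>carrier N. \<forall>y\<in>carrier N. \<phi> (x \<oplus>\<^bsub>N\<^esub> y) = \<phi> x \<oplus>\<^bsub>R\<^esub> \<phi> y) \<and>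
    (\<forall>a\<in>carrier R. \<forall>x\<in>carrier N. \<phi> (a \<odot>\<^bsub>N\<^esub> x) = a \<otimes>\<^bsub>R\<^esub> \<phi> x)"

definition transv ::
  "('a, 'k) ring_scheme \<Rightarrow> ('a, 'b, 'm) module_scheme \<Rightarrow> ('b \<Rightarrow> 'a) \<Rightarrow> 'b \<Rightarrow> 'b \<Rightarrow> 'b"
  where "transv R N \<phi> u = (\<lambda>x\<in>carrier N. x \<oplus>\<^bsub>N\<^esub> \<phi> x \<odot>\<^bsub>N\<^esub> u)"

context module
begin

lemma lin_form_closed: "lin_form R M \<phi> \<Longrightarrow> x \<in> carrier M \<Longrightarrow> \<phi> x \<in> carrier R"
  by (auto simp: lin_form_def)

lemma lin_form_add:
  "lin_form R M \<phi> \<Longrightarrow> x \<in> carrier M \<Longrightarrow> y \<in> carrier M \<Longrightarrow> \<phi> (x \<oplus>\<^bsub>M\<^esub> y) = \<phi> x \<oplus> \<phi> y"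
  by (simp add: lin_form_def)

lemma lin_form_smult:
  "lin_form R M \<phi> \<Longrightarrow> a \<in> carrier R \<Longrightarrow> x \<in> carrier M \<Longrightarrow> \<phi> (a \<odot>\<^bsub>M\<^esub> x) = a \<otimes> \<phi> x"
  by (simp add: lin_form_def)

lemma lin_form_zero: "lin_form R M \<phi> \<Longrightarrow> \<phi> \<zero>\<^bsub>M\<^esub> = \<zero>"
  using lin_form_smult[of \<phi> \<zero> "\<zero>\<^bsub>M\<^esub>"] lin_form_closed[of \<phi> "\<zero>\<^bsub>M\<^esub>"] by simp

lemma smult_minus_one: "x \<in> carrier M \<Longrightarrow> (\<ominus> \<one>) \<odot>\<^bsub>M\<^esub> x = \<ominus>\<^bsub>M\<^esub> x"
  by (simp add: smult_l_minus)

lemma lin_form_neg: "lin_form R M \<phi> \<Longrightarrow> x \<in> carrier M \<Longrightarrow> \<phi> (\<ominus>\<^bsub>M\<^esub> x) = \<ominus> \<phi> x"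
  using lin_form_smult[of \<phi> "\<ominus> \<one>" x] lin_form_closed[of \<phi> x]
  by (simp add: smult_minus_one R.l_minus)

lemma lin_form_minus:
  "lin_form R M \<phi> \<Longrightarrow> x \<in> carrier M \<Longrightarrow> y \<in> carrier M \<Longrightarrow> \<phi> (x \<ominus>\<^bsub>M\<^esub> y) = \<phi> x \<ominus> \<phi> y"
  by (simp add: a_minus_def lin_form_add lin_form_neg)

lemmas lin_form_simps = lin_form_closed lin_form_add lin_form_smult lin_form_zero lin_form_neg lin_form_minus

lemma lin_form_comb:
  assumes "lin_form R M \<phi>" "lin_form R M \<psi>" "a \<in> carrier R" "b \<in> carrier R"
  shows "lin_form R M (\<lambda>x. a \<otimes> \<phi> x \<oplus> b \<otimes> \<psi> x)"
  using assms unfolding lin_form_def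
  by (auto simp: Pi_iff R.r_distr R.a_ac R.m_ac)

lemma lin_form_scale:
  assumes "lin_form R M \<phi>" "a \<in> carrier R"
  shows "lin_form R M (\<lambda>x. a \<otimes> \<phi> x)"
  using assms unfolding lin_form_def
  by (auto simp: Pi_iff R.r_distr R.m_ac)

lemma lin_form_diff:
  assumes "lin_form R M \<phi>" "lin_form R M \<psi>" "a \<in> carrier R" "b \<in> carrier R"
  shows "lin_form R M (\<lambda>x. a \<otimes> \<phi> x \<ominus> b \<otimes> \<psi> x)"
proof -
  have "lin_form R M (\<lambda>x. a \<otimes> \<phi> x \<oplus> (\<ominus> b) \<otimes> \<psi> x)" by (rule lin_form_comb) (use assms in auto)
  then show ?thesis using assms
    by (auto simp: lin_form_def a_minus_def R.l_minus Pi_iff)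
qed

lemma transv_cong:
  assumes "\<And>x. x \<in> carrier M \<Longrightarrow> \<phi> x \<odot>\<^bsub>M\<^esub> u = \<psi> x \<odot>\<^bsub>M\<^esub> v"
  shows "transv R M \<phi> u = transv R M \<psi> v"
  unfolding transv_def using assms by (intro restrict_ext) simp

lemma transv_scale:
  assumes "lin_form R M \<phi>" "a \<in> carrier R" "u \<in> carrier M"
  shows "transv R M (\<lambda>x. a \<otimes> \<phi> x) u = transv R M \<phi> (a \<odot>\<^bsub>M\<^esub> u)"
  using assms by (intro transv_cong) (simp add: lin_form_closed R.m_comm smult_assoc1[symmetric])

lemma transv_lin_maps:
  assumes "lin_form R M \<phi>" "u \<in> carrier M"
  shows "transv R M \<phi> u \<in> lin_maps R M M"
proof -
  have "x \<oplus>\<^bsub>M\<^esub> y \<oplus>\<^bsub>M\<^esub> (\<phi> x \<oplus> \<phi> y) \<odot>\<^bsub>M\<^esub> u = x \<oplus>\<^bsub>M\<^esub> \<phi> x \<odot>\<^bsub>M\<^esub> u \<oplus>\<^bsub>M\<^esub> (y \<oplus>\<^bsub>M\<^esub> \<phi> y \<odot>\<^bsub>M\<^esub> u)"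
    if "x \<in> carrier M" "y \<in> carrier M" for x y
    using that assms by (simp add: smult_l_distr lin_form_simps M.a_ac)
  then show ?thesis using assms
    by (auto simp: lin_maps_def transv_def lin_form_simps smult_r_distr smult_assoc1)
qed

lemma transv_compose_vec:
  assumes "lin_form R M \<phi>" "u \<in> carrier M" "v \<in> carrier M" "\<phi> v = \<zero>"
  shows "compose (carrier M) (transv R M \<phi> u) (transv R M \<phi> v) = transv R M \<phi> (u \<oplus>\<^bsub>M\<^esub> v)"
  unfolding compose_def transv_def using assms
  by (intro restrict_ext) (simp add: lin_form_simps smult_r_distr M.a_ac)

lemma transv_compose_form:
  assumes "lin_form R M \<phi>" "lin_form R M \<psi>" "u \<in> carrier M" "\<phi> u = \<zero>"
  shows "compose (carrier M) (transv R M \<phi> u) (transv R M \<psi> u) = transv R M (\<lambda>x. \<phi> x \<oplus> \<psi> x) u"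
  unfolding compose_def transv_def using assms
  by (intro restrict_ext) (simp add: lin_form_simps smult_l_distr M.a_ac)

lemma transv_zero: "lin_form R M \<phi> \<Longrightarrow> transv R M \<phi> \<zero>\<^bsub>M\<^esub> = \<one>\<^bsub>Aut R M\<^esub>"
  unfolding transv_def Aut_one by (intro restrict_ext) (simp add: lin_form_closed)

text \<open>Transvections with the same form add up in the vector, so the inverse is the transvection by
  \<open>- u\<close>.\<close>

lemma transv_Aut:
  assumes "lin_form R M \<phi>" "u \<in> carrier M" "\<phi> u = \<zero>"
  shows "transv R M \<phi> u \<in> carrier (Aut R M)"
proof -
  let ?T = "transv R M \<phi> u" and ?S = "transv R M \<phi> (\<ominus>\<^bsub>M\<^esub> u)"
  have lin: "?T \<in> lin_maps R M M" "?S \<in> lin_maps R M M"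
    using assms by (auto intro: transv_lin_maps)
  have "compose (carrier M) ?T ?S = (\<lambda>x\<in>carrier M. x)" "compose (carrier M) ?S ?T = (\<lambda>x\<in>carrier M. x)"
    using assms
    by (simp_all add: transv_compose_vec lin_form_simps M.r_neg M.l_neg transv_zero Aut_one)
  then have "?T (?S x) = x" "?S (?T x) = x" if "x \<in> carrier M" for x
    using that by (metis compose_eq restrict_apply')+
  then have "bij_betw ?T (carrier M) (carrier M)"
    using lin by (intro bij_betw_byWitness[where f' = ?S]) (auto simp: lin_maps_def PiE_iff)
  then show ?thesis using lin by (auto simp: Aut_carrier Bij_def lin_maps_def PiE_iff)
qed

lemma transv_mult_vec:
  assumes "lin_form R M \<phi>" "u \<in> carrier M" "v \<in> carrier M" "\<phi> u = \<zero>" "\<phi> v = \<zero>"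
  shows "transv R M \<phi> u \<otimes>\<^bsub>Aut R M\<^esub> transv R M \<phi> v = transv R M \<phi> (u \<oplus>\<^bsub>M\<^esub> v)"
  using assms by (simp add: Aut_mult transv_Aut transv_compose_vec)

lemma transv_mult_form:
  assumes "lin_form R M \<phi>" "lin_form R M \<psi>" "u \<in> carrier M" "\<phi> u = \<zero>" "\<psi> u = \<zero>"
  shows "transv R M \<phi> u \<otimes>\<^bsub>Aut R M\<^esub> transv R M \<psi> u = transv R M (\<lambda>x. \<phi> x \<oplus> \<psi> x) u"
  using assms by (simp add: Aut_mult transv_Aut transv_compose_form)

text \<open>Among the products of the two rank one operators \<open>u \<otimes> \<psi>\<close> and \<open>f \<otimes> \<phi>\<close>
  only \<open>(u \<otimes> \<psi>)(f \<otimes> \<phi>) = \<psi>(f) u \<otimes> \<phi>\<close> survives the three vanishing conditions, and it is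
  the nontrivial part of the commutator of the two transvections. Without inverses the identity
  compares two composites pointwise.\<close>

lemma transv_commutator:
  assumes \<phi>: "lin_form R M \<phi>" and \<psi>: "lin_form R M \<psi>" and f: "f \<in> carrier M" and u: "u \<in> carrier M"
    and 0: "\<phi> f = \<zero>" "\<phi> u = \<zero>" "\<psi> u = \<zero>"
  shows "transv R M \<psi> u \<otimes>\<^bsub>Aut R M\<^esub> transv R M \<phi> f =
    transv R M \<phi> (\<psi> f \<odot>\<^bsub>M\<^esub> u) \<otimes>\<^bsub>Aut R M\<^esub> (transv R M \<phi> f \<otimes>\<^bsub>Aut R M\<^esub> transv R M \<psi> u)"
proof -
  let ?N = "carrier M"
  have fu: "\<psi> f \<odot>\<^bsub>M\<^esub> u \<in> ?N" "\<phi> (\<psi> f \<odot>\<^bsub>M\<^esub> u) = \<zero>"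
    using assms by (simp_all add: lin_form_simps)
  have A: "transv R M \<psi> u \<in> carrier (Aut R M)" "transv R M \<phi> f \<in> carrier (Aut R M)"
    "transv R M \<phi> (\<psi> f \<odot>\<^bsub>M\<^esub> u) \<in> carrier (Aut R M)"
    using assms fu by (auto intro: transv_Aut)
  have "compose ?N (transv R M \<psi> u) (transv R M \<phi> f) =
      compose ?N (transv R M \<phi> (\<psi> f \<odot>\<^bsub>M\<^esub> u)) (compose ?N (transv R M \<phi> f) (transv R M \<psi> u))"
    unfolding compose_def transv_def using assms fu
    by (intro restrict_ext)
      (simp add: lin_form_simps smult_l_distr smult_r_distr smult_assoc1 M.a_ac)
  moreover have "compose ?N (transv R M \<phi> f) (transv R M \<psi> u) = transv R M \<phi> f \<otimes>\<^bsub>Aut R M\<^esub> transv R M \<psi> u"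
    using A by (simp add: Aut_mult)
  moreover have "transv R M \<phi> f \<otimes>\<^bsub>Aut R M\<^esub> transv R M \<psi> u \<in> carrier (Aut R M)"
    using A by (intro monoid.m_closed group.is_monoid Aut_group)
  ultimately show ?thesis
    by (simp only: Aut_mult[OF A(1,2)] Aut_mult[OF A(3)])
qed

text \<open>The conjugate of \<open>1 + u \<otimes> \<phi>\<close> is \<open>1 + \<sigma>(u) \<otimes> \<phi> \<sigma>\<^sup>-\<^sup>1\<close>. The second conclusion
  serves to evaluate the new form on images under \<open>\<sigma>\<close>.\<close>

lemma transv_conj:
  assumes \<phi>: "lin_form R M \<phi>" and u: "u \<in> carrier M" "\<phi> u = \<zero>" and \<sigma>: "\<sigma> \<in> carrier (Aut R M)"
  shows "lin_form R M (\<lambda>x. \<phi> ((inv\<^bsub>Aut R M\<^esub> \<sigma>) x))"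
    and "\<And>x. x \<in> carrier M \<Longrightarrow> (inv\<^bsub>Aut R M\<^esub> \<sigma>) (\<sigma> x) = x"
    and "\<sigma> \<otimes>\<^bsub>Aut R M\<^esub> transv R M \<phi> u \<otimes>\<^bsub>Aut R M\<^esub> inv\<^bsub>Aut R M\<^esub> \<sigma> =
      transv R M (\<lambda>x. \<phi> ((inv\<^bsub>Aut R M\<^esub> \<sigma>) x)) (\<sigma> u)"
proof -
  interpret A: group "Aut R M" by (rule Aut_group)
  let ?\<tau> = "inv\<^bsub>Aut R M\<^esub> \<sigma>"
  have \<tau>: "?\<tau> \<in> carrier (Aut R M)" using \<sigma> by simp
  have lin: "\<sigma> \<in> lin_maps R M M" "?\<tau> \<in> lin_maps R M M" using \<sigma> \<tau> by (auto simp: Aut_carrier)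
  have cl: "\<sigma> x \<in> carrier M" "?\<tau> x \<in> carrier M" if "x \<in> carrier M" for x
    using lin that by (auto simp: lin_maps_def)
  have "compose (carrier M) ?\<tau> \<sigma> = (\<lambda>x\<in>carrier M. x)" "compose (carrier M) \<sigma> ?\<tau> = (\<lambda>x\<in>carrier M. x)"
    using A.l_inv[OF \<sigma>] A.r_inv[OF \<sigma>] \<sigma> \<tau> by (simp_all add: Aut_mult Aut_one)
  then have inv: "?\<tau> (\<sigma> x) = x" "\<sigma> (?\<tau> x) = x" if "x \<in> carrier M" for x
    using that by (metis compose_eq restrict_apply')+
  show "\<And>x. x \<in> carrier M \<Longrightarrow> ?\<tau> (\<sigma> x) = x" by (rule inv)
  show "lin_form R M (\<lambda>x. \<phi> (?\<tau> x))"
    using \<phi> lin cl by (simp add: lin_form_def lin_maps_def Pi_iff)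
  have T: "transv R M \<phi> u \<in> carrier (Aut R M)" using assms by (auto intro: transv_Aut)
  then have "\<sigma> \<otimes>\<^bsub>Aut R M\<^esub> transv R M \<phi> u \<in> carrier (Aut R M)" using \<sigma> by simp
  then have "\<sigma> \<otimes>\<^bsub>Aut R M\<^esub> transv R M \<phi> u \<otimes>\<^bsub>Aut R M\<^esub> ?\<tau> =
      compose (carrier M) (compose (carrier M) \<sigma> (transv R M \<phi> u)) ?\<tau>"
    using \<sigma> \<tau> T by (simp add: Aut_mult)
  also have "\<dots> = transv R M (\<lambda>x. \<phi> (?\<tau> x)) (\<sigma> u)"
    unfolding compose_def transv_def using lin cl inv u \<phi>
    by (intro restrict_ext) (simp add: lin_maps_def lin_form_closed)
  finally show "\<sigma> \<otimes>\<^bsub>Aut R M\<^esub> transv R M \<phi> u \<otimes>\<^bsub>Aut R M\<^esub> ?\<tau> = transv R M (\<lambda>x. \<phi> (?\<tau> x)) (\<sigma> u)" .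
qed

end

section \<open>Commutators of transvections in the relative elementary group\<close>

text \<open>The direct sum \<open>R \<oplus> M\<close> seen from inside: \<open>M\<close> is the kernel of \<open>\<pi>\<close>, and the forms on \<open>M\<close>
  are the forms on \<open>N\<close> that kill \<open>e\<close>. This makes vectors and forms symmetric. The
  groups \<open>G\<close> and \<open>H\<close> stand for \<open>ETrans(N)\<close> and \<open>ETrans(N, IN)\<close>; of the latter only
  the transvections by simple multiples \<open>a u\<close> with \<open>a \<in> I\<close> are recorded, as these generate \<open>I M\<close>
  additively.\<close>

locale transvection_pair = module R N for R (structure) and N +
  fixes e :: 'c and \<pi> :: "'c \<Rightarrow> 'a" and I :: "'a set" and G H :: "('c \<Rightarrow> 'c) set"
  assumes e: "e \<in> carrier N"
    and \<pi>: "lin_form R N \<pi>"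
    and \<pi>e: "\<pi> e = \<one>"
    and I: "ideal I R"
    and G: "subgroup G (Aut R N)"
    and H: "subgroup H (Aut R N)"
    and HG: "H \<subseteq> G"
    and G_conj_H: "\<lbrakk>k \<in> G; h \<in> H\<rbrakk> \<Longrightarrow> k \<otimes>\<^bsub>Aut R N\<^esub> h \<otimes>\<^bsub>Aut R N\<^esub> inv\<^bsub>Aut R N\<^esub> k \<in> H"
    and vec_G: "\<lbrakk>u \<in> carrier N; \<pi> u = \<zero>\<rbrakk> \<Longrightarrow> transv R N \<pi> u \<in> G"
    and vec_H: "\<lbrakk>u \<in> carrier N; \<pi> u = \<zero>; a \<in> I\<rbrakk> \<Longrightarrow> transv R N \<pi> (a \<odot>\<^bsub>N\<^esub> u) \<in> H"
    and form_G: "\<lbrakk>lin_form R N g; g e = \<zero>\<rbrakk> \<Longrightarrow> transv R N g e \<in> G"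
    and form_H: "\<lbrakk>lin_form R N g; g e = \<zero>; a \<in> I\<rbrakk> \<Longrightarrow> transv R N g (a \<odot>\<^bsub>N\<^esub> e) \<in> H"
begin

lemma I_carrier: "a \<in> I \<Longrightarrow> a \<in> carrier R"
  using I by (simp add: ideal.Icarr)

lemma I_mult: "a \<in> I \<Longrightarrow> r \<in> carrier R \<Longrightarrow> a \<otimes> r \<in> I"
  using I by (simp add: ideal.I_r_closed)

text \<open>With \<open>I = R\<close> the group \<open>G\<close> takes the place of \<open>H\<close>, so that each statement about \<open>H\<close> also
  yields its absolute version for \<open>G\<close>.\<close>

lemma full_pair: "transvection_pair R N e \<pi> (carrier R) G G"
proof (intro transvection_pair.intro transvection_pair_axioms.intro module_axioms)
  show "subgroup G (Aut R N)" "subgroup G (Aut R N)" by (rule G)+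
  show "ideal (carrier R) R" by (rule R.oneideal)
  interpret A: group "Aut R N" by (rule Aut_group)
  show "k \<otimes>\<^bsub>Aut R N\<^esub> h \<otimes>\<^bsub>Aut R N\<^esub> inv\<^bsub>Aut R N\<^esub> k \<in> G" if "k \<in> G" "h \<in> G" for k h
    using that G by (simp add: subgroup_def)
  show "transv R N \<pi> (a \<odot>\<^bsub>N\<^esub> u) \<in> G" if "u \<in> carrier N" "\<pi> u = \<zero>" "a \<in> carrier R" for u a
    using that \<pi> by (intro vec_G) (simp_all add: lin_form_simps)
  show "transv R N g (a \<odot>\<^bsub>N\<^esub> e) \<in> G" if "lin_form R N g" "g e = \<zero>" "a \<in> carrier R" for g a
  proof -
    have "transv R N (\<lambda>x. a \<otimes> g x) e \<in> G"
      using that e by (intro form_G) (simp_all add: lin_form_scale)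
    then show ?thesis using that e by (simp add: transv_scale)
  qed
qed (use e \<pi> \<pi>e vec_G form_G in auto)

text \<open>The equation says \<open>C = B A B\<^sup>-\<^sup>1 A\<^sup>-\<^sup>1\<close>, and \<open>H\<close> is normalised by \<open>G\<close>.\<close>

lemma commutator_in_H:
  assumes eq: "B \<otimes>\<^bsub>Aut R N\<^esub> A = C \<otimes>\<^bsub>Aut R N\<^esub> (A \<otimes>\<^bsub>Aut R N\<^esub> B)"
    and C: "C \<in> carrier (Aut R N)"
    and AB: "A \<in> G \<and> B \<in> H \<or> A \<in> H \<and> B \<in> G"
  shows "C \<in> H"
proof -
  interpret A: group "Aut R N" by (rule Aut_group)
  have cA: "A \<in> carrier (Aut R N)" "B \<in> carrier (Aut R N)"
    using AB subgroup.subset[OF G] subgroup.subset[OF H] by auto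
  have "C = B \<otimes>\<^bsub>Aut R N\<^esub> A \<otimes>\<^bsub>Aut R N\<^esub> inv\<^bsub>Aut R N\<^esub> (A \<otimes>\<^bsub>Aut R N\<^esub> B)"
    using eq C cA by (simp add: A.inv_solve_right)
  then have C1: "C = B \<otimes>\<^bsub>Aut R N\<^esub> (A \<otimes>\<^bsub>Aut R N\<^esub> inv\<^bsub>Aut R N\<^esub> B \<otimes>\<^bsub>Aut R N\<^esub> inv\<^bsub>Aut R N\<^esub> A)"
    and C2: "C = (B \<otimes>\<^bsub>Aut R N\<^esub> A \<otimes>\<^bsub>Aut R N\<^esub> inv\<^bsub>Aut R N\<^esub> B) \<otimes>\<^bsub>Aut R N\<^esub> inv\<^bsub>Aut R N\<^esub> A"
    using cA by (simp_all add: A.inv_mult_group A.m_assoc)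
  from AB show ?thesis
  proof
    assume "A \<in> G \<and> B \<in> H"
    then show ?thesis unfolding C1
      by (intro subgroup.m_closed[OF H] G_conj_H subgroup.m_inv_closed[OF H]) auto
  next
    assume "A \<in> H \<and> B \<in> G"
    then show ?thesis unfolding C2
      by (intro subgroup.m_closed[OF H] G_conj_H subgroup.m_inv_closed[OF H]) auto
  qed
qed

text \<open>Quantifying over all \<open>a \<in> I\<close> makes this condition linear on both sides: for a fixed form it cuts
  out a submodule of the vectors killed by the form, for a fixed vector a submodule of the forms that
  kill it.\<close>

definition rel :: "('c \<Rightarrow> 'a) \<Rightarrow> 'c \<Rightarrow> bool"
  where "rel \<phi> u \<longleftrightarrow> (\<forall>a\<in>I. transv R N \<phi> (a \<odot>\<^bsub>N\<^esub> u) \<in> H)"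

lemma rel_cong:
  assumes "rel \<psi> v" and "\<And>x. x \<in> carrier N \<Longrightarrow> \<phi> x = \<psi> x" and "u = v"
  shows "rel \<phi> u"
proof -
  have "transv R N \<phi> (a \<odot>\<^bsub>N\<^esub> u) = transv R N \<psi> (a \<odot>\<^bsub>N\<^esub> v)" for a
    using assms by (intro transv_cong) simp
  with assms show ?thesis by (simp add: rel_def)
qed

lemma rel_add_vec:
  assumes "rel \<phi> u" "rel \<phi> v" "lin_form R N \<phi>" "u \<in> carrier N" "v \<in> carrier N" "\<phi> u = \<zero>" "\<phi> v = \<zero>"
  shows "rel \<phi> (u \<oplus>\<^bsub>N\<^esub> v)"
  unfolding rel_def
proof
  fix a assume a: "a \<in> I"
  have "transv R N \<phi> (a \<odot>\<^bsub>N\<^esub> u) \<otimes>\<^bsub>Aut R N\<^esub> transv R N \<phi> (a \<odot>\<^bsub>N\<^esub> v) \<in> H"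
    using assms a by (auto intro: subgroup.m_closed[OF H] simp: rel_def)
  then show "transv R N \<phi> (a \<odot>\<^bsub>N\<^esub> (u \<oplus>\<^bsub>N\<^esub> v)) \<in> H"
    using assms I_carrier[OF a] by (simp add: transv_mult_vec lin_form_simps smult_r_distr)
qed

lemma rel_add_form:
  assumes "rel \<phi> u" "rel \<psi> u" "lin_form R N \<phi>" "lin_form R N \<psi>" "u \<in> carrier N" "\<phi> u = \<zero>" "\<psi> u = \<zero>"
  shows "rel (\<lambda>x. \<phi> x \<oplus> \<psi> x) u"
  unfolding rel_def
proof
  fix a assume a: "a \<in> I"
  have "transv R N \<phi> (a \<odot>\<^bsub>N\<^esub> u) \<otimes>\<^bsub>Aut R N\<^esub> transv R N \<psi> (a \<odot>\<^bsub>N\<^esub> u) \<in> H"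
    using assms a by (auto intro: subgroup.m_closed[OF H] simp: rel_def)
  then show "transv R N (\<lambda>x. \<phi> x \<oplus> \<psi> x) (a \<odot>\<^bsub>N\<^esub> u) \<in> H"
    using assms I_carrier[OF a] by (simp add: transv_mult_form lin_form_simps)
qed

lemma rel_smult_vec:
  assumes "rel \<phi> u" "r \<in> carrier R" "u \<in> carrier N"
  shows "rel \<phi> (r \<odot>\<^bsub>N\<^esub> u)"
  using assms by (simp add: rel_def smult_assoc1[symmetric] I_carrier I_mult)

lemma rel_smult_form_iff:
  assumes "r \<in> carrier R" "lin_form R N \<phi>" "u \<in> carrier N"
  shows "rel (\<lambda>x. r \<otimes> \<phi> x) u \<longleftrightarrow> rel \<phi> (r \<odot>\<^bsub>N\<^esub> u)"
proof -
  have "r \<odot>\<^bsub>N\<^esub> (a \<odot>\<^bsub>N\<^esub> u) = a \<odot>\<^bsub>N\<^esub> (r \<odot>\<^bsub>N\<^esub> u)" if "a \<in> I" for a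
    using I_carrier[OF that] assms by (simp add: smult_assoc1[symmetric] R.m_comm)
  then show ?thesis using assms by (simp add: rel_def transv_scale I_carrier)
qed

lemma rel_zero_vec:
  assumes "lin_form R N \<phi>"
  shows "rel \<phi> \<zero>\<^bsub>N\<^esub>"
  using assms subgroup.one_closed[OF H] by (simp add: rel_def transv_zero I_carrier)

lemma rel_zero_form:
  assumes "u \<in> carrier N"
  shows "rel (\<lambda>x. \<zero>) u"
proof -
  have "lin_form R N (\<lambda>x. \<zero>)" by (auto simp: lin_form_def)
  moreover have "transv R N (\<lambda>x. \<zero>) (a \<odot>\<^bsub>N\<^esub> u) = transv R N (\<lambda>x. \<zero>) \<zero>\<^bsub>N\<^esub>" if "a \<in> I" for a
    using that I_carrier[OF that] assms by (intro transv_cong) simp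
  ultimately show ?thesis
    using subgroup.one_closed[OF H] by (simp add: rel_def transv_zero)
qed

text \<open>Subtracting the multiple \<open>\<pi>(u) e\<close>, which is covered by the generators, one may assume
  \<open>\<pi>(u) = 0\<close>. Then \<open>1 + a u \<otimes> g\<close> is the commutator of \<open>1 + a u \<otimes> \<pi>\<close> and \<open>1 + e \<otimes> g\<close>, as
  \<open>\<pi>(e) = 1\<close>.\<close>

lemma rel_form_kills_e:
  assumes g: "lin_form R N g" "g e = \<zero>" and u: "u \<in> carrier N" "g u = \<zero>"
  shows "rel g u"
proof -
  define v where "v = u \<ominus>\<^bsub>N\<^esub> \<pi> u \<odot>\<^bsub>N\<^esub> e"
  note [simp] = lin_form_simps[OF \<pi>] lin_form_simps[OF g(1)] \<pi>e e g(2) u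
  have v: "v \<in> carrier N" "\<pi> v = \<zero>" "g v = \<zero>"
    by (simp_all add: v_def R.minus_eq R.r_neg)
  have "rel g v" unfolding rel_def
  proof
    fix a assume a: "a \<in> I"
    note ac = I_carrier[OF a]
    have "transv R N \<pi> (a \<odot>\<^bsub>N\<^esub> v) \<otimes>\<^bsub>Aut R N\<^esub> transv R N g e =
        transv R N g (\<pi> e \<odot>\<^bsub>N\<^esub> (a \<odot>\<^bsub>N\<^esub> v)) \<otimes>\<^bsub>Aut R N\<^esub> (transv R N g e \<otimes>\<^bsub>Aut R N\<^esub> transv R N \<pi> (a \<odot>\<^bsub>N\<^esub> v))"
      by (rule transv_commutator[OF g(1) \<pi> e]) (use v ac in simp_all)
    then have eq: "transv R N \<pi> (a \<odot>\<^bsub>N\<^esub> v) \<otimes>\<^bsub>Aut R N\<^esub> transv R N g e =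
        transv R N g (a \<odot>\<^bsub>N\<^esub> v) \<otimes>\<^bsub>Aut R N\<^esub> (transv R N g e \<otimes>\<^bsub>Aut R N\<^esub> transv R N \<pi> (a \<odot>\<^bsub>N\<^esub> v))"
      using v ac by simp
    show "transv R N g (a \<odot>\<^bsub>N\<^esub> v) \<in> H"
      by (rule commutator_in_H[OF eq])
        (use v ac a g in \<open>auto intro: transv_Aut vec_H form_G\<close>)
  qed
  moreover have "rel g (\<pi> u \<odot>\<^bsub>N\<^esub> e)"
    by (rule rel_smult_vec) (use form_H g in \<open>auto simp: rel_def\<close>)
  ultimately have "rel g (v \<oplus>\<^bsub>N\<^esub> \<pi> u \<odot>\<^bsub>N\<^esub> e)"
    using v g by (intro rel_add_vec) auto
  moreover have "v \<oplus>\<^bsub>N\<^esub> \<pi> u \<odot>\<^bsub>N\<^esub> e = u"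
    by (simp add: v_def M.minus_eq M.a_assoc M.l_neg)
  ultimately show ?thesis by simp
qed

text \<open>The form is \<open>\<phi>(e) \<pi>\<close> plus a form that kills both \<open>e\<close> and \<open>f\<close>.\<close>

lemma rel_vec_killed_by_\<pi>:
  assumes \<phi>: "lin_form R N \<phi>" and f: "f \<in> carrier N" "\<pi> f = \<zero>" "\<phi> f = \<zero>"
  shows "rel \<phi> f"
proof -
  note [simp] = lin_form_simps[OF \<pi>] lin_form_simps[OF \<phi>] \<pi>e e f
  define \<psi> where "\<psi> x = \<one> \<otimes> \<phi> x \<ominus> \<phi> e \<otimes> \<pi> x" for x
  have \<psi>: "lin_form R N \<psi>"
    unfolding \<psi>_def[abs_def] by (rule lin_form_diff) (use \<phi> \<pi> in auto)
  have v: "\<psi> e = \<zero>" "\<psi> f = \<zero>" by (simp_all add: \<psi>_def R.minus_eq R.r_neg)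
  have "rel \<pi> f" using vec_H by (simp add: rel_def)
  then have "rel (\<lambda>x. \<phi> e \<otimes> \<pi> x) f"
    using \<pi> by (simp add: rel_smult_form_iff rel_smult_vec)
  moreover have "rel \<psi> f" using \<psi> v by (intro rel_form_kills_e) auto
  ultimately have "rel (\<lambda>x. \<phi> e \<otimes> \<pi> x \<oplus> \<psi> x) f"
    using \<psi> v \<pi> by (intro rel_add_form) (auto simp: lin_form_scale)
  moreover have "\<phi> x = \<phi> e \<otimes> \<pi> x \<oplus> \<psi> x" if "x \<in> carrier N" for x
  proof -
    have "\<phi> x \<in> carrier R" "\<phi> e \<in> carrier R" "\<pi> x \<in> carrier R" using that by simp_all
    then show ?thesis unfolding \<psi>_def by algebra
  qed
  ultimately show ?thesis by (rule rel_cong) simp_all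
qed

text \<open>The form \<open>\<psi> = g(f) \<phi> - \<phi>(f) g\<close> kills \<open>f\<close>, so \<open>1 + a g(f) u \<otimes> \<psi>\<close> is the commutator of
  \<open>1 + a u \<otimes> g\<close>, which is in \<open>H\<close>, and \<open>1 + f \<otimes> \<psi>\<close>, which is in \<open>G\<close>. Replacing \<open>\<psi>\<close> by
  \<open>g(f) \<phi>\<close> changes it by a transvection whose form kills \<open>e\<close>.\<close>

lemma rel_scaled_vec:
  assumes \<phi>: "lin_form R N \<phi>" and u: "u \<in> carrier N" "\<phi> u = \<zero>"
    and f: "f \<in> carrier N" "\<pi> f = \<zero>" and g: "lin_form R N g" "g e = \<zero>" and gu: "g u = \<zero>"
  shows "rel \<phi> ((g f \<otimes> g f) \<odot>\<^bsub>N\<^esub> u)"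
proof -
  interpret full: transvection_pair R N e \<pi> "carrier R" G G by (rule full_pair)
  note [simp] = lin_form_simps[OF \<pi>] lin_form_simps[OF \<phi>] lin_form_simps[OF g(1)] \<pi>e e f u gu
  define \<psi> where "\<psi> x = g f \<otimes> \<phi> x \<ominus> \<phi> f \<otimes> g x" for x
  have \<psi>: "lin_form R N \<psi>"
    unfolding \<psi>_def[abs_def] by (rule lin_form_diff) (use \<phi> g in auto)
  note [simp] = lin_form_simps[OF \<psi>]
  have v: "\<psi> u = \<zero>" by (simp add: \<psi>_def R.minus_eq)
  have vf: "\<psi> f = \<zero>" by (simp add: \<psi>_def R.minus_eq R.m_comm R.r_neg)
  have "full.rel \<psi> f" using \<psi> vf by (intro full.rel_vec_killed_by_\<pi>) auto
  then have TG: "transv R N \<psi> f \<in> G" by (auto simp: full.rel_def dest: bspec[of _ _ \<one>])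
  have g_u: "rel g u" using g by (intro rel_form_kills_e) auto
  have "rel \<psi> (g f \<odot>\<^bsub>N\<^esub> u)" unfolding rel_def
  proof
    fix a assume a: "a \<in> I"
    note ac = I_carrier[OF a]
    have "transv R N g (a \<odot>\<^bsub>N\<^esub> u) \<otimes>\<^bsub>Aut R N\<^esub> transv R N \<psi> f =
        transv R N \<psi> (g f \<odot>\<^bsub>N\<^esub> (a \<odot>\<^bsub>N\<^esub> u)) \<otimes>\<^bsub>Aut R N\<^esub> (transv R N \<psi> f \<otimes>\<^bsub>Aut R N\<^esub> transv R N g (a \<odot>\<^bsub>N\<^esub> u))"
      by (rule transv_commutator[OF \<psi> g(1) f(1)]) (use ac v vf in simp_all)
    moreover have "g f \<odot>\<^bsub>N\<^esub> (a \<odot>\<^bsub>N\<^esub> u) = a \<odot>\<^bsub>N\<^esub> (g f \<odot>\<^bsub>N\<^esub> u)"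
      using ac by (simp add: smult_assoc1[symmetric] R.m_comm)
    ultimately have eq: "transv R N g (a \<odot>\<^bsub>N\<^esub> u) \<otimes>\<^bsub>Aut R N\<^esub> transv R N \<psi> f =
        transv R N \<psi> (a \<odot>\<^bsub>N\<^esub> (g f \<odot>\<^bsub>N\<^esub> u)) \<otimes>\<^bsub>Aut R N\<^esub> (transv R N \<psi> f \<otimes>\<^bsub>Aut R N\<^esub> transv R N g (a \<odot>\<^bsub>N\<^esub> u))"
      by simp
    show "transv R N \<psi> (a \<odot>\<^bsub>N\<^esub> (g f \<odot>\<^bsub>N\<^esub> u)) \<in> H"
      by (rule commutator_in_H[OF eq])
        (use v ac a \<psi> TG g_u in \<open>auto intro: transv_Aut simp: rel_def\<close>)
  qed
  moreover have "rel (\<lambda>x. \<phi> f \<otimes> g x) (g f \<odot>\<^bsub>N\<^esub> u)"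
    using g g_u by (simp add: rel_smult_form_iff rel_smult_vec)
  ultimately have "rel (\<lambda>x. \<psi> x \<oplus> \<phi> f \<otimes> g x) (g f \<odot>\<^bsub>N\<^esub> u)"
    using \<psi> v g by (intro rel_add_form) (auto simp: lin_form_scale)
  moreover have "g f \<otimes> \<phi> x = \<psi> x \<oplus> \<phi> f \<otimes> g x" if "x \<in> carrier N" for x
  proof -
    have "\<phi> x \<in> carrier R" "\<phi> f \<in> carrier R" "g x \<in> carrier R" "g f \<in> carrier R" using that by simp_all
    then show ?thesis unfolding \<psi>_def by algebra
  qed
  ultimately have "rel (\<lambda>x. g f \<otimes> \<phi> x) (g f \<odot>\<^bsub>N\<^esub> u)" by (rule rel_cong) simp_all
  then show ?thesis using \<phi> by (simp add: rel_smult_form_iff smult_assoc1)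
qed

text \<open>The dual of the preceding lemma, with the roles of \<open>f\<close> and \<open>g\<close> exchanged: the vector
  \<open>w = g(f) u - g(u) f\<close> is killed by \<open>g\<close>, so \<open>1 + a g(f) w \<otimes> \<phi>\<close> is the commutator of
  \<open>1 + w \<otimes> g\<close>, which is in \<open>G\<close>, and \<open>1 + a f \<otimes> \<phi>\<close>, which is in \<open>H\<close>. It differs from \<open>g(f) u\<close> by
  a multiple of \<open>f\<close>, which is killed by \<open>\<pi>\<close> and \<open>\<phi>\<close>.\<close>

lemma rel_scaled_form:
  assumes \<phi>: "lin_form R N \<phi>" and u: "u \<in> carrier N" "\<phi> u = \<zero>"
    and f: "f \<in> carrier N" "\<pi> f = \<zero>" and g: "lin_form R N g" "g e = \<zero>" and \<phi>f: "\<phi> f = \<zero>"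
  shows "rel \<phi> ((g f \<otimes> g f) \<odot>\<^bsub>N\<^esub> u)"
proof -
  interpret full: transvection_pair R N e \<pi> "carrier R" G G by (rule full_pair)
  note [simp] = lin_form_simps[OF \<pi>] lin_form_simps[OF \<phi>] lin_form_simps[OF g(1)] \<pi>e e f u \<phi>f
  define w where "w = g f \<odot>\<^bsub>N\<^esub> u \<ominus>\<^bsub>N\<^esub> g u \<odot>\<^bsub>N\<^esub> f"
  have w: "w \<in> carrier N" "\<phi> w = \<zero>" by (simp_all add: w_def R.minus_eq)
  have gw: "g w = \<zero>" by (simp add: w_def R.minus_eq R.m_comm R.r_neg)
  have "full.rel g w" using g w gw by (intro full.rel_form_kills_e) auto
  then have TG: "transv R N g w \<in> G" using w by (auto simp: full.rel_def dest: bspec[of _ _ \<one>])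
  have \<phi>_f: "rel \<phi> f" using \<phi> by (intro rel_vec_killed_by_\<pi>) auto
  have "rel \<phi> (g f \<odot>\<^bsub>N\<^esub> w)" unfolding rel_def
  proof
    fix a assume a: "a \<in> I"
    note ac = I_carrier[OF a]
    have "transv R N g w \<otimes>\<^bsub>Aut R N\<^esub> transv R N \<phi> (a \<odot>\<^bsub>N\<^esub> f) =
        transv R N \<phi> (g (a \<odot>\<^bsub>N\<^esub> f) \<odot>\<^bsub>N\<^esub> w) \<otimes>\<^bsub>Aut R N\<^esub> (transv R N \<phi> (a \<odot>\<^bsub>N\<^esub> f) \<otimes>\<^bsub>Aut R N\<^esub> transv R N g w)"
      by (rule transv_commutator[OF \<phi> g(1)]) (use ac w gw in simp_all)
    then have eq: "transv R N g w \<otimes>\<^bsub>Aut R N\<^esub> transv R N \<phi> (a \<odot>\<^bsub>N\<^esub> f) =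
        transv R N \<phi> (a \<odot>\<^bsub>N\<^esub> (g f \<odot>\<^bsub>N\<^esub> w)) \<otimes>\<^bsub>Aut R N\<^esub> (transv R N \<phi> (a \<odot>\<^bsub>N\<^esub> f) \<otimes>\<^bsub>Aut R N\<^esub> transv R N g w)"
      using ac w by (simp add: smult_assoc1)
    show "transv R N \<phi> (a \<odot>\<^bsub>N\<^esub> (g f \<odot>\<^bsub>N\<^esub> w)) \<in> H"
      by (rule commutator_in_H[OF eq])
        (use w ac a \<phi> TG \<phi>_f in \<open>auto intro: transv_Aut simp: rel_def\<close>)
  qed
  moreover have "rel \<phi> ((g f \<otimes> g u) \<odot>\<^bsub>N\<^esub> f)"
    using \<phi>_f by (simp add: rel_smult_vec)
  ultimately have "rel \<phi> (g f \<odot>\<^bsub>N\<^esub> w \<oplus>\<^bsub>N\<^esub> (g f \<otimes> g u) \<odot>\<^bsub>N\<^esub> f)"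
    using \<phi> w by (intro rel_add_vec) auto
  moreover have "g f \<odot>\<^bsub>N\<^esub> w \<oplus>\<^bsub>N\<^esub> (g f \<otimes> g u) \<odot>\<^bsub>N\<^esub> f = g f \<odot>\<^bsub>N\<^esub> (w \<oplus>\<^bsub>N\<^esub> g u \<odot>\<^bsub>N\<^esub> f)"
    using w by (simp add: smult_assoc1 smult_r_distr)
  moreover have "w \<oplus>\<^bsub>N\<^esub> g u \<odot>\<^bsub>N\<^esub> f = g f \<odot>\<^bsub>N\<^esub> u"
    by (simp add: w_def M.minus_eq M.a_assoc M.l_neg)
  ultimately show ?thesis by (simp add: smult_assoc1)
qed

end

section \<open>Reduction to prime ideals and the Koszul relation\<close>

text \<open>By Zorn's lemma there is a maximal one among the ideals that contain \<open>J\<close> but not \<open>1\<close>.\<close>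

lemma (in cring) proper_ideal_subset_prime:
  assumes J: "ideal J R" and ne: "J \<noteq> carrier R"
  shows "\<exists>P. primeideal P R \<and> J \<subseteq> P"
proof -
  let ?A = "{K. ideal K R \<and> J \<subseteq> K \<and> \<one> \<notin> K}"
  have one: "\<one> \<notin> K \<longleftrightarrow> K \<noteq> carrier R" if "ideal K R" for K
    using that by (metis ideal.one_imp_carrier one_closed)
  have "\<exists>P\<in>?A. \<forall>X\<in>?A. P \<subseteq> X \<longrightarrow> X = P"
  proof (rule subset_Zorn_nonempty)
    show "?A \<noteq> {}" using J ne one by blast
    fix C assume C: "C \<noteq> {}" "subset.chain ?A C"
    have idl: "ideal K R" if "K \<in> C" for K using C that by (auto simp: subset.chain_def)
    obtain K0 where K0: "K0 \<in> C" using C by blast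
    have comp: "\<exists>K\<in>C. x \<in> K \<and> y \<in> K" if xy: "x \<in> \<Union>C" "y \<in> \<Union>C" for x y
    proof -
      obtain K L where KL: "K \<in> C" "L \<in> C" "x \<in> K" "y \<in> L" using xy by blast
      have "K \<subseteq> L \<or> L \<subseteq> K" using C KL by (auto simp: subset.chain_def)
      then show ?thesis using KL by blast
    qed
    have ag: "K \<subseteq> carrier R" "\<zero> \<in> K" "\<And>x y. x \<in> K \<Longrightarrow> y \<in> K \<Longrightarrow> x \<oplus> y \<in> K"
      "\<And>x. x \<in> K \<Longrightarrow> \<ominus> x \<in> K" if "K \<in> C" for K
    proof -
      interpret ideal K R by (rule idl[OF that])
      show "K \<subseteq> carrier R" "\<zero> \<in> K" "\<And>x y. x \<in> K \<Longrightarrow> y \<in> K \<Longrightarrow> x \<oplus> y \<in> K"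
        "\<And>x. x \<in> K \<Longrightarrow> \<ominus> x \<in> K" by (auto simp: a_subset)
    qed
    have "ideal (\<Union>C) R"
    proof (rule idealI[OF ring_axioms])
      show "subgroup (\<Union>C) (add_monoid R)"
      proof (rule group.subgroupI[OF a_group])
        show "\<Union>C \<subseteq> carrier (add_monoid R)" using ag by auto
        show "\<Union>C \<noteq> {}" using K0 ag by blast
        show "\<And>a. a \<in> \<Union>C \<Longrightarrow> inv\<^bsub>add_monoid R\<^esub> a \<in> \<Union>C" using ag(4) by (auto simp: a_inv_def)
        show "\<And>a b. a \<in> \<Union>C \<Longrightarrow> b \<in> \<Union>C \<Longrightarrow> a \<otimes>\<^bsub>add_monoid R\<^esub> b \<in> \<Union>C"
          using comp ag(3) by (metis UnionI monoid.simps(1))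
      qed
      show "\<And>a x. a \<in> \<Union>C \<Longrightarrow> x \<in> carrier R \<Longrightarrow> x \<otimes> a \<in> \<Union>C"
        using idl ideal.I_l_closed by fastforce
      show "\<And>a x. a \<in> \<Union>C \<Longrightarrow> x \<in> carrier R \<Longrightarrow> a \<otimes> x \<in> \<Union>C"
        using idl ideal.I_r_closed by fastforce
    qed
    moreover have "J \<subseteq> \<Union>C" "\<one> \<notin> \<Union>C" using C K0 unfolding subset.chain_def by blast+
    ultimately show "\<Union>C \<in> ?A" by simp
  qed
  then obtain P where "P \<in> ?A" and max: "\<forall>X\<in>?A. P \<subseteq> X \<longrightarrow> X = P" by (rule bexE)
  then have P: "ideal P R" "J \<subseteq> P" "\<one> \<notin> P" by auto
  have "maximalideal P R"
  proof (rule maximalidealI[OF P(1)])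
    show "carrier R \<noteq> P" using P by auto
    fix X assume X: "ideal X R" "P \<subseteq> X" "X \<subseteq> carrier R"
    show "X = P \<or> X = carrier R" using bspec[OF max, of X] X P one[of X] by auto
  qed
  then show ?thesis using P maximalideal_prime by blast
qed

context transvection_pair
begin

text \<open>The \<open>r\<close> for which \<open>r u\<close> satisfies the condition form an ideal, which by assumption lies
  in no prime ideal.\<close>

lemma rel_local_global:
  assumes \<phi>: "lin_form R N \<phi>" and u: "u \<in> carrier N" "\<phi> u = \<zero>"
    and loc: "\<And>P. primeideal P R \<Longrightarrow> \<exists>s\<in>carrier R - P. rel \<phi> (s \<odot>\<^bsub>N\<^esub> u)"
  shows "rel \<phi> u"
proof -
  let ?J = "{r \<in> carrier R. rel \<phi> (r \<odot>\<^bsub>N\<^esub> u)}"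
  have mult: "rel \<phi> ((x \<otimes> r) \<odot>\<^bsub>N\<^esub> u)" if "rel \<phi> (r \<odot>\<^bsub>N\<^esub> u)" "r \<in> carrier R" "x \<in> carrier R" for r x
    using that u by (simp add: smult_assoc1 rel_smult_vec)
  have J: "ideal ?J R"
  proof (rule idealI[OF R.ring_axioms])
    show "subgroup ?J (add_monoid R)"
    proof (rule group.subgroupI[OF R.a_group])
      show "?J \<noteq> {}" using \<phi> u by (auto simp: rel_zero_vec intro: exI[of _ \<zero>])
      show "inv\<^bsub>add_monoid R\<^esub> a \<in> ?J" if "a \<in> ?J" for a
        using that mult[of a "\<ominus> \<one>"] by (simp add: a_inv_def[symmetric] R.l_minus)
      show "a \<otimes>\<^bsub>add_monoid R\<^esub> b \<in> ?J" if "a \<in> ?J" "b \<in> ?J" for a b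
        using that \<phi> u by (auto simp: smult_l_distr lin_form_simps intro!: rel_add_vec)
    qed auto
  qed (use mult in \<open>auto simp: R.m_comm\<close>)
  have "?J = carrier R"
  proof (rule ccontr)
    assume "?J \<noteq> carrier R"
    then obtain P where P: "primeideal P R" "?J \<subseteq> P"
      using R.proper_ideal_subset_prime[OF J] by blast
    with loc[OF P(1)] show False by blast
  qed
  then have "rel \<phi> (\<one> \<odot>\<^bsub>N\<^esub> u)" by auto
  then show ?thesis using u by simp
qed

text \<open>A basis of the kernel of \<open>\<pi>\<close> and the dual basis, after inverting \<open>s\<close> and clearing
  denominators.\<close>

definition chart :: "'a \<Rightarrow> nat \<Rightarrow> (nat \<Rightarrow> 'c) \<Rightarrow> (nat \<Rightarrow> 'c \<Rightarrow> 'a) \<Rightarrow> bool"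
  where "chart s n f g \<longleftrightarrow> s \<in> carrier R \<and>
    (\<forall>i<n. f i \<in> carrier N \<and> \<pi> (f i) = \<zero> \<and> lin_form R N (g i) \<and> g i e = \<zero>) \<and>
    (\<forall>i<n. \<forall>j<n. g i (f j) = (if i = j then s else \<zero>)) \<and>
    (\<forall>q\<in>carrier N. \<pi> q = \<zero> \<longrightarrow> s \<odot>\<^bsub>N\<^esub> q = (\<Oplus>\<^bsub>N\<^esub>i\<in>{..<n}. g i q \<odot>\<^bsub>N\<^esub> f i))"

text \<open>As the vector \<open>k q = \<phi>(e) q - \<phi>(q) e\<close> is linear in \<open>q\<close>, the expansion of \<open>s q\<close> reduces the
  claim to \<open>q = f\<^sub>i\<close>. There \<open>g\<^sub>j\<close> kills \<open>k f\<^sub>i\<close> for any \<open>j \<noteq> i\<close>, and \<open>rel_scaled_vec\<close> applies to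
  the pair \<open>f\<^sub>j\<close>, \<open>g\<^sub>j\<close>. One factor \<open>s\<close> comes from the expansion, two from that lemma.\<close>

lemma chart_rel_vec:
  assumes c: "chart s n f g" and n: "n \<ge> 2" and \<phi>: "lin_form R N \<phi>"
    and q: "q \<in> carrier N" "\<pi> q = \<zero>"
  shows "rel \<phi> ((s \<otimes> s \<otimes> s) \<odot>\<^bsub>N\<^esub> (\<phi> e \<odot>\<^bsub>N\<^esub> q \<ominus>\<^bsub>N\<^esub> \<phi> q \<odot>\<^bsub>N\<^esub> e))"
proof -
  note [simp] = lin_form_simps[OF \<pi>] lin_form_simps[OF \<phi>] \<pi>e e
  define k where "k q = \<phi> e \<odot>\<^bsub>N\<^esub> q \<ominus>\<^bsub>N\<^esub> \<phi> q \<odot>\<^bsub>N\<^esub> e" for q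
  have s [simp]: "s \<in> carrier R" using c by (simp add: chart_def)
  have k [simp]: "k x \<in> carrier N" "\<phi> (k x) = \<zero>" if "x \<in> carrier N" for x
    using that by (simp_all add: k_def R.minus_eq R.m_comm R.r_neg)
  have k_add: "k (x \<oplus>\<^bsub>N\<^esub> y) = k x \<oplus>\<^bsub>N\<^esub> k y" if "x \<in> carrier N" "y \<in> carrier N" for x y
    using that by (simp add: k_def M.minus_eq smult_l_distr smult_r_distr M.minus_add M.a_ac)
  have k_smult: "k (r \<odot>\<^bsub>N\<^esub> x) = r \<odot>\<^bsub>N\<^esub> k x" if "x \<in> carrier N" "r \<in> carrier R" for r x
    using that by (simp add: k_def M.minus_eq smult_r_distr smult_r_minus smult_assoc1[symmetric] R.m_comm)
  define P where "P x \<longleftrightarrow> rel \<phi> ((s \<otimes> s) \<odot>\<^bsub>N\<^esub> k x)" for x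
  have P_f: "P (f i)" if i: "i < n" for i
  proof -
    obtain j where j: "j < n" "j \<noteq> i" 
      using n by (intro that[of "if i = 0 then 1 else 0"]) auto
    have "rel \<phi> ((g j (f j) \<otimes> g j (f j)) \<odot>\<^bsub>N\<^esub> k (f i))"
    proof (rule rel_scaled_vec[OF \<phi>])
      have "lin_form R N (g j)" using c j by (simp add: chart_def)
      note [simp] = lin_form_simps[OF this]
      show "g j (k (f i)) = \<zero>"
        using c i j by (simp add: k_def chart_def R.minus_eq)
    qed (use c i j in \<open>simp_all add: chart_def\<close>)
    then show ?thesis using c j by (simp add: P_def chart_def)
  qed
  have P_smult: "P (r \<odot>\<^bsub>N\<^esub> x)" if "P x" "x \<in> carrier N" "r \<in> carrier R" for r x
  proof -
    have "(s \<otimes> s) \<odot>\<^bsub>N\<^esub> k (r \<odot>\<^bsub>N\<^esub> x) = r \<odot>\<^bsub>N\<^esub> ((s \<otimes> s) \<odot>\<^bsub>N\<^esub> k x)"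
      using that by (simp add: k_smult smult_assoc1[symmetric] R.m_ac)
    then show ?thesis using that by (simp add: P_def rel_smult_vec)
  qed
  have P_add: "P (x \<oplus>\<^bsub>N\<^esub> y)" if "P x" "P y" "x \<in> carrier N" "y \<in> carrier N" for x y
    using that \<phi> by (auto simp: P_def k_add smult_r_distr intro!: rel_add_vec)
  have P_zero: "P \<zero>\<^bsub>N\<^esub>"
    using rel_zero_vec[OF \<phi>] k_smult[of "\<zero>\<^bsub>N\<^esub>" \<zero>] by (simp add: P_def)
  have "P (\<Oplus>\<^bsub>N\<^esub>i\<in>A. g i q \<odot>\<^bsub>N\<^esub> f i)" if "finite A" "A \<subseteq> {..<n}" for A
    using that
  proof (induction A rule: finite_induct)
    case empty
    then show ?case by (simp add: P_zero)
  next
    case (insert i A)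
    have cl: "g i q \<in> carrier R" "f i \<in> carrier N" if "i < n" for i
      using c that q by (auto simp: chart_def lin_form_closed)
    have "(\<lambda>i. g i q \<odot>\<^bsub>N\<^esub> f i) \<in> A \<rightarrow> carrier N" using insert.prems cl by auto
    with insert cl show ?case by (auto intro!: P_add P_smult P_f M.finsum_closed)
  qed
  then have "P (s \<odot>\<^bsub>N\<^esub> q)" using c q by (simp add: chart_def)
  then show ?thesis using q by (simp add: P_def k_smult smult_assoc1[symmetric] k_def[symmetric])
qed

text \<open>The dual of the preceding lemma: on \<open>N\<close> one has \<open>s \<chi> = \<Sum> \<chi>(f\<^sub>i) g\<^sub>i\<close>, as both sides kill \<open>e\<close>,
  and the form \<open>\<pi>(u) g\<^sub>i - g\<^sub>i(u) \<pi>\<close> kills \<open>f\<^sub>j\<close> for \<open>j \<noteq> i\<close>.\<close>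

lemma chart_rel_form:
  assumes c: "chart s n f g" and n: "n \<ge> 2" and \<chi>: "lin_form R N \<chi>" "\<chi> e = \<zero>"
    and u: "u \<in> carrier N"
  shows "rel (\<lambda>x. \<pi> u \<otimes> \<chi> x \<ominus> \<chi> u \<otimes> \<pi> x) ((s \<otimes> s \<otimes> s) \<odot>\<^bsub>N\<^esub> u)"
proof -
  note [simp] = lin_form_simps[OF \<pi>] lin_form_simps[OF \<chi>(1)] \<pi>e e u \<chi>
  define k where "k \<psi> x = \<pi> u \<otimes> \<psi> x \<ominus> \<psi> u \<otimes> \<pi> x" for \<psi> x
  have s [simp]: "s \<in> carrier R" using c by (simp add: chart_def)
  have k: "lin_form R N (k \<psi>)" "k \<psi> u = \<zero>" if "lin_form R N \<psi>" for \<psi>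
  proof -
    show "lin_form R N (k \<psi>)" unfolding k_def[abs_def]
      by (rule lin_form_diff) (use that \<pi> in \<open>auto simp: lin_form_simps\<close>)
    show "k \<psi> u = \<zero>" using lin_form_closed[OF that] by (simp add: k_def R.minus_eq R.m_comm R.r_neg)
  qed
  define P where "P \<psi> \<longleftrightarrow> rel (k \<psi>) ((s \<otimes> s) \<odot>\<^bsub>N\<^esub> u)" for \<psi>
  have gf: "lin_form R N (g i)" "g i e = \<zero>" "f i \<in> carrier N" "\<pi> (f i) = \<zero>" if "i < n" for i
    using c that by (auto simp: chart_def)
  have P_g: "P (g i)" if i: "i < n" for i
  proof -
    obtain j where j: "j < n" "j \<noteq> i" 
      using n by (intro that[of "if i = 0 then 1 else 0"]) auto
    have "rel (k (g i)) ((g j (f j) \<otimes> g j (f j)) \<odot>\<^bsub>N\<^esub> u)"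
    proof (rule rel_scaled_form)
      show "k (g i) (f j) = \<zero>"
        using c i j lin_form_closed[OF gf(1)[OF i]] by (simp add: k_def chart_def R.minus_eq)
    qed (use i j gf k in simp_all)
    then show ?thesis using c j by (simp add: P_def chart_def)
  qed
  have P_scale: "P (\<lambda>x. r \<otimes> \<psi> x)" if "P \<psi>" "lin_form R N \<psi>" "r \<in> carrier R" for r \<psi>
  proof -
    note [simp] = lin_form_simps[OF that(2)]
    have "rel (\<lambda>x. r \<otimes> k \<psi> x) ((s \<otimes> s) \<odot>\<^bsub>N\<^esub> u)"
      using that k by (auto simp: rel_smult_form_iff rel_smult_vec P_def)
    moreover have "k (\<lambda>x. r \<otimes> \<psi> x) x = r \<otimes> k \<psi> x" if "x \<in> carrier N" for x
    proof -
      have "\<psi> x \<in> carrier R" "\<psi> u \<in> carrier R" "\<pi> x \<in> carrier R" "\<pi> u \<in> carrier R" using that by simp_all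
      then show ?thesis unfolding k_def using \<open>r \<in> carrier R\<close> by algebra
    qed
    ultimately show ?thesis unfolding P_def by (rule rel_cong) simp_all
  qed
  have P_add: "P (\<lambda>x. \<psi> x \<oplus> \<omega> x)" if "P \<psi>" "P \<omega>" "lin_form R N \<psi>" "lin_form R N \<omega>" for \<psi> \<omega>
  proof -
    note [simp] = lin_form_simps[OF that(3)] lin_form_simps[OF that(4)]
    have "rel (\<lambda>x. k \<psi> x \<oplus> k \<omega> x) ((s \<otimes> s) \<odot>\<^bsub>N\<^esub> u)"
      by (rule rel_add_form) (use that k in \<open>auto simp: P_def lin_form_simps\<close>)
    moreover have "k (\<lambda>x. \<psi> x \<oplus> \<omega> x) x = k \<psi> x \<oplus> k \<omega> x" if "x \<in> carrier N" for x
    proof -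
      have "\<psi> x \<in> carrier R" "\<psi> u \<in> carrier R" "\<pi> x \<in> carrier R" "\<pi> u \<in> carrier R"
        "\<omega> x \<in> carrier R" "\<omega> u \<in> carrier R" using that by simp_all
      then show ?thesis unfolding k_def by algebra
    qed
    ultimately show ?thesis unfolding P_def by (rule rel_cong) simp_all
  qed
  have "rel (\<lambda>x. \<zero>) ((s \<otimes> s) \<odot>\<^bsub>N\<^esub> u)" by (rule rel_zero_form) simp
  then have P_zero: "P (\<lambda>x. \<zero>)"
    unfolding P_def by (rule rel_cong) (simp_all add: k_def R.minus_eq)
  have P_cong: "P \<psi>" if "P \<omega>" "\<And>x. x \<in> carrier N \<Longrightarrow> \<psi> x = \<omega> x" for \<psi> \<omega>
    using that(1) unfolding P_def by (rule rel_cong) (simp_all add: k_def that(2))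
  have "P (\<lambda>x. \<Oplus>i\<in>A. \<chi> (f i) \<otimes> g i x) \<and> lin_form R N (\<lambda>x. \<Oplus>i\<in>A. \<chi> (f i) \<otimes> g i x)"
    if "finite A" "A \<subseteq> {..<n}" for A
    using that
  proof (induction A rule: finite_induct)
    case empty
    then show ?case by (simp add: P_zero lin_form_def)
  next
    case (insert i A)
    have i: "i < n" using insert.prems by auto
    let ?S = "\<lambda>x. \<Oplus>i\<in>A. \<chi> (f i) \<otimes> g i x"
    have *: "P ?S" "lin_form R N ?S" using insert by auto
    have eq: "(\<Oplus>i\<in>insert i A. \<chi> (f i) \<otimes> g i x) = \<chi> (f i) \<otimes> g i x \<oplus> ?S x" if x: "x \<in> carrier N" for x
      using insert.hyps insert.prems gf x by (subst R.finsum_insert) (auto simp: lin_form_closed)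
    have lin: "lin_form R N (\<lambda>x. \<chi> (f i) \<otimes> g i x)" using gf i by (auto intro: lin_form_scale)
    have "P (\<lambda>x. \<chi> (f i) \<otimes> g i x \<oplus> ?S x)"
      using * lin i gf by (intro P_add P_scale P_g) auto
    moreover have "lin_form R N (\<lambda>x. \<one> \<otimes> (\<chi> (f i) \<otimes> g i x) \<oplus> \<one> \<otimes> ?S x)"
      by (rule lin_form_comb) (use * lin in auto)
    ultimately show ?case
      using eq lin_form_closed[OF *(2)] lin_form_closed[OF lin] by (auto intro: P_cong simp: lin_form_def)
  qed
  then have "P (\<lambda>x. \<Oplus>i\<in>{..<n}. \<chi> (f i) \<otimes> g i x)" by simp
  moreover have "s \<otimes> \<chi> x = (\<Oplus>i\<in>{..<n}. \<chi> (f i) \<otimes> g i x)" if x: "x \<in> carrier N" for x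
  proof -
    have sum: "\<chi> (\<Oplus>\<^bsub>N\<^esub>i\<in>A. g i y \<odot>\<^bsub>N\<^esub> f i) = (\<Oplus>i\<in>A. \<chi> (f i) \<otimes> g i y)"
      if "finite A" "A \<subseteq> {..<n}" "y \<in> carrier N" for A y
      using that
    proof (induction A rule: finite_induct)
      case (insert i A)
      have cl: "g i y \<in> carrier R" "f i \<in> carrier N" if "i < n" for i
        using gf that insert.prems by (auto simp: lin_form_closed)
      have 1: "(\<lambda>i. g i y \<odot>\<^bsub>N\<^esub> f i) \<in> A \<rightarrow> carrier N" "(\<lambda>i. \<chi> (f i) \<otimes> g i y) \<in> A \<rightarrow> carrier R"
        using insert.prems cl by auto
      have i: "i < n" using insert.prems by auto
      show ?case using insert 1 cl[OF i] by (simp add: M.finsum_closed R.m_comm)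
    qed simp
    define y where "y = x \<ominus>\<^bsub>N\<^esub> \<pi> x \<odot>\<^bsub>N\<^esub> e"
    have y: "y \<in> carrier N" "\<pi> y = \<zero>" "\<chi> y = \<chi> x" using x by (simp_all add: y_def R.minus_eq R.r_neg)
    have gy: "g i y = g i x" if "i < n" for i
      using gf[OF that] x lin_form_simps[OF gf(1)[OF that]] by (simp add: y_def R.minus_eq)
    have "s \<otimes> \<chi> x = \<chi> (s \<odot>\<^bsub>N\<^esub> y)" using y by simp
    also have "\<dots> = (\<Oplus>i\<in>{..<n}. \<chi> (f i) \<otimes> g i y)" using c y by (simp add: chart_def sum)
    also have "\<dots> = (\<Oplus>i\<in>{..<n}. \<chi> (f i) \<otimes> g i x)"
      using gy x gf by (intro R.finsum_cong') (auto simp: lin_form_closed)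
    finally show ?thesis .
  qed
  ultimately have "P (\<lambda>x. s \<otimes> \<chi> x)" by (rule P_cong)
  then have "rel (\<lambda>x. s \<otimes> k \<chi> x) ((s \<otimes> s) \<odot>\<^bsub>N\<^esub> u)"
    unfolding P_def
  proof (rule rel_cong)
    fix x assume "x \<in> carrier N"
    then have "\<chi> x \<in> carrier R" "\<chi> u \<in> carrier R" "\<pi> x \<in> carrier R" "\<pi> u \<in> carrier R" by simp_all
    then show "s \<otimes> k \<chi> x = k (\<lambda>x. s \<otimes> \<chi> x) x" unfolding k_def using s by algebra
  qed simp
  then have "rel (k \<chi>) (s \<odot>\<^bsub>N\<^esub> ((s \<otimes> s) \<odot>\<^bsub>N\<^esub> u))"
    using k by (simp add: rel_smult_form_iff)
  then show ?thesis by (simp add: k_def[abs_def] smult_assoc1[symmetric] R.m_assoc)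
qed

definition charts :: bool
  where "charts \<longleftrightarrow> (\<forall>P. primeideal P R \<longrightarrow> (\<exists>s n f g. s \<notin> P \<and> n \<ge> 2 \<and> chart s n f g))"

lemma cube_not_in_prime:
  assumes "primeideal P R" "s \<in> carrier R" "s \<notin> P"
  shows "s \<otimes> s \<otimes> s \<in> carrier R - P"
  using assms primeideal.I_prime[OF assms(1)] by blast

text \<open>The Koszul step. With \<open>q = \<pi>(v) u - \<pi>(u) v\<close>, the \<open>M\<close>-part of \<open>v \<and> u\<close>, one has
  \<open>\<phi>(q) = - \<pi>(u)\<close>. So \<open>u\<^sub>1 = \<phi>(e) q - \<phi>(q) e\<close> agrees with \<open>u\<close> under \<open>\<pi>\<close>, and
  \<open>u - u\<^sub>1\<close> is killed by \<open>\<pi>\<close> and by \<open>\<phi>\<close>.\<close>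

lemma rel_unimodular_form:
  assumes charts: charts and \<phi>: "lin_form R N \<phi>" and u: "u \<in> carrier N" "\<phi> u = \<zero>"
    and v: "v \<in> carrier N" "\<phi> v = \<one>"
  shows "rel \<phi> u"
proof -
  note [simp] = lin_form_simps[OF \<pi>] lin_form_simps[OF \<phi>] \<pi>e e u v
  define q where "q = \<pi> v \<odot>\<^bsub>N\<^esub> u \<ominus>\<^bsub>N\<^esub> \<pi> u \<odot>\<^bsub>N\<^esub> v"
  have q: "q \<in> carrier N" "\<pi> q = \<zero>" "\<phi> q = \<ominus> \<pi> u"
    by (simp_all add: q_def R.minus_eq R.m_comm R.r_neg)
  define u1 where "u1 = \<phi> e \<odot>\<^bsub>N\<^esub> q \<ominus>\<^bsub>N\<^esub> \<phi> q \<odot>\<^bsub>N\<^esub> e"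
  have u1: "u1 \<in> carrier N" "\<pi> u1 = \<pi> u" "\<phi> u1 = \<zero>"
    using q(1,2) by (simp_all add: u1_def R.minus_eq R.m_comm R.r_neg) (simp add: q(3))
  have 1: "rel \<phi> u1"
  proof (rule rel_local_global[OF \<phi> u1(1,3)])
    fix P assume P: "primeideal P R"
    then obtain s n f g where s: "s \<notin> P" "n \<ge> 2" and c: "chart s n f g" using charts by (auto simp: charts_def)
    have "s \<otimes> s \<otimes> s \<in> carrier R - P" using cube_not_in_prime[OF P] s c by (simp add: chart_def)
    with chart_rel_vec[OF c s(2) \<phi> q(1,2)] show "\<exists>s\<in>carrier R - P. rel \<phi> (s \<odot>\<^bsub>N\<^esub> u1)"
      unfolding u1_def by blast
  qed
  have 2: "rel \<phi> (u \<ominus>\<^bsub>N\<^esub> u1)"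
    using u1 \<phi> by (intro rel_vec_killed_by_\<pi>) (simp_all add: R.minus_eq R.r_neg)
  have "rel \<phi> (u \<ominus>\<^bsub>N\<^esub> u1 \<oplus>\<^bsub>N\<^esub> u1)"
    using 1 2 u1 \<phi> by (intro rel_add_vec) (simp_all add: R.minus_eq)
  then show ?thesis using u1 by (simp add: M.minus_eq M.a_assoc M.l_neg)
qed

text \<open>The dual Koszul step: with \<open>\<chi> = \<omega>(e) \<phi> - \<phi>(e) \<omega>\<close> one has \<open>\<chi>(e) = 0\<close> and
  \<open>\<chi>(u) = - \<phi>(e)\<close>, so the form \<open>\<phi>1 = \<pi>(u) \<chi> - \<chi>(u) \<pi>\<close> agrees with \<open>\<phi>\<close> at \<open>e\<close>, and
  \<open>\<phi> - \<phi>1\<close> kills \<open>e\<close> and \<open>u\<close>.\<close>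

lemma rel_unimodular_vec:
  assumes charts: charts and \<phi>: "lin_form R N \<phi>" and u: "u \<in> carrier N" "\<phi> u = \<zero>"
    and \<omega>: "lin_form R N \<omega>" "\<omega> u = \<one>"
  shows "rel \<phi> u"
proof -
  note [simp] = lin_form_simps[OF \<pi>] lin_form_simps[OF \<phi>] lin_form_simps[OF \<omega>(1)] \<pi>e e u \<omega>(2)
  define \<chi> where "\<chi> x = \<omega> e \<otimes> \<phi> x \<ominus> \<phi> e \<otimes> \<omega> x" for x
  have \<chi>: "lin_form R N \<chi>" unfolding \<chi>_def[abs_def] using \<phi> \<omega> by (intro lin_form_diff) auto
  have \<chi>e: "\<chi> e = \<zero>" "\<chi> u = \<ominus> \<phi> e" by (simp_all add: \<chi>_def R.minus_eq R.m_comm R.r_neg)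
  note [simp] = lin_form_simps[OF \<chi>]
  define \<phi>1 where "\<phi>1 x = \<pi> u \<otimes> \<chi> x \<ominus> \<chi> u \<otimes> \<pi> x" for x
  have \<phi>1: "lin_form R N \<phi>1" unfolding \<phi>1_def[abs_def] using \<pi> \<chi> by (intro lin_form_diff) auto
  note [simp] = lin_form_simps[OF \<phi>1]
  have \<phi>1u: "\<phi>1 u = \<zero>" "\<phi>1 e = \<phi> e"
    by (simp add: \<phi>1_def R.minus_eq R.m_comm R.r_neg) (simp add: \<phi>1_def R.minus_eq \<chi>e)
  define \<phi>2 where "\<phi>2 x = \<one> \<otimes> \<phi> x \<ominus> \<one> \<otimes> \<phi>1 x" for x
  have \<phi>2: "lin_form R N \<phi>2" unfolding \<phi>2_def[abs_def] using \<phi> \<phi>1 by (intro lin_form_diff) auto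
  have \<phi>2u: "\<phi>2 u = \<zero>" "\<phi>2 e = \<zero>" by (simp_all add: \<phi>2_def \<phi>1u R.minus_eq R.r_neg)
  have 1: "rel \<phi>1 u"
  proof (rule rel_local_global[OF \<phi>1 u(1) \<phi>1u(1)])
    fix P assume P: "primeideal P R"
    then obtain s n f g where s: "s \<notin> P" "n \<ge> 2" and c: "chart s n f g" using charts by (auto simp: charts_def)
    have "s \<otimes> s \<otimes> s \<in> carrier R - P" using cube_not_in_prime[OF P] s c by (simp add: chart_def)
    with chart_rel_form[OF c s(2) \<chi> \<chi>e(1) u(1)] show "\<exists>s\<in>carrier R - P. rel \<phi>1 (s \<odot>\<^bsub>N\<^esub> u)"
      unfolding \<phi>1_def[abs_def] by blast
  qed
  have 2: "rel \<phi>2 u" using \<phi>2 \<phi>2u by (intro rel_form_kills_e) auto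
  have "rel (\<lambda>x. \<phi>1 x \<oplus> \<phi>2 x) u"
    using 1 2 \<phi>1 \<phi>2 \<phi>1u \<phi>2u by (intro rel_add_form) auto
  then show ?thesis
  proof (rule rel_cong)
    fix x assume "x \<in> carrier N"
    then have "\<phi> x \<in> carrier R" "\<phi>1 x \<in> carrier R" by simp_all
    then show "\<phi> x = \<phi>1 x \<oplus> \<phi>2 x" unfolding \<phi>2_def by algebra
  qed simp
qed

text \<open>The conjugated form \<open>\<pi> \<sigma>\<^sup>-\<^sup>1\<close> takes the value \<open>1\<close> at \<open>\<sigma>(e)\<close>.\<close>

lemma conj_vec_H:
  assumes charts: charts and u: "u \<in> carrier N" "\<pi> u = \<zero>" and a: "a \<in> I" and \<sigma>: "\<sigma> \<in> carrier (Aut R N)"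
  shows "\<sigma> \<otimes>\<^bsub>Aut R N\<^esub> transv R N \<pi> (a \<odot>\<^bsub>N\<^esub> u) \<otimes>\<^bsub>Aut R N\<^esub> inv\<^bsub>Aut R N\<^esub> \<sigma> \<in> H"
proof -
  have ac: "a \<in> carrier R" using a by (rule I_carrier)
  have lin: "\<sigma> (a \<odot>\<^bsub>N\<^esub> u) = a \<odot>\<^bsub>N\<^esub> \<sigma> u" "\<sigma> u \<in> carrier N" "\<sigma> e \<in> carrier N"
    using \<sigma> u e ac by (auto simp: Aut_carrier lin_maps_def)
  note conj = transv_conj[OF \<pi> _ _ \<sigma>, of "a \<odot>\<^bsub>N\<^esub> u"]
  have au: "a \<odot>\<^bsub>N\<^esub> u \<in> carrier N" "\<pi> (a \<odot>\<^bsub>N\<^esub> u) = \<zero>" using u ac \<pi> by (simp_all add: lin_form_simps)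
  have "rel (\<lambda>x. \<pi> ((inv\<^bsub>Aut R N\<^esub> \<sigma>) x)) (\<sigma> u)"
    using conj(1,2)[OF au] u lin e \<pi>e by (intro rel_unimodular_form[OF charts, where v = "\<sigma> e"]) simp_all
  then show ?thesis using a by (simp add: conj(3)[OF au] lin rel_def)
qed

text \<open>The form \<open>\<pi> \<sigma>\<^sup>-\<^sup>1\<close> takes the value \<open>1\<close> at the conjugated vector \<open>\<sigma>(e)\<close>.\<close>

lemma conj_form_H:
  assumes charts: charts and g: "lin_form R N g" "g e = \<zero>" and a: "a \<in> I" and \<sigma>: "\<sigma> \<in> carrier (Aut R N)"
  shows "\<sigma> \<otimes>\<^bsub>Aut R N\<^esub> transv R N g (a \<odot>\<^bsub>N\<^esub> e) \<otimes>\<^bsub>Aut R N\<^esub> inv\<^bsub>Aut R N\<^esub> \<sigma> \<in> H"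
proof -
  have ac: "a \<in> carrier R" using a by (rule I_carrier)
  have lin: "\<sigma> (a \<odot>\<^bsub>N\<^esub> e) = a \<odot>\<^bsub>N\<^esub> \<sigma> e" "\<sigma> e \<in> carrier N"
    using \<sigma> e ac by (auto simp: Aut_carrier lin_maps_def)
  note conj = transv_conj[OF g(1) _ _ \<sigma>, of "a \<odot>\<^bsub>N\<^esub> e"]
  have ae: "a \<odot>\<^bsub>N\<^esub> e \<in> carrier N" "g (a \<odot>\<^bsub>N\<^esub> e) = \<zero>" using e g ac by (simp_all add: lin_form_simps)
  have "lin_form R N (\<lambda>x. \<pi> ((inv\<^bsub>Aut R N\<^esub> \<sigma>) x))"
    by (rule transv_conj(1)[OF \<pi> _ _ \<sigma>, of "\<zero>\<^bsub>N\<^esub>"]) (simp_all add: lin_form_zero[OF \<pi>])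
  then have "rel (\<lambda>x. g ((inv\<^bsub>Aut R N\<^esub> \<sigma>) x)) (\<sigma> e)"
    using conj(1,2)[OF ae] g lin e \<pi>e
    by (intro rel_unimodular_vec[OF charts, where \<omega> = "\<lambda>x. \<pi> ((inv\<^bsub>Aut R N\<^esub> \<sigma>) x)"]) simp_all
  then show ?thesis using a by (simp add: conj(3)[OF ae] lin rel_def)
qed

end

section \<open>Direct sums, free modules and dual bases\<close>

lemma regular_module_simps [simp]:
  "carrier (regular_module R) = carrier R"
  "x \<oplus>\<^bsub>regular_module R\<^esub> y = x \<oplus>\<^bsub>R\<^esub> y"
  "a \<odot>\<^bsub>regular_module R\<^esub> x = a \<otimes>\<^bsub>R\<^esub> x"
  "\<zero>\<^bsub>regular_module R\<^esub> = \<zero>\<^bsub>R\<^esub>"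
  by (simp_all add: regular_module_def)

lemma module_sum_simps [simp]:
  "carrier (module_sum M N) = carrier M \<times> carrier N"
  "(x, y) \<oplus>\<^bsub>module_sum M N\<^esub> (x', y') = (x \<oplus>\<^bsub>M\<^esub> x', y \<oplus>\<^bsub>N\<^esub> y')"
  "a \<odot>\<^bsub>module_sum M N\<^esub> (x, y) = (a \<odot>\<^bsub>M\<^esub> x, a \<odot>\<^bsub>N\<^esub> y)"
  "\<zero>\<^bsub>module_sum M N\<^esub> = (\<zero>\<^bsub>M\<^esub>, \<zero>\<^bsub>N\<^esub>)"
  by (simp_all add: module_sum_def)

lemma (in cring) module_regular_module: "module R (regular_module R)"
proof (rule moduleI)
  show "abelian_group (regular_module R)"
    by (rule abelian_groupI) (auto simp: a_ac intro: l_neg)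
qed (auto simp: l_distr r_distr m_assoc cring_axioms)

lemma module_module_sum:
  assumes "module R M" "module R N"
  shows "module R (module_sum M N)"
proof -
  interpret M: module R M by fact
  interpret N: module R N by fact
  show ?thesis
  proof (rule moduleI[OF M.R.is_cring])
    show "abelian_group (module_sum M N)"
    proof (rule abelian_groupI)
      fix p assume "p \<in> carrier (module_sum M N)"
      then show "\<exists>q\<in>carrier (module_sum M N). q \<oplus>\<^bsub>module_sum M N\<^esub> p = \<zero>\<^bsub>module_sum M N\<^esub>"
        by (intro bexI[of _ "(\<ominus>\<^bsub>M\<^esub> fst p, \<ominus>\<^bsub>N\<^esub> snd p)"]) (auto simp: M.l_neg N.l_neg)
    qed (auto simp: M.M.a_ac N.M.a_ac)
  qed (auto simp: M.smult_l_distr N.smult_l_distr M.smult_r_distr N.smult_r_distr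
      M.smult_assoc1 N.smult_assoc1)
qed

lemma free_module_simps:
  "f \<in> carrier (free_module R J) \<longleftrightarrow> f \<in> J \<rightarrow>\<^sub>E carrier R \<and> finite {j \<in> J. f j \<noteq> \<zero>\<^bsub>R\<^esub>}"
  "f \<oplus>\<^bsub>free_module R J\<^esub> g = (\<lambda>j\<in>J. f j \<oplus>\<^bsub>R\<^esub> g j)"
  "a \<odot>\<^bsub>free_module R J\<^esub> f = (\<lambda>j\<in>J. a \<otimes>\<^bsub>R\<^esub> f j)"
  "\<zero>\<^bsub>free_module R J\<^esub> = (\<lambda>j\<in>J. \<zero>\<^bsub>R\<^esub>)"
  by (simp_all add: free_module_def)

context module
begin

lemma lin_form_finsum_zero:
  assumes \<phi>: "lin_form R M \<phi>" and "finite A" "x \<in> A \<rightarrow> carrier M" "\<And>j. j \<in> A \<Longrightarrow> \<phi> (x j) = \<zero>"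
  shows "\<phi> (\<Oplus>\<^bsub>M\<^esub>j\<in>A. x j) = \<zero>"
  using assms(2-)
proof (induction A rule: finite_induct)
  case empty
  then show ?case using \<phi> by (simp add: lin_form_zero)
next
  case (insert i A)
  then have "x \<in> A \<rightarrow> carrier M" "x i \<in> carrier M" by auto
  with insert \<phi> show ?case by (simp add: lin_form_simps M.finsum_closed)
qed

text \<open>Let \<open>h\<close> be an isomorphism from \<open>M \<oplus> Q\<close> to the free module on \<open>J\<close>. The coordinates of
  \<open>h(m, 0)\<close> are the forms \<open>\<xi>\<^sub>j\<close>, and the \<open>M\<close>-components of the preimages of the standard basis are the
  vectors \<open>x\<^sub>j\<close>. The finitely many generators of \<open>M\<close> involve only a finite set of coordinates, and
  then so do all elements of \<open>M\<close>.\<close>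

lemma finite_dual_basis:
  assumes fg: "finitely_generated R M" and pr: "projective R M"
  shows "\<exists>(J :: 'c set) x \<xi>. finite J \<and> x \<in> J \<rightarrow> carrier M \<and> (\<forall>j\<in>J. lin_form R M (\<xi> j)) \<and>
    (\<forall>m\<in>carrier M. m = (\<Oplus>\<^bsub>M\<^esub>j\<in>J. \<xi> j m \<odot>\<^bsub>M\<^esub> x j))"
proof -
  obtain J :: "'c set" and Q :: "('a, 'c \<Rightarrow> 'a) module" and h
    where Q: "module R Q" and h: "h \<in> lin_maps R (module_sum M Q) (free_module R J)"
      and bij: "bij_betw h (carrier M \<times> carrier Q) (carrier (free_module R J))"
    using pr unfolding projective_def module_iso_def by auto
  interpret Q: module R Q by (rule Q)
  have h_cl: "h p \<in> J \<rightarrow>\<^sub>E carrier R" "finite {j \<in> J. h p j \<noteq> \<zero>}" if "p \<in> carrier M \<times> carrier Q" for p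
  proof -
    have "h p \<in> carrier (free_module R J)" using h that by (auto simp: lin_maps_def)
    then show "h p \<in> J \<rightarrow>\<^sub>E carrier R" "finite {j \<in> J. h p j \<noteq> \<zero>}"
      unfolding free_module_simps by auto
  qed
  have h_add: "h (x \<oplus>\<^bsub>M\<^esub> x', y \<oplus>\<^bsub>Q\<^esub> y') = (\<lambda>j\<in>J. h (x, y) j \<oplus> h (x', y') j)"
    if "x \<in> carrier M" "x' \<in> carrier M" "y \<in> carrier Q" "y' \<in> carrier Q" for x x' y y'
  proof -
    have "h ((x, y) \<oplus>\<^bsub>module_sum M Q\<^esub> (x', y')) = h (x, y) \<oplus>\<^bsub>free_module R J\<^esub> h (x', y')"
      using h that unfolding lin_maps_def by (simp del: module_sum_simps(2))
    then show ?thesis by (simp add: free_module_simps)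
  qed
  have h_smult: "h (a \<odot>\<^bsub>M\<^esub> x, a \<odot>\<^bsub>Q\<^esub> y) = (\<lambda>j\<in>J. a \<otimes> h (x, y) j)"
    if "a \<in> carrier R" "x \<in> carrier M" "y \<in> carrier Q" for a x y
  proof -
    have "h (a \<odot>\<^bsub>module_sum M Q\<^esub> (x, y)) = a \<odot>\<^bsub>free_module R J\<^esub> h (x, y)"
      using h that unfolding lin_maps_def by (simp del: module_sum_simps(3))
    then show ?thesis by (simp add: free_module_simps)
  qed
  define \<xi> where "\<xi> j m = h (m, \<zero>\<^bsub>Q\<^esub>) j" for j m
  have \<xi>: "lin_form R M (\<xi> j)" if "j \<in> J" for j
    unfolding lin_form_def
  proof (intro conjI ballI)
    show "\<xi> j \<in> carrier M \<rightarrow> carrier R"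
      unfolding \<xi>_def using that by (auto intro!: PiE_mem[OF h_cl(1)])
    show "\<xi> j (x \<oplus>\<^bsub>M\<^esub> y) = \<xi> j x \<oplus> \<xi> j y" if "x \<in> carrier M" "y \<in> carrier M" for x y
      using h_add[of x y "\<zero>\<^bsub>Q\<^esub>" "\<zero>\<^bsub>Q\<^esub>"] that \<open>j \<in> J\<close> by (simp add: \<xi>_def)
    show "\<xi> j (a \<odot>\<^bsub>M\<^esub> x) = a \<otimes> \<xi> j x" if "a \<in> carrier R" "x \<in> carrier M" for a x
      using h_smult[of a x "\<zero>\<^bsub>Q\<^esub>"] that \<open>j \<in> J\<close> by (simp add: \<xi>_def)
  qed
  obtain X where X: "finite X" "X \<subseteq> carrier M"
    and gen: "\<And>y. y \<in> carrier M \<Longrightarrow> \<exists>c\<in>X \<rightarrow> carrier R. y = (\<Oplus>\<^bsub>M\<^esub>x\<in>X. c x \<odot>\<^bsub>M\<^esub> x)"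
    using fg unfolding finitely_generated_def by blast
  define J0 where "J0 = (\<Union>x\<in>X. {j \<in> J. \<xi> j x \<noteq> \<zero>})"
  have J0: "finite J0" "J0 \<subseteq> J" using X h_cl(2) by (auto simp: J0_def \<xi>_def)
  have out: "\<xi> j m = \<zero>" if j: "j \<in> J - J0" and m: "m \<in> carrier M" for j m
  proof -
    obtain c where c: "c \<in> X \<rightarrow> carrier R" "m = (\<Oplus>\<^bsub>M\<^esub>x\<in>X. c x \<odot>\<^bsub>M\<^esub> x)" using gen[OF m] by blast
    have "\<xi> j (\<Oplus>\<^bsub>M\<^esub>x\<in>X. c x \<odot>\<^bsub>M\<^esub> x) = \<zero>"
    proof (rule lin_form_finsum_zero)
      show "lin_form R M (\<xi> j)" using j by (intro \<xi>) auto
      show "(\<lambda>x. c x \<odot>\<^bsub>M\<^esub> x) \<in> X \<rightarrow> carrier M" using c X by auto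
      fix x assume x: "x \<in> X"
      then have "\<xi> j x = \<zero>" using j by (auto simp: J0_def)
      then show "\<xi> j (c x \<odot>\<^bsub>M\<^esub> x) = \<zero>" 
        using lin_form_smult[OF \<xi>, of j "c x" x] x c X j by auto
    qed (rule X)
    then show ?thesis using c by simp
  qed
  define \<delta> where "\<delta> j = (\<lambda>k\<in>J. if k = j then \<one> else \<zero>)" for j
  have "\<exists>p\<in>carrier M \<times> carrier Q. h p = \<delta> j" if "j \<in> J" for j
  proof -
    have "{k \<in> J. \<delta> j k \<noteq> \<zero>} \<subseteq> {j}" by (auto simp: \<delta>_def)
    then have "finite {k \<in> J. \<delta> j k \<noteq> \<zero>}" by (rule finite_subset) simp
    then have "\<delta> j \<in> carrier (free_module R J)"
      by (auto simp: free_module_simps \<delta>_def)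
    then have "\<delta> j \<in> h ` (carrier M \<times> carrier Q)" using bij by (simp add: bij_betw_def)
    then show ?thesis by (rule imageE) auto
  qed
  then obtain p where p: "\<And>j. j \<in> J \<Longrightarrow> p j \<in> carrier M \<times> carrier Q" "\<And>j. j \<in> J \<Longrightarrow> h (p j) = \<delta> j"
    by metis
  define x y where "x j = fst (p j)" and "y j = snd (p j)" for j
  have xy: "x j \<in> carrier M" "y j \<in> carrier Q" "h (x j, y j) = \<delta> j" if "j \<in> J" for j
    using p[OF that] by (auto simp: x_def y_def)
  have "m = (\<Oplus>\<^bsub>M\<^esub>j\<in>J0. \<xi> j m \<odot>\<^bsub>M\<^esub> x j)" if m: "m \<in> carrier M" for m
  proof -
    have \<xi>m: "\<xi> j m \<in> carrier R" if "j \<in> J" for j using \<xi>[OF that] m by (rule lin_form_closed)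
    let ?a = "\<lambda>j. \<xi> j m \<odot>\<^bsub>M\<^esub> x j" and ?b = "\<lambda>j. \<xi> j m \<odot>\<^bsub>Q\<^esub> y j"
    have cl: "?a \<in> A \<rightarrow> carrier M" "?b \<in> A \<rightarrow> carrier Q" if "A \<subseteq> J" for A
      using xy \<xi>m that by auto
    have "h (\<Oplus>\<^bsub>M\<^esub>j\<in>A. ?a j, \<Oplus>\<^bsub>Q\<^esub>j\<in>A. ?b j) = (\<lambda>k\<in>J. if k \<in> A then \<xi> k m else \<zero>)"
      if "finite A" "A \<subseteq> J" for A
      using that
    proof (induction A rule: finite_induct)
      case empty
      have "\<zero> \<otimes> h (\<zero>\<^bsub>M\<^esub>, \<zero>\<^bsub>Q\<^esub>) j = \<zero>" if "j \<in> J" for j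
        using h_cl(1)[of "(\<zero>\<^bsub>M\<^esub>, \<zero>\<^bsub>Q\<^esub>)"] that by (auto simp: PiE_iff)
      then have "(\<lambda>j\<in>J. \<zero> \<otimes> h (\<zero>\<^bsub>M\<^esub>, \<zero>\<^bsub>Q\<^esub>) j) = (\<lambda>j\<in>J. \<zero>)" by (intro restrict_ext)
      then show ?case using h_smult[of \<zero> "\<zero>\<^bsub>M\<^esub>" "\<zero>\<^bsub>Q\<^esub>"] by simp
    next
      case (insert j A)
      then have j: "j \<in> J" "j \<notin> A" "finite A" and A: "A \<subseteq> J" by auto
      have IH: "h (\<Oplus>\<^bsub>M\<^esub>j\<in>A. ?a j, \<Oplus>\<^bsub>Q\<^esub>j\<in>A. ?b j) = (\<lambda>k\<in>J. if k \<in> A then \<xi> k m else \<zero>)"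
        using insert by auto
      have "h (\<Oplus>\<^bsub>M\<^esub>j\<in>insert j A. ?a j, \<Oplus>\<^bsub>Q\<^esub>j\<in>insert j A. ?b j) =
          h (?a j \<oplus>\<^bsub>M\<^esub> (\<Oplus>\<^bsub>M\<^esub>j\<in>A. ?a j), ?b j \<oplus>\<^bsub>Q\<^esub> (\<Oplus>\<^bsub>Q\<^esub>j\<in>A. ?b j))"
        using j cl[OF A] xy[OF j(1)] \<xi>m[OF j(1)] by simp
      also have "\<dots> = (\<lambda>k\<in>J. \<xi> j m \<otimes> \<delta> j k \<oplus> (if k \<in> A then \<xi> k m else \<zero>))"
        using j cl[OF A] xy[OF j(1)] \<xi>m[OF j(1)]
        by (subst h_add) (auto simp: M.finsum_closed Q.finsum_closed h_smult IH)
      also have "\<dots> = (\<lambda>k\<in>J. if k \<in> insert j A then \<xi> k m else \<zero>)"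
        using j \<xi>m by (intro restrict_ext) (auto simp: \<delta>_def)
      finally show ?case .
    qed
    from this[OF J0] have "h (\<Oplus>\<^bsub>M\<^esub>j\<in>J0. ?a j, \<Oplus>\<^bsub>Q\<^esub>j\<in>J0. ?b j) = (\<lambda>k\<in>J. if k \<in> J0 then \<xi> k m else \<zero>)" .
    also have "\<dots> = h (m, \<zero>\<^bsub>Q\<^esub>)"
      using out[OF _ m] h_cl(1)[of "(m, \<zero>\<^bsub>Q\<^esub>)"] m
      by (intro extensionalityI[of _ J]) (auto simp: PiE_iff \<xi>_def[symmetric])
    finally have "(\<Oplus>\<^bsub>M\<^esub>j\<in>J0. ?a j, \<Oplus>\<^bsub>Q\<^esub>j\<in>J0. ?b j) = (m, \<zero>\<^bsub>Q\<^esub>)"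
      by (rule inj_onD[OF bij_betw_imp_inj_on[OF bij]])
        (use m M.finsum_closed[OF cl(1)[OF J0(2)]] Q.finsum_closed[OF cl(2)[OF J0(2)]] in auto)
    then show ?thesis by simp
  qed
  then show ?thesis using J0 xy \<xi>
    by (intro exI[of _ J0] exI[of _ x] exI[of _ \<xi>]) auto
qed

end

section \<open>Lifting bases from a localization\<close>

text \<open>Localization at a multiplicative set \<open>S\<close>. The union over all representatives that defines an
  operation on fractions reduces to a single representative once the operation is shown to be
  compatible with the equivalence of fractions.\<close>

locale localization = module R M for R (structure) and M +
  fixes S
  assumes S: "S \<subseteq> carrier R" and S_one: "\<one> \<in> S" and S_mult: "\<And>s t. s \<in> S \<Longrightarrow> t \<in> S \<Longrightarrow> s \<otimes> t \<in> S"
begin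

lemma S_carrier [simp]: "s \<in> S \<Longrightarrow> s \<in> carrier R"
  using S by blast

lemmas S_simps [simp] = S_one S_mult

lemma smult_lcomm:
  "a \<in> carrier R \<Longrightarrow> b \<in> carrier R \<Longrightarrow> x \<in> carrier M \<Longrightarrow> a \<odot>\<^bsub>M\<^esub> (b \<odot>\<^bsub>M\<^esub> x) = b \<odot>\<^bsub>M\<^esub> (a \<odot>\<^bsub>M\<^esub> x)"
  by (simp add: smult_assoc1[symmetric] R.m_comm)

lemma loc_rel_iff:
  "((x, s), (y, t)) \<in> loc_rel R S M \<longleftrightarrow> x \<in> carrier M \<and> s \<in> S \<and> y \<in> carrier M \<and> t \<in> S \<and>
    (\<exists>u\<in>S. u \<odot>\<^bsub>M\<^esub> (t \<odot>\<^bsub>M\<^esub> x) = u \<odot>\<^bsub>M\<^esub> (s \<odot>\<^bsub>M\<^esub> y))"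
  by (simp add: loc_rel_def)

lemma equiv_loc_rel: "equiv (carrier M \<times> S) (loc_rel R S M)"
proof (rule equivI)
  show "loc_rel R S M \<subseteq> (carrier M \<times> S) \<times> (carrier M \<times> S)" by (auto simp: loc_rel_iff)
  show "refl_on (carrier M \<times> S) (loc_rel R S M)"
    by (rule refl_onI) (auto simp: loc_rel_iff intro: S_one)
  show "sym (loc_rel R S M)"
    by (rule symI) (auto simp: loc_rel_iff, metis)
  show "trans (loc_rel R S M)"
  proof (rule transI, clarify)
    fix x s y t z r
    assume 1: "((x, s), (y, t)) \<in> loc_rel R S M" and 2: "((y, t), (z, r)) \<in> loc_rel R S M"
    from 1 2 have [simp]: "x \<in> carrier M" "y \<in> carrier M" "z \<in> carrier M" "s \<in> S" "t \<in> S" "r \<in> S"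
      by (auto simp: loc_rel_iff)
    from 1 obtain u where u [simp]: "u \<in> S" and eu: "u \<odot>\<^bsub>M\<^esub> (t \<odot>\<^bsub>M\<^esub> x) = u \<odot>\<^bsub>M\<^esub> (s \<odot>\<^bsub>M\<^esub> y)"
      by (auto simp: loc_rel_iff)
    from 2 obtain v where v [simp]: "v \<in> S" and ev: "v \<odot>\<^bsub>M\<^esub> (r \<odot>\<^bsub>M\<^esub> y) = v \<odot>\<^bsub>M\<^esub> (t \<odot>\<^bsub>M\<^esub> z)"
      by (auto simp: loc_rel_iff)
    have "(u \<otimes> v \<otimes> t) \<odot>\<^bsub>M\<^esub> (r \<odot>\<^bsub>M\<^esub> x) = (v \<otimes> r) \<odot>\<^bsub>M\<^esub> (u \<odot>\<^bsub>M\<^esub> (t \<odot>\<^bsub>M\<^esub> x))"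
      by (simp add: smult_assoc1 smult_lcomm)
    also have "\<dots> = (u \<otimes> s) \<odot>\<^bsub>M\<^esub> (v \<odot>\<^bsub>M\<^esub> (r \<odot>\<^bsub>M\<^esub> y))"
      unfolding eu by (simp add: smult_assoc1 smult_lcomm)
    also have "\<dots> = (u \<otimes> v \<otimes> t) \<odot>\<^bsub>M\<^esub> (s \<odot>\<^bsub>M\<^esub> z)"
      unfolding ev by (simp add: smult_assoc1 smult_lcomm)
    finally show "((x, s), (z, r)) \<in> loc_rel R S M"
      by (auto simp: loc_rel_iff intro!: bexI[of _ "u \<otimes> v \<otimes> t"])
  qed
qed

lemma fraction_eq_iff:
  assumes "x \<in> carrier M" "s \<in> S" "y \<in> carrier M" "t \<in> S"
  shows "fraction R S M x s = fraction R S M y t \<longleftrightarrow>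
    (\<exists>u\<in>S. u \<odot>\<^bsub>M\<^esub> (t \<odot>\<^bsub>M\<^esub> x) = u \<odot>\<^bsub>M\<^esub> (s \<odot>\<^bsub>M\<^esub> y))"
  unfolding fraction_def using assms
  by (subst eq_equiv_class_iff[OF equiv_loc_rel]) (auto simp: loc_rel_iff)

lemma fraction_eqI:
  assumes "u \<odot>\<^bsub>M\<^esub> (t \<odot>\<^bsub>M\<^esub> x) = u \<odot>\<^bsub>M\<^esub> (s \<odot>\<^bsub>M\<^esub> y)" "u \<in> S" "x \<in> carrier M" "s \<in> S" "y \<in> carrier M" "t \<in> S"
  shows "fraction R S M x s = fraction R S M y t"
  using assms fraction_eq_iff by blast

lemma loc_module_carrier:
  "carrier (loc_module R S M) = {fraction R S M x s | x s. x \<in> carrier M \<and> s \<in> S}"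
  by (auto simp: loc_module_def quotient_def fraction_def Let_def)

lemma loc_module_add:
  assumes "x \<in> carrier M" "s \<in> S" "y \<in> carrier M" "t \<in> S"
  shows "fraction R S M x s \<oplus>\<^bsub>loc_module R S M\<^esub> fraction R S M y t =
    fraction R S M (t \<odot>\<^bsub>M\<^esub> x \<oplus>\<^bsub>M\<^esub> s \<odot>\<^bsub>M\<^esub> y) (s \<otimes> t)"
proof -
  let ?f = "\<lambda>p q. fraction R S M (snd q \<odot>\<^bsub>M\<^esub> fst p \<oplus>\<^bsub>M\<^esub> snd p \<odot>\<^bsub>M\<^esub> fst q) (snd p \<otimes> snd q)"
  have "congruent2 (loc_rel R S M) (loc_rel R S M) ?f"
  proof (rule congruent2I', clarify)
    fix x s x' s' y t y' t'
    assume 1: "((x, s), (x', s')) \<in> loc_rel R S M" and 2: "((y, t), (y', t')) \<in> loc_rel R S M"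
    from 1 2 have [simp]: "x \<in> carrier M" "s \<in> S" "x' \<in> carrier M" "s' \<in> S"
      "y \<in> carrier M" "t \<in> S" "y' \<in> carrier M" "t' \<in> S" by (auto simp: loc_rel_iff)
    from 1 obtain u where u [simp]: "u \<in> S" and eu: "u \<odot>\<^bsub>M\<^esub> (s' \<odot>\<^bsub>M\<^esub> x) = u \<odot>\<^bsub>M\<^esub> (s \<odot>\<^bsub>M\<^esub> x')"
      by (auto simp: loc_rel_iff)
    from 2 obtain v where v [simp]: "v \<in> S" and ev: "v \<odot>\<^bsub>M\<^esub> (t' \<odot>\<^bsub>M\<^esub> y) = v \<odot>\<^bsub>M\<^esub> (t \<odot>\<^bsub>M\<^esub> y')"
      by (auto simp: loc_rel_iff)
    have "(u \<otimes> v) \<odot>\<^bsub>M\<^esub> ((s' \<otimes> t') \<odot>\<^bsub>M\<^esub> (t \<odot>\<^bsub>M\<^esub> x \<oplus>\<^bsub>M\<^esub> s \<odot>\<^bsub>M\<^esub> y)) =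
        (v \<otimes> t' \<otimes> t) \<odot>\<^bsub>M\<^esub> (u \<odot>\<^bsub>M\<^esub> (s' \<odot>\<^bsub>M\<^esub> x)) \<oplus>\<^bsub>M\<^esub> (u \<otimes> s' \<otimes> s) \<odot>\<^bsub>M\<^esub> (v \<odot>\<^bsub>M\<^esub> (t' \<odot>\<^bsub>M\<^esub> y))"
      by (simp add: smult_assoc1 smult_lcomm smult_r_distr)
    also have "\<dots> = (u \<otimes> v) \<odot>\<^bsub>M\<^esub> ((s \<otimes> t) \<odot>\<^bsub>M\<^esub> (t' \<odot>\<^bsub>M\<^esub> x' \<oplus>\<^bsub>M\<^esub> s' \<odot>\<^bsub>M\<^esub> y'))"
      unfolding eu ev by (simp add: smult_assoc1 smult_lcomm smult_r_distr)
    finally show "?f (x, s) (y, t) = ?f (x', s') (y', t')"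
      by (intro fraction_eqI[of "u \<otimes> v"]) auto
  qed
  from UN_equiv_class2[OF equiv_loc_rel equiv_loc_rel this, of "(x, s)" "(y, t)"] assms
  show ?thesis by (simp add: loc_module_def Let_def case_prod_unfold fraction_def)
qed

end

lemma (in localization) localization_regular: "localization R (regular_module R) S"
  by (intro localization.intro localization_axioms.intro R.module_regular_module) (use S in auto)

lemma (in localization) loc_module_smult:
  assumes "a \<in> carrier R" "s \<in> S" "y \<in> carrier M" "t \<in> S"
  shows "fraction R S (regular_module R) a s \<odot>\<^bsub>loc_module R S M\<^esub> fraction R S M y t =
    fraction R S M (a \<odot>\<^bsub>M\<^esub> y) (s \<otimes> t)"
proof -
  interpret reg: localization R "regular_module R" S by (rule localization_regular)
  let ?f = "\<lambda>p q. fraction R S M (fst p \<odot>\<^bsub>M\<^esub> fst q) (snd p \<otimes> snd q)"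
  have "congruent2 (loc_rel R S (regular_module R)) (loc_rel R S M) ?f"
  proof (rule congruent2I', clarify)
    fix x s x' s' y t y' t'
    assume 1: "((x, s), (x', s')) \<in> loc_rel R S (regular_module R)" and 2: "((y, t), (y', t')) \<in> loc_rel R S M"
    from 1 2 have [simp]: "x \<in> carrier R" "s \<in> S" "x' \<in> carrier R" "s' \<in> S"
      "y \<in> carrier M" "t \<in> S" "y' \<in> carrier M" "t' \<in> S" by (auto simp: loc_rel_iff reg.loc_rel_iff)
    from 1 obtain u where u [simp]: "u \<in> S" and eu: "u \<otimes> (s' \<otimes> x) = u \<otimes> (s \<otimes> x')"
      by (auto simp: reg.loc_rel_iff)
    from 2 obtain v where v [simp]: "v \<in> S" and ev: "v \<odot>\<^bsub>M\<^esub> (t' \<odot>\<^bsub>M\<^esub> y) = v \<odot>\<^bsub>M\<^esub> (t \<odot>\<^bsub>M\<^esub> y')"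
      by (auto simp: loc_rel_iff)
    have "(u \<otimes> v) \<odot>\<^bsub>M\<^esub> ((s' \<otimes> t') \<odot>\<^bsub>M\<^esub> (x \<odot>\<^bsub>M\<^esub> y)) = (u \<otimes> (s' \<otimes> x)) \<odot>\<^bsub>M\<^esub> (v \<odot>\<^bsub>M\<^esub> (t' \<odot>\<^bsub>M\<^esub> y))"
      by (simp add: smult_assoc1 smult_lcomm)
    also have "\<dots> = (u \<otimes> v) \<odot>\<^bsub>M\<^esub> ((s \<otimes> t) \<odot>\<^bsub>M\<^esub> (x' \<odot>\<^bsub>M\<^esub> y'))"
      unfolding eu ev by (simp add: smult_assoc1 smult_lcomm)
    finally show "?f (x, s) (y, t) = ?f (x', s') (y', t')"
      by (intro fraction_eqI[of "u \<otimes> v"]) auto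
  qed
  from UN_equiv_class2[OF reg.equiv_loc_rel equiv_loc_rel this, of "(a, s)" "(y, t)"] assms
  show ?thesis by (simp add: loc_module_def Let_def case_prod_unfold fraction_def)
qed

text \<open>Finitely many conditions, each satisfied by some \<open>t \<in> S\<close> and preserved by passing to multiples,
  have a common solution. This yields common denominators, and common multipliers for
  finitely many equalities of fractions.\<close>

lemma common_multiplier:
  assumes "finite A" "\<And>k. k \<in> A \<Longrightarrow> \<exists>t\<in>S. Q k t"
    and one: "\<one>\<^bsub>R\<^esub> \<in> S" and mult: "\<And>s t. s \<in> S \<Longrightarrow> t \<in> S \<Longrightarrow> s \<otimes>\<^bsub>R\<^esub> t \<in> S"
    and up: "\<And>k s t. k \<in> A \<Longrightarrow> s \<in> S \<Longrightarrow> t \<in> S \<Longrightarrow> Q k s \<or> Q k t \<Longrightarrow> Q k (s \<otimes>\<^bsub>R\<^esub> t)"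
  shows "\<exists>t\<in>S. \<forall>k\<in>A. Q k t"
  using assms(1,2) up
proof (induction A rule: finite_induct)
  case empty
  then show ?case using one by auto
next
  case (insert k A)
  obtain t where "t \<in> S" "\<forall>k\<in>A. Q k t" using insert.IH insert.prems by (metis insertCI)
  moreover obtain s where "s \<in> S" "Q k s" using insert.prems(1) by blast
  ultimately have "\<forall>j\<in>insert k A. Q j (s \<otimes>\<^bsub>R\<^esub> t)" using insert.prems(2) by blast
  then show ?case using \<open>s \<in> S\<close> \<open>t \<in> S\<close> mult by blast
qed

context localization
begin

text \<open>The localized ring is the localization of the regular module, with the scalar action as
  multiplication.\<close>

lemma loc_ring_simps:
  "carrier (loc_ring R S) = carrier (loc_module R S (regular_module R))"
  "X \<oplus>\<^bsub>loc_ring R S\<^esub> Y = X \<oplus>\<^bsub>loc_module R S (regular_module R)\<^esub> Y"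
  "X \<otimes>\<^bsub>loc_ring R S\<^esub> Y = X \<odot>\<^bsub>loc_module R S (regular_module R)\<^esub> Y"
  by (simp_all add: loc_ring_def loc_module_def Let_def)

text \<open>Let \<open>h : M\<^sub>S \<rightarrow> R\<^sub>S\<^sup>n\<close> be an isomorphism and \<open>D\<^sub>i(m)\<close> the \<open>i\<close>-th coordinate of \<open>h(m/1)\<close>. A
  coordinate function of \<open>h\<close> lifts to a form on \<open>M\<close> up to a denominator, because a dual basis of \<open>M\<close>
  allows to define a form from numerators of the values \<open>D\<^sub>i(x\<^sub>j)\<close>; a standard basis vector lifts
  to an element of \<open>M\<close> up to a denominator, because \<open>h\<close> is onto. The two identities then hold as
  equalities of fractions, the second one since \<open>h\<close> is injective. There are finitely many of them, as
  the second needs to be checked at the \<open>x\<^sub>j\<close> only, so that a single multiplier from \<open>S\<close> turns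
  them into identities in \<open>R\<close> and \<open>M\<close>.\<close>

lemma basis_lifts:
  assumes fr: "free_of_rank (loc_ring R S) (loc_module R S M) n"
    and fg: "finitely_generated R M" and pr: "projective R M"
  shows "\<exists>s\<in>S. \<exists>f g. (\<forall>i<n. f i \<in> carrier M \<and> lin_form R M (g i)) \<and>
    (\<forall>i<n. \<forall>j<n. g i (f j) = (if i = j then s else \<zero>)) \<and>
    (\<forall>q\<in>carrier M. s \<odot>\<^bsub>M\<^esub> q = (\<Oplus>\<^bsub>M\<^esub>i\<in>{..<n}. g i q \<odot>\<^bsub>M\<^esub> f i))"
proof -
  interpret reg: localization R "regular_module R" S by (rule localization_regular)
  let ?L = "loc_ring R S"
  define fm where "fm = fraction R S M"
  define fr where "fr = fraction R S (regular_module R)"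
  have carL: "carrier ?L = {fr r s | r s. r \<in> carrier R \<and> s \<in> S}"
    by (simp add: loc_ring_simps reg.loc_module_carrier fr_def)
  have addL: "fr a s \<oplus>\<^bsub>?L\<^esub> fr b t = fr (t \<otimes> a \<oplus> s \<otimes> b) (s \<otimes> t)"
    if "a \<in> carrier R" "s \<in> S" "b \<in> carrier R" "t \<in> S" for a b s t
    using reg.loc_module_add[of a s b t] that by (simp add: fr_def loc_ring_simps)
  have multL: "fr a s \<otimes>\<^bsub>?L\<^esub> fr b t = fr (a \<otimes> b) (s \<otimes> t)"
    if "a \<in> carrier R" "s \<in> S" "b \<in> carrier R" "t \<in> S" for a b s t
    using reg.loc_module_smult[of a s b t] that by (simp add: fr_def loc_ring_simps)
  have fr_eqI: "fr a s = fr b t" if "t \<otimes> a = s \<otimes> b" "a \<in> carrier R" "s \<in> S" "b \<in> carrier R" "t \<in> S" for a b s t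
    unfolding fr_def by (rule reg.fraction_eqI[of \<one>]) (use that in auto)
  have fr_eqD: "\<exists>u\<in>S. u \<otimes> (t \<otimes> a) = u \<otimes> (s \<otimes> b)"
    if "fr a s = fr b t" "a \<in> carrier R" "s \<in> S" "b \<in> carrier R" "t \<in> S" for a b s t
    using that reg.fraction_eq_iff[of a s b t] by (simp add: fr_def)
  have addL': "fr a t \<oplus>\<^bsub>?L\<^esub> fr b t = fr (a \<oplus> b) t"
    if "a \<in> carrier R" "b \<in> carrier R" "t \<in> S" for a b t
    using that by (simp add: addL, intro fr_eqI) (auto simp: R.r_distr R.m_assoc)
  obtain h where h: "h \<in> lin_maps ?L (loc_module R S M) (free_module ?L {..<n})"
    and bij: "bij_betw h (carrier (loc_module R S M)) (carrier (free_module ?L {..<n}))"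
    using fr unfolding free_of_rank_def module_iso_def by blast
  have fm_cl: "fm x s \<in> carrier (loc_module R S M)" if "x \<in> carrier M" "s \<in> S" for x s
    using that by (auto simp: fm_def loc_module_carrier)
  have fr_cl: "fr r s \<in> carrier ?L" if "r \<in> carrier R" "s \<in> S" for r s
    using that by (auto simp: carL)
  define D where "D i m = h (fm m \<one>) i" for i m
  have h_fun: "h (fm x s) \<in> {..<n} \<rightarrow>\<^sub>E carrier ?L" if "x \<in> carrier M" "s \<in> S" for x s
  proof -
    have "h (fm x s) \<in> carrier (free_module ?L {..<n})" using h fm_cl[OF that] by (auto simp: lin_maps_def)
    then show ?thesis by (simp add: free_module_simps)
  qed
  have h_smult: "h (fm (a \<odot>\<^bsub>M\<^esub> x) (t \<otimes> s)) = (\<lambda>i\<in>{..<n}. fr a t \<otimes>\<^bsub>?L\<^esub> h (fm x s) i)"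
    if "a \<in> carrier R" "x \<in> carrier M" "s \<in> S" "t \<in> S" for a x s t
  proof -
    have "h (fr a t \<odot>\<^bsub>loc_module R S M\<^esub> fm x s) = fr a t \<odot>\<^bsub>free_module ?L {..<n}\<^esub> h (fm x s)"
      using h fm_cl[of x s] fr_cl[of a t] that by (simp add: lin_maps_def)
    then show ?thesis using that by (simp add: free_module_simps fr_def fm_def loc_module_smult)
  qed
  have D_cl: "D i m \<in> carrier ?L" if "m \<in> carrier M" "i < n" for i m
    using PiE_mem[OF h_fun[of m \<one>]] that by (auto simp: D_def)
  have D_add: "D i (x \<oplus>\<^bsub>M\<^esub> y) = D i x \<oplus>\<^bsub>?L\<^esub> D i y" if "x \<in> carrier M" "y \<in> carrier M" "i < n" for i x y
  proof -
    have "h (fm x \<one> \<oplus>\<^bsub>loc_module R S M\<^esub> fm y \<one>) = h (fm x \<one>) \<oplus>\<^bsub>free_module ?L {..<n}\<^esub> h (fm y \<one>)"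
      using h fm_cl that by (simp add: lin_maps_def)
    then show ?thesis using that by (simp add: free_module_simps fm_def loc_module_add D_def)
  qed
  have D_smult: "D i (a \<odot>\<^bsub>M\<^esub> x) = fr a \<one> \<otimes>\<^bsub>?L\<^esub> D i x" if "a \<in> carrier R" "x \<in> carrier M" "i < n" for i a x
    using h_smult[of a x \<one> \<one>] that by (simp add: D_def)
  have D_zero: "D i \<zero>\<^bsub>M\<^esub> = fr \<zero> t" if i: "i < n" and t: "t \<in> S" for i t
  proof -
    obtain r s where rs: "D i \<zero>\<^bsub>M\<^esub> = fr r s" "r \<in> carrier R" "s \<in> S"
      using D_cl[of "\<zero>\<^bsub>M\<^esub>" i] i by (auto simp: carL)
    have "D i \<zero>\<^bsub>M\<^esub> = fr \<zero> \<one> \<otimes>\<^bsub>?L\<^esub> fr r s" using D_smult[of \<zero> "\<zero>\<^bsub>M\<^esub>" i] i rs by simp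
    also have "\<dots> = fr \<zero> t" using rs t by (simp add: multL, intro fr_eqI) auto
    finally show ?thesis .
  qed
  obtain J :: "'c set" and x \<xi> where J: "finite J" and x: "x \<in> J \<rightarrow> carrier M"
    and \<xi>: "\<And>j. j \<in> J \<Longrightarrow> lin_form R M (\<xi> j)"
    and dual: "\<And>m. m \<in> carrier M \<Longrightarrow> m = (\<Oplus>\<^bsub>M\<^esub>j\<in>J. \<xi> j m \<odot>\<^bsub>M\<^esub> x j)"
    using finite_dual_basis[OF fg pr] by blast
  have xc: "x j \<in> carrier M" if "j \<in> J" for j using x that by auto

  \<comment> \<open>the values \<open>D\<^sub>i(x\<^sub>j)\<close> get a common denominator \<open>t\<close>\<close>
  have "\<exists>t\<in>S. \<forall>k\<in>{..<n} \<times> J. \<exists>r\<in>carrier R. D (fst k) (x (snd k)) = fr r t"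
  proof (rule common_multiplier[where R = R])
    show "finite ({..<n} \<times> J)" using J by simp
    fix k assume "k \<in> {..<n} \<times> J"
    then show "\<exists>t\<in>S. \<exists>r\<in>carrier R. D (fst k) (x (snd k)) = fr r t"
      using D_cl[of "x (snd k)" "fst k"] xc[of "snd k"] unfolding carL by force
  next
    fix k s t assume st: "s \<in> S" "t \<in> S"
      and "(\<exists>r\<in>carrier R. D (fst k) (x (snd k)) = fr r s) \<or> (\<exists>r\<in>carrier R. D (fst k) (x (snd k)) = fr r t)"
    then obtain r where "r \<in> carrier R" "D (fst k) (x (snd k)) = fr r s \<or> D (fst k) (x (snd k)) = fr r t" by blast
    moreover have "fr r s = fr (t \<otimes> r) (s \<otimes> t)"
      by (rule fr_eqI) (use st \<open>r \<in> carrier R\<close> in \<open>auto simp: R.m_ac\<close>)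
    moreover have "fr r t = fr (s \<otimes> r) (s \<otimes> t)"
      by (rule fr_eqI) (use st \<open>r \<in> carrier R\<close> in \<open>auto simp: R.m_ac\<close>)
    ultimately show "\<exists>r\<in>carrier R. D (fst k) (x (snd k)) = fr r (s \<otimes> t)"
      using st by (metis R.m_closed S_carrier)
  qed simp_all
  then obtain t r where t: "t \<in> S" and r: "\<And>i j. i < n \<Longrightarrow> j \<in> J \<Longrightarrow> r i j \<in> carrier R \<and> D i (x j) = fr (r i j) t"
    by (auto simp: Ball_def) metis
  define \<gamma> where "\<gamma> i m = (\<Oplus>j\<in>J. \<xi> j m \<otimes> r i j)" for i m
  have fin: "lin_form R M (\<lambda>m. \<Oplus>j\<in>A. \<xi> j m \<otimes> r i j) \<and>
      (\<forall>m\<in>carrier M. D i (\<Oplus>\<^bsub>M\<^esub>j\<in>A. \<xi> j m \<odot>\<^bsub>M\<^esub> x j) = fr (\<Oplus>j\<in>A. \<xi> j m \<otimes> r i j) t)"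
    if "finite A" "A \<subseteq> J" "i < n" for A i
    using that
  proof (induction A rule: finite_induct)
    case empty
    then show ?case using t D_zero by (simp add: lin_form_def)
  next
    case (insert j A)
    have j: "j \<in> J" and A: "A \<subseteq> J" using insert.prems by auto
    have cl: "\<xi> j m \<in> carrier R" if "j \<in> J" "m \<in> carrier M" for j m
      using lin_form_closed[OF \<xi>] that by simp
    let ?S = "\<lambda>m. \<Oplus>j\<in>A. \<xi> j m \<otimes> r i j" and ?T = "\<lambda>m. \<Oplus>\<^bsub>M\<^esub>j\<in>A. \<xi> j m \<odot>\<^bsub>M\<^esub> x j"
    have Sc: "?S m \<in> carrier R" and Tc: "?T m \<in> carrier M" if "m \<in> carrier M" for m
      using A cl r \<open>i < n\<close> xc that by (auto intro!: R.finsum_closed M.finsum_closed)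
    have eqS: "(\<Oplus>j\<in>insert j A. \<xi> j m \<otimes> r i j) = \<xi> j m \<otimes> r i j \<oplus> ?S m" if "m \<in> carrier M" for m
      using insert.hyps A j cl r \<open>i < n\<close> that by (subst R.finsum_insert) auto
    have eqT: "(\<Oplus>\<^bsub>M\<^esub>j\<in>insert j A. \<xi> j m \<odot>\<^bsub>M\<^esub> x j) = \<xi> j m \<odot>\<^bsub>M\<^esub> x j \<oplus>\<^bsub>M\<^esub> ?T m" if "m \<in> carrier M" for m
      using insert.hyps A j cl xc that by (subst M.finsum_insert) auto
    have IH: "lin_form R M ?S" "\<And>m. m \<in> carrier M \<Longrightarrow> D i (?T m) = fr (?S m) t"
      using insert.IH A \<open>i < n\<close> by auto
    have "lin_form R M (\<lambda>m. r i j \<otimes> \<xi> j m \<oplus> \<one> \<otimes> ?S m)"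
      using \<xi>[OF j] IH(1) r[OF \<open>i < n\<close> j] by (intro lin_form_comb) auto
    then have "lin_form R M (\<lambda>m. \<Oplus>j\<in>insert j A. \<xi> j m \<otimes> r i j)"
      using eqS Sc cl[OF j] r[OF \<open>i < n\<close> j] by (simp add: lin_form_def R.m_comm Pi_iff)
    moreover have "D i (\<xi> j m \<odot>\<^bsub>M\<^esub> x j \<oplus>\<^bsub>M\<^esub> ?T m) = fr (\<xi> j m \<otimes> r i j \<oplus> ?S m) t" if m: "m \<in> carrier M" for m
      using m cl[OF j m] r[OF \<open>i < n\<close> j] xc[OF j] Tc[OF m] Sc[OF m] IH(2)[OF m] t \<open>i < n\<close>
      by (simp add: D_add D_smult multL addL')
    ultimately show ?case by (simp add: eqS eqT)
  qed
  have \<gamma>: "lin_form R M (\<gamma> i)" and D\<gamma>: "m \<in> carrier M \<Longrightarrow> D i m = fr (\<gamma> i m) t" if "i < n" for i m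
    using fin[OF J order_refl that] dual[of m] by (auto simp: \<gamma>_def[abs_def])
  note \<gamma>_cl = lin_form_closed[OF \<gamma>]

  \<comment> \<open>vectors \<open>y\<^sub>j\<close> that \<open>h\<close> maps to \<open>s\<close> times the standard basis\<close>
  have "\<exists>s\<in>S. \<forall>j\<in>{..<n}. \<exists>y\<in>carrier M. \<forall>i<n. D i y = fr (if i = j then s else \<zero>) \<one>"
  proof (rule common_multiplier[where R = R])
    fix j assume j: "j \<in> {..<n}"
    define \<delta> where "\<delta> = (\<lambda>i\<in>{..<n}. fr (if i = j then \<one> else \<zero>) \<one>)"
    have "\<delta> \<in> carrier (free_module ?L {..<n})" by (auto simp: free_module_simps \<delta>_def fr_cl)
    then have "\<delta> \<in> h ` carrier (loc_module R S M)" using bij by (simp add: bij_betw_def)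
    then obtain X where "X \<in> carrier (loc_module R S M)" "h X = \<delta>" by (rule imageE) auto
    then obtain y s where y: "y \<in> carrier M" "s \<in> S" "h (fm y s) = \<delta>"
      by (auto simp: loc_module_carrier fm_def)
    have "fm y \<one> = fm (s \<odot>\<^bsub>M\<^esub> y) (\<one> \<otimes> s)"
      unfolding fm_def using y by (intro fraction_eqI[of \<one>]) auto
    then have "D i y = fr s \<one> \<otimes>\<^bsub>?L\<^esub> \<delta> i" if "i < n" for i
      using h_smult[of s y s \<one>] y that by (simp add: D_def)
    then have "\<forall>i<n. D i y = fr (if i = j then s else \<zero>) \<one>"
      using y by (auto simp: \<delta>_def multL)
    then show "\<exists>s\<in>S. \<exists>y\<in>carrier M. \<forall>i<n. D i y = fr (if i = j then s else \<zero>) \<one>" using y by blast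
  next
    fix j s s' assume st: "s \<in> S" "s' \<in> S"
      and or: "(\<exists>y\<in>carrier M. \<forall>i<n. D i y = fr (if i = j then s else \<zero>) \<one>) \<or>
        (\<exists>y\<in>carrier M. \<forall>i<n. D i y = fr (if i = j then s' else \<zero>) \<one>)"
    have "\<exists>y\<in>carrier M. \<forall>i<n. D i y = fr (if i = j then a \<otimes> b else \<zero>) \<one>"
      if "a \<in> S" "b \<in> S" "y \<in> carrier M" "\<forall>i<n. D i y = fr (if i = j then b else \<zero>) \<one>" for a b y
      using that by (intro bexI[of _ "a \<odot>\<^bsub>M\<^esub> y"]) (auto simp: D_smult multL)
    moreover have "s' \<otimes> s = s \<otimes> s'" using st R.m_comm[of s s'] by simp
    ultimately show "\<exists>y\<in>carrier M. \<forall>i<n. D i y = fr (if i = j then s \<otimes> s' else \<zero>) \<one>"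
      using or st by metis
  qed simp_all
  then obtain s y where s: "s \<in> S" and yc: "\<And>j. j < n \<Longrightarrow> y j \<in> carrier M"
    and Dy: "\<And>i j. i < n \<Longrightarrow> j < n \<Longrightarrow> D i (y j) = fr (if i = j then s else \<zero>) \<one>"
    by (auto simp: Ball_def) metis

  have "\<exists>u\<in>S. \<forall>k\<in>{..<n} \<times> {..<n}. u \<otimes> \<gamma> (fst k) (y (snd k)) = u \<otimes> (if fst k = snd k then t \<otimes> s else \<zero>)"
  proof (rule common_multiplier[where R = R])
    fix k assume "k \<in> {..<n} \<times> {..<n}"
    then have k: "fst k < n" "snd k < n" by auto
    have "fr (\<gamma> (fst k) (y (snd k))) t = fr (if fst k = snd k then s else \<zero>) \<one>"
      using Dy[OF k] D\<gamma>[OF k(1) yc[OF k(2)]] by simp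
    from fr_eqD[OF this] show "\<exists>u\<in>S. u \<otimes> \<gamma> (fst k) (y (snd k)) = u \<otimes> (if fst k = snd k then t \<otimes> s else \<zero>)"
      using k \<gamma>_cl yc s t by (auto split: if_splits)
  next
    fix k u v assume k: "k \<in> {..<n} \<times> {..<n}" and uv: "u \<in> S" "v \<in> S"
      and or: "u \<otimes> \<gamma> (fst k) (y (snd k)) = u \<otimes> (if fst k = snd k then t \<otimes> s else \<zero>) \<or>
        v \<otimes> \<gamma> (fst k) (y (snd k)) = v \<otimes> (if fst k = snd k then t \<otimes> s else \<zero>)"
    have cl: "\<gamma> (fst k) (y (snd k)) \<in> carrier R" "(if fst k = snd k then t \<otimes> s else \<zero>) \<in> carrier R"
      using k \<gamma>_cl yc s t by auto
    have "u \<otimes> v \<otimes> a = u \<otimes> v \<otimes> b"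
      if "u \<otimes> a = u \<otimes> b \<or> v \<otimes> a = v \<otimes> b" "a \<in> carrier R" "b \<in> carrier R" for a b
    proof -
      have "u \<otimes> v \<otimes> a = v \<otimes> (u \<otimes> a)" "u \<otimes> v \<otimes> a = u \<otimes> (v \<otimes> a)"
        "u \<otimes> v \<otimes> b = v \<otimes> (u \<otimes> b)" "u \<otimes> v \<otimes> b = u \<otimes> (v \<otimes> b)"
        using that uv by (simp_all add: R.m_ac)
      with that show ?thesis by metis
    qed
    from this[OF or cl] show "u \<otimes> v \<otimes> \<gamma> (fst k) (y (snd k)) = u \<otimes> v \<otimes> (if fst k = snd k then t \<otimes> s else \<zero>)" .
  qed simp_all
  then obtain u where u: "u \<in> S"
    and \<gamma>y: "\<And>i j. i < n \<Longrightarrow> j < n \<Longrightarrow> u \<otimes> \<gamma> i (y j) = u \<otimes> (if i = j then t \<otimes> s else \<zero>)"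
    by auto

  let ?c = "\<lambda>m. \<Oplus>\<^bsub>M\<^esub>i\<in>{..<n}. \<gamma> i m \<odot>\<^bsub>M\<^esub> y i"
  have c_cl: "(\<Oplus>\<^bsub>M\<^esub>i\<in>A. \<gamma> i m \<odot>\<^bsub>M\<^esub> y i) \<in> carrier M" if "A \<subseteq> {..<n}" "m \<in> carrier M" for A m
    using that \<gamma>_cl yc by (intro M.finsum_closed) auto
  have Dc: "D l (\<Oplus>\<^bsub>M\<^esub>i\<in>A. \<gamma> i m \<odot>\<^bsub>M\<^esub> y i) = fr (if l \<in> A then \<gamma> l m \<otimes> s else \<zero>) \<one>"
    if "finite A" "A \<subseteq> {..<n}" "l < n" "m \<in> carrier M" for A l m
    using that
  proof (induction A rule: finite_induct)
    case empty
    then show ?case using D_zero by simp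
  next
    case (insert i A)
    have i: "i < n" and A: "A \<subseteq> {..<n}" using insert.prems by auto
    have "(\<Oplus>\<^bsub>M\<^esub>i\<in>insert i A. \<gamma> i m \<odot>\<^bsub>M\<^esub> y i) = \<gamma> i m \<odot>\<^bsub>M\<^esub> y i \<oplus>\<^bsub>M\<^esub> (\<Oplus>\<^bsub>M\<^esub>i\<in>A. \<gamma> i m \<odot>\<^bsub>M\<^esub> y i)"
      using insert i A \<gamma>_cl yc by (subst M.finsum_insert) auto
    then have "D l (\<Oplus>\<^bsub>M\<^esub>i\<in>insert i A. \<gamma> i m \<odot>\<^bsub>M\<^esub> y i) =
        fr (\<gamma> i m) \<one> \<otimes>\<^bsub>?L\<^esub> fr (if l = i then s else \<zero>) \<one> \<oplus>\<^bsub>?L\<^esub> fr (if l \<in> A then \<gamma> l m \<otimes> s else \<zero>) \<one>"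
      using insert i A c_cl[OF A] \<gamma>_cl[OF i] yc[OF i] by (simp add: D_add D_smult Dy)
    also have "\<dots> = fr (if l \<in> insert i A then \<gamma> l m \<otimes> s else \<zero>) \<one>"
      using insert i s \<gamma>_cl by (auto simp: multL addL')
    finally show ?case .
  qed
  have inj: "inj_on h (carrier (loc_module R S M))" using bij by (simp add: bij_betw_def)
  have "\<exists>v\<in>S. \<forall>j\<in>J. v \<odot>\<^bsub>M\<^esub> ?c (x j) = v \<odot>\<^bsub>M\<^esub> ((t \<otimes> s) \<odot>\<^bsub>M\<^esub> x j)"
  proof (rule common_multiplier[where R = R])
    fix j assume "j \<in> J"
    then have xj: "x j \<in> carrier M" by (rule xc)
    have "D l (?c (x j)) = D l ((t \<otimes> s) \<odot>\<^bsub>M\<^esub> x j)" if l: "l < n" for l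
    proof -
      have "D l ((t \<otimes> s) \<odot>\<^bsub>M\<^esub> x j) = fr ((t \<otimes> s) \<otimes> \<gamma> l (x j)) t"
        using l xj t s by (simp add: D\<gamma> lin_form_smult[OF \<gamma>])
      also have "\<dots> = fr (\<gamma> l (x j) \<otimes> s) \<one>"
        using t s \<gamma>_cl[OF l xj] by (intro fr_eqI) (auto simp: R.m_ac)
      finally show ?thesis using Dc[of "{..<n}" l "x j"] l xj by simp
    qed
    then have "h (fm (?c (x j)) \<one>) = h (fm ((t \<otimes> s) \<odot>\<^bsub>M\<^esub> x j) \<one>)"
      using h_fun[of "?c (x j)" \<one>] h_fun[of "(t \<otimes> s) \<odot>\<^bsub>M\<^esub> x j" \<one>] c_cl[OF order_refl xj] xj t s
      by (intro extensionalityI[of _ "{..<n}"]) (auto simp: D_def PiE_iff)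
    then have "fm (?c (x j)) \<one> = fm ((t \<otimes> s) \<odot>\<^bsub>M\<^esub> x j) \<one>"
      using inj c_cl[OF order_refl xj] xj t s by (intro inj_onD[OF inj] fm_cl) auto
    then show "\<exists>v\<in>S. v \<odot>\<^bsub>M\<^esub> ?c (x j) = v \<odot>\<^bsub>M\<^esub> ((t \<otimes> s) \<odot>\<^bsub>M\<^esub> x j)"
      using c_cl[OF order_refl xj] xj t s by (simp add: fm_def fraction_eq_iff)
  next
    fix j v w assume "j \<in> J" and vw: "v \<in> S" "w \<in> S"
      and or: "v \<odot>\<^bsub>M\<^esub> ?c (x j) = v \<odot>\<^bsub>M\<^esub> ((t \<otimes> s) \<odot>\<^bsub>M\<^esub> x j) \<or> w \<odot>\<^bsub>M\<^esub> ?c (x j) = w \<odot>\<^bsub>M\<^esub> ((t \<otimes> s) \<odot>\<^bsub>M\<^esub> x j)"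
    have cl: "?c (x j) \<in> carrier M" "(t \<otimes> s) \<odot>\<^bsub>M\<^esub> x j \<in> carrier M"
      using c_cl[OF order_refl xc[OF \<open>j \<in> J\<close>]] xc[OF \<open>j \<in> J\<close>] t s by auto
    have "(v \<otimes> w) \<odot>\<^bsub>M\<^esub> a = (v \<otimes> w) \<odot>\<^bsub>M\<^esub> b"
      if "v \<odot>\<^bsub>M\<^esub> a = v \<odot>\<^bsub>M\<^esub> b \<or> w \<odot>\<^bsub>M\<^esub> a = w \<odot>\<^bsub>M\<^esub> b" "a \<in> carrier M" "b \<in> carrier M" for a b
    proof -
      have "(v \<otimes> w) \<odot>\<^bsub>M\<^esub> a = w \<odot>\<^bsub>M\<^esub> (v \<odot>\<^bsub>M\<^esub> a)" "(v \<otimes> w) \<odot>\<^bsub>M\<^esub> a = v \<odot>\<^bsub>M\<^esub> (w \<odot>\<^bsub>M\<^esub> a)"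
        "(v \<otimes> w) \<odot>\<^bsub>M\<^esub> b = w \<odot>\<^bsub>M\<^esub> (v \<odot>\<^bsub>M\<^esub> b)" "(v \<otimes> w) \<odot>\<^bsub>M\<^esub> b = v \<odot>\<^bsub>M\<^esub> (w \<odot>\<^bsub>M\<^esub> b)"
        using that vw by (simp_all add: smult_assoc1 smult_lcomm)
      with that(1) show ?thesis by metis
    qed
    from this[OF or cl] show "(v \<otimes> w) \<odot>\<^bsub>M\<^esub> ?c (x j) = (v \<otimes> w) \<odot>\<^bsub>M\<^esub> ((t \<otimes> s) \<odot>\<^bsub>M\<^esub> x j)" .
  qed (simp_all add: J)
  then obtain v where v: "v \<in> S" and vx: "\<And>j. j \<in> J \<Longrightarrow> v \<odot>\<^bsub>M\<^esub> ?c (x j) = v \<odot>\<^bsub>M\<^esub> ((t \<otimes> s) \<odot>\<^bsub>M\<^esub> x j)"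
    by blast
  define w where "w = u \<otimes> v"
  have w: "w \<in> S" using u v by (simp add: w_def)
  define g where "g i m = w \<otimes> \<gamma> i m" for i m
  have g: "lin_form R M (g i)" if "i < n" for i
    unfolding g_def[abs_def] using \<gamma>[OF that] w by (intro lin_form_scale) auto
  let ?s = "w \<otimes> (t \<otimes> s)"
  have gy: "g i (y j) = (if i = j then ?s else \<zero>)" if "i < n" "j < n" for i j
  proof -
    have "g i (y j) = v \<otimes> (u \<otimes> \<gamma> i (y j))" using that u v \<gamma>_cl yc by (simp add: g_def w_def R.m_ac)
    also have "\<dots> = (if i = j then ?s else \<zero>)" using \<gamma>y[OF that] u v t s by (simp add: w_def R.m_ac)
    finally show ?thesis .
  qed
  define C where "C m = (\<Oplus>\<^bsub>M\<^esub>i\<in>{..<n}. g i m \<odot>\<^bsub>M\<^esub> y i)" for m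
  have gc: "(\<lambda>i. g i m \<odot>\<^bsub>M\<^esub> y i) \<in> {..<n} \<rightarrow> carrier M" if "m \<in> carrier M" for m
    using lin_form_closed[OF g] yc that by auto
  have C_cl: "C m \<in> carrier M" if "m \<in> carrier M" for m
    unfolding C_def using gc[OF that] by (rule M.finsum_closed)
  have C_add: "C (m \<oplus>\<^bsub>M\<^esub> m') = C m \<oplus>\<^bsub>M\<^esub> C m'" if "m \<in> carrier M" "m' \<in> carrier M" for m m'
  proof -
    have "C (m \<oplus>\<^bsub>M\<^esub> m') = (\<Oplus>\<^bsub>M\<^esub>i\<in>{..<n}. g i m \<odot>\<^bsub>M\<^esub> y i \<oplus>\<^bsub>M\<^esub> g i m' \<odot>\<^bsub>M\<^esub> y i)"
      unfolding C_def using that lin_form_simps[OF g] yc gc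
      by (intro M.finsum_cong') (auto simp: smult_l_distr)
    also have "\<dots> = C m \<oplus>\<^bsub>M\<^esub> C m'" unfolding C_def using gc that by (intro M.finsum_addf) auto
    finally show ?thesis .
  qed
  have C_smult: "C (a \<odot>\<^bsub>M\<^esub> m) = a \<odot>\<^bsub>M\<^esub> C m" if "a \<in> carrier R" "m \<in> carrier M" for a m
  proof -
    have "a \<odot>\<^bsub>M\<^esub> C m = (\<Oplus>\<^bsub>M\<^esub>i\<in>{..<n}. a \<odot>\<^bsub>M\<^esub> (g i m \<odot>\<^bsub>M\<^esub> y i))"
      unfolding C_def using gc that by (intro finsum_smult_ldistr) auto
    also have "\<dots> = C (a \<odot>\<^bsub>M\<^esub> m)" unfolding C_def
      using that lin_form_simps[OF g] yc gc by (intro M.finsum_cong') (auto simp: smult_assoc1)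
    finally show ?thesis by simp
  qed
  have Cx: "C (x j) = ?s \<odot>\<^bsub>M\<^esub> x j" if "j \<in> J" for j
  proof -
    have "C (x j) = (\<Oplus>\<^bsub>M\<^esub>i\<in>{..<n}. w \<odot>\<^bsub>M\<^esub> (\<gamma> i (x j) \<odot>\<^bsub>M\<^esub> y i))"
      unfolding C_def using w \<gamma>_cl yc xc[OF that]
      by (intro M.finsum_cong') (auto simp: g_def smult_assoc1)
    also have "\<dots> = w \<odot>\<^bsub>M\<^esub> ?c (x j)"
      using w \<gamma>_cl yc xc[OF that] by (intro finsum_smult_ldistr[symmetric]) auto
    also have "\<dots> = u \<odot>\<^bsub>M\<^esub> (v \<odot>\<^bsub>M\<^esub> ?c (x j))"
      using u v c_cl[OF order_refl xc[OF that]] by (simp add: w_def smult_assoc1)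
    also have "\<dots> = ?s \<odot>\<^bsub>M\<^esub> x j" using u v t s xc[OF that] by (simp add: vx[OF that] w_def smult_assoc1)
    finally show ?thesis .
  qed
  have C_eq: "C m = ?s \<odot>\<^bsub>M\<^esub> m" if m: "m \<in> carrier M" for m
  proof -
    have cl: "\<xi> j m \<in> carrier R" if "j \<in> J" for j using lin_form_closed[OF \<xi>[OF that] m] .
    have "C (\<Oplus>\<^bsub>M\<^esub>j\<in>A. \<xi> j m \<odot>\<^bsub>M\<^esub> x j) = ?s \<odot>\<^bsub>M\<^esub> (\<Oplus>\<^bsub>M\<^esub>j\<in>A. \<xi> j m \<odot>\<^bsub>M\<^esub> x j)"
      if "finite A" "A \<subseteq> J" for A
      using that
    proof (induction A rule: finite_induct)
      case empty
      then show ?case using C_smult[of \<zero> "\<zero>\<^bsub>M\<^esub>"] C_cl[of "\<zero>\<^bsub>M\<^esub>"] w t s by simp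
    next
      case (insert j A)
      have j: "j \<in> J" and A: "A \<subseteq> J" using insert.prems by auto
      have 1: "(\<lambda>j. \<xi> j m \<odot>\<^bsub>M\<^esub> x j) \<in> A \<rightarrow> carrier M" using A cl xc by auto
      have 2: "?s \<in> carrier R" using w t s by simp
      show ?case using insert.hyps insert.IH[OF A] 1 2 cl[OF j] xc[OF j]
        by (simp add: C_add C_smult Cx[OF j] smult_r_distr smult_lcomm M.finsum_closed del: S_mult)
    qed
    from this[OF J order_refl] show ?thesis using dual[OF m] by simp
  qed
  show ?thesis
    using w t s yc g gy C_eq
    by (intro bexI[of _ ?s] exI[of _ y] exI[of _ g]) (auto simp: C_def)
qed

end

section \<open>Elementary transvections of the direct sum\<close>

lemma (in group) normal_closure_normal:
  assumes "S \<subseteq> carrier G"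
  shows "normal_closure G S \<lhd> G"
proof -
  let ?F = "{K. K \<lhd> G \<and> S \<subseteq> K}"
  have ne: "carrier G \<in> ?F"
    using assms subgroup_self by (auto simp: normal_inv_iff)
  show ?thesis unfolding normal_closure_def
  proof (rule normal_invI)
    show "subgroup (\<Inter>?F) G"
      by (rule subgroups_Inter) (use ne in \<open>auto simp: normal_inv_iff\<close>)
    fix x h assume "x \<in> carrier G" "h \<in> \<Inter>?F"
    then show "x \<otimes> h \<otimes> inv x \<in> \<Inter>?F" by (auto simp: normal_inv_iff)
  qed
qed

lemma subset_normal_closure: "S \<subseteq> normal_closure G S"
  by (auto simp: normal_closure_def)

lemma normal_closure_minimal: "K \<lhd> G \<Longrightarrow> S \<subseteq> K \<Longrightarrow> normal_closure G S \<subseteq> K"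
  by (auto simp: normal_closure_def)

context module
begin

lemma module_ring_plus: "module R (ring_plus R M)"
  by (rule module_module_sum[OF R.module_regular_module module_axioms])

lemma lin_form_fst: "lin_form R (ring_plus R M) fst"
  by (auto simp: lin_form_def)

lemma lin_form_snd: "lin_form R M \<tau> \<Longrightarrow> lin_form R (ring_plus R M) (\<lambda>p. \<tau> (snd p))"
  by (auto simp: lin_form_def Pi_iff)

lemma E_vec_transv:
  assumes "x \<in> carrier M"
  shows "E_vec R M x = transv R (ring_plus R M) fst (\<zero>, x)"
  unfolding E_vec_def transv_def using assms by (intro restrict_ext) auto

lemma E_form_transv:
  assumes "lin_form R M \<tau>"
  shows "E_form R M \<tau> = transv R (ring_plus R M) (\<lambda>p. \<tau> (snd p)) (\<one>, \<zero>\<^bsub>M\<^esub>)"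
  unfolding E_form_def transv_def using assms by (intro restrict_ext) (auto simp: lin_form_closed)

lemma dual_module_simps [simp]:
  "\<xi> \<oplus>\<^bsub>dual_module R M\<^esub> \<eta> = (\<lambda>x\<in>carrier M. \<xi> x \<oplus> \<eta> x)"
  "a \<odot>\<^bsub>dual_module R M\<^esub> \<xi> = (\<lambda>x\<in>carrier M. a \<otimes> \<xi> x)"
  "\<zero>\<^bsub>dual_module R M\<^esub> = (\<lambda>x\<in>carrier M. \<zero>)"
  by (simp_all add: dual_module_def)

lemma dual_module_carrier: "\<xi> \<in> carrier (dual_module R M) \<longleftrightarrow> lin_form R M \<xi> \<and> \<xi> \<in> extensional (carrier M)"
  by (auto simp: dual_module_def lin_maps_def lin_form_def PiE_iff Pi_iff)

lemma dual_smult_closed: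
  "a \<in> carrier R \<Longrightarrow> \<xi> \<in> carrier (dual_module R M) \<Longrightarrow> a \<odot>\<^bsub>dual_module R M\<^esub> \<xi> \<in> carrier (dual_module R M)"
  unfolding dual_module_carrier using lin_form_scale[of \<xi> a] by (auto simp: lin_form_def)

lemma abelian_group_dual_module: "abelian_group (dual_module R M)"
proof (rule abelian_groupI)
  fix \<xi> \<eta> \<zeta>
  assume \<xi>: "\<xi> \<in> carrier (dual_module R M)" and \<eta>: "\<eta> \<in> carrier (dual_module R M)"
  show "\<xi> \<oplus>\<^bsub>dual_module R M\<^esub> \<eta> \<in> carrier (dual_module R M)"
    using \<xi> \<eta> unfolding dual_module_carrier by (auto simp: lin_form_def Pi_iff R.a_ac R.r_distr)
  show "\<xi> \<oplus>\<^bsub>dual_module R M\<^esub> \<eta> = \<eta> \<oplus>\<^bsub>dual_module R M\<^esub> \<xi>"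
    using \<xi> \<eta> by (auto simp: dual_module_carrier lin_form_closed R.a_comm intro!: restrict_ext)
  show "\<zero>\<^bsub>dual_module R M\<^esub> \<oplus>\<^bsub>dual_module R M\<^esub> \<xi> = \<xi>"
    using \<xi> by (intro extensionalityI[of _ "carrier M"]) (auto simp: dual_module_carrier lin_form_closed)
  have "(\<ominus> \<one>) \<odot>\<^bsub>dual_module R M\<^esub> \<xi> \<oplus>\<^bsub>dual_module R M\<^esub> \<xi> = \<zero>\<^bsub>dual_module R M\<^esub>"
    using \<xi> by (auto simp: dual_module_carrier lin_form_closed R.l_minus R.l_neg intro!: restrict_ext)
  then show "\<exists>\<eta>\<in>carrier (dual_module R M). \<eta> \<oplus>\<^bsub>dual_module R M\<^esub> \<xi> = \<zero>\<^bsub>dual_module R M\<^esub>"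
    using dual_smult_closed[OF _ \<xi>, of "\<ominus> \<one>"] by (intro bexI) auto
  assume \<zeta>: "\<zeta> \<in> carrier (dual_module R M)"
  show "\<xi> \<oplus>\<^bsub>dual_module R M\<^esub> \<eta> \<oplus>\<^bsub>dual_module R M\<^esub> \<zeta> = \<xi> \<oplus>\<^bsub>dual_module R M\<^esub> (\<eta> \<oplus>\<^bsub>dual_module R M\<^esub> \<zeta>)"
    using \<xi> \<eta> \<zeta> by (auto simp: dual_module_carrier lin_form_closed R.a_assoc intro!: restrict_ext)
next
  show "\<zero>\<^bsub>dual_module R M\<^esub> \<in> carrier (dual_module R M)"
    unfolding dual_module_carrier by (auto simp: lin_form_def)
qed

lemma E_vec_hom: "group_hom (add_monoid M) (Aut R (ring_plus R M)) (E_vec R M)"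
proof -
  interpret N: module R "ring_plus R M" by (rule module_ring_plus)
  show ?thesis
  proof (intro group_hom.intro group_hom_axioms.intro homI)
    show "group (add_monoid M)" by (rule M.a_group)
    show "group (Aut R (ring_plus R M))" by (rule N.Aut_group)
    fix x y assume x: "x \<in> carrier (add_monoid M)" and y: "y \<in> carrier (add_monoid M)"
    then show "E_vec R M x \<in> carrier (Aut R (ring_plus R M))"
      by (auto simp: E_vec_transv lin_form_fst intro!: N.transv_Aut)
    show "E_vec R M (x \<otimes>\<^bsub>add_monoid M\<^esub> y) = E_vec R M x \<otimes>\<^bsub>Aut R (ring_plus R M)\<^esub> E_vec R M y"
      using x y by (simp add: E_vec_transv lin_form_fst N.transv_mult_vec)
  qed
qed

lemma E_form_hom: "group_hom (add_monoid (dual_module R M)) (Aut R (ring_plus R M)) (E_form R M)"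
proof -
  interpret N: module R "ring_plus R M" by (rule module_ring_plus)
  interpret D: abelian_group "dual_module R M" by (rule abelian_group_dual_module)
  show ?thesis
  proof (intro group_hom.intro group_hom_axioms.intro homI)
    show "group (add_monoid (dual_module R M))" by (rule D.a_group)
    show "group (Aut R (ring_plus R M))" by (rule N.Aut_group)
    fix \<xi> \<eta> assume "\<xi> \<in> carrier (add_monoid (dual_module R M))" and "\<eta> \<in> carrier (add_monoid (dual_module R M))"
    then have \<xi>: "\<xi> \<in> carrier (dual_module R M)" "lin_form R M \<xi>" and \<eta>: "\<eta> \<in> carrier (dual_module R M)" "lin_form R M \<eta>"
      by (simp_all add: dual_module_carrier)
    have s: "lin_form R M (\<xi> \<oplus>\<^bsub>dual_module R M\<^esub> \<eta>)"
      using D.a_closed[OF \<xi>(1) \<eta>(1)] by (simp only: dual_module_carrier)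
    show "E_form R M \<xi> \<in> carrier (Aut R (ring_plus R M))"
      using \<xi> by (auto simp: E_form_transv lin_form_snd lin_form_zero intro!: N.transv_Aut)
    have "transv R (ring_plus R M) (\<lambda>p. (\<xi> \<oplus>\<^bsub>dual_module R M\<^esub> \<eta>) (snd p)) (\<one>, \<zero>\<^bsub>M\<^esub>) =
        transv R (ring_plus R M) (\<lambda>p. \<xi> (snd p) \<oplus> \<eta> (snd p)) (\<one>, \<zero>\<^bsub>M\<^esub>)"
      by (rule N.transv_cong) auto
    then show "E_form R M (\<xi> \<otimes>\<^bsub>add_monoid (dual_module R M)\<^esub> \<eta>) = E_form R M \<xi> \<otimes>\<^bsub>Aut R (ring_plus R M)\<^esub> E_form R M \<eta>"
      using \<xi> \<eta> s by (simp add: E_form_transv lin_form_snd lin_form_zero N.transv_mult_form del: dual_module_simps)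
  qed
qed

end

lemma (in group_hom) generate_image_subset:
  assumes "X \<subseteq> carrier G" "h ` X \<subseteq> K" "subgroup K H"
  shows "h ` generate G X \<subseteq> K"
  using generate_img[OF assms(1)] H.generate_subgroup_incl[OF assms(2,3)] by simp

context module
begin

lemma ideal_smult_generators:
  assumes "ideal I R"
  shows "{a \<odot>\<^bsub>M\<^esub> x | a x. a \<in> I \<and> x \<in> carrier M} \<subseteq> carrier (add_monoid M)"
    and "{a \<odot>\<^bsub>dual_module R M\<^esub> \<xi> | a \<xi>. a \<in> I \<and> \<xi> \<in> carrier (dual_module R M)} \<subseteq> carrier (add_monoid (dual_module R M))"
  using ideal.Icarr[OF assms] dual_smult_closed by auto

lemma ideal_smult_subset:
  assumes "ideal I R"
  shows "ideal_smult I M \<subseteq> carrier M" "ideal_smult I (dual_module R M) \<subseteq> carrier (dual_module R M)"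
  using group.generate_incl[OF M.a_group ideal_smult_generators(1)[OF assms]]
    group.generate_incl[OF abelian_group.a_group[OF abelian_group_dual_module] ideal_smult_generators(2)[OF assms]]
  by (simp_all add: ideal_smult_def)

lemma ETrans_subgroup: "subgroup (ETrans R M) (Aut R (ring_plus R M))"
proof -
  interpret V: group_hom "add_monoid M" "Aut R (ring_plus R M)" "E_vec R M" by (rule E_vec_hom)
  interpret F: group_hom "add_monoid (dual_module R M)" "Aut R (ring_plus R M)" "E_form R M" by (rule E_form_hom)
  show ?thesis unfolding ETrans_def
    by (rule V.H.generate_is_subgroup) (use V.hom_closed F.hom_closed in auto)
qed

lemma ETrans_ideal_subset: "ideal I R \<Longrightarrow> ETrans_ideal R I M \<subseteq> ETrans R M"
  unfolding ETrans_ideal_def ETrans_def using ideal_smult_subset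
  by (intro group.mono_generate module.Aut_group module_ring_plus) blast

lemma ETrans_rel_normal:
  assumes "ideal I R"
  shows "ETrans_rel R I M \<lhd> (Aut R (ring_plus R M))\<lparr>carrier := ETrans R M\<rparr>"
  unfolding ETrans_rel_def
  by (rule group.normal_closure_normal)
    (use assms ETrans_ideal_subset in \<open>auto intro: subgroup.subgroup_is_group[OF ETrans_subgroup] module.Aut_group module_ring_plus\<close>)

text \<open>A form on \<open>N\<close> that kills \<open>e = (1, 0)\<close> factors through the second component; restricted to
  \<open>M\<close> it becomes an element of the dual module.\<close>

lemma transvection_pair_ETrans:
  assumes I: "ideal I R"
  shows "transvection_pair R (ring_plus R M) (\<one>, \<zero>\<^bsub>M\<^esub>) fst I (ETrans R M) (ETrans_rel R I M)"
proof -
  let ?N = "ring_plus R M" let ?A = "Aut R ?N" let ?G = "ETrans R M" let ?H = "ETrans_rel R I M"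
  interpret N: module R ?N by (rule module_ring_plus)
  interpret A: group ?A by (rule N.Aut_group)
  have GA: "subgroup ?G ?A" by (rule ETrans_subgroup)
  interpret G: group "?A\<lparr>carrier := ?G\<rparr>" by (rule A.subgroup_imp_group[OF GA])
  have HG: "subgroup ?H (?A\<lparr>carrier := ?G\<rparr>)"
    and conj: "\<And>k h. k \<in> ?G \<Longrightarrow> h \<in> ?H \<Longrightarrow> k \<otimes>\<^bsub>?A\<^esub> h \<otimes>\<^bsub>?A\<^esub> inv\<^bsub>?A\<lparr>carrier := ?G\<rparr>\<^esub> k \<in> ?H"
    using ETrans_rel_normal[OF I] unfolding G.normal_inv_iff by auto
  have gen: "ETrans_ideal R I M \<subseteq> ?H" unfolding ETrans_rel_def by (rule subset_normal_closure)
  have form: "\<exists>\<tau>\<in>carrier (dual_module R M). \<forall>p\<in>carrier ?N. g p = \<tau> (snd p)"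
    if g: "lin_form R ?N g" "g (\<one>, \<zero>\<^bsub>M\<^esub>) = \<zero>" for g
  proof (intro bexI ballI)
    let ?t = "\<lambda>m\<in>carrier M. g (\<zero>, m)"
    have cl: "g (\<zero>, m) \<in> carrier R" if "m \<in> carrier M" for m
      using N.lin_form_closed[OF g(1), of "(\<zero>, m)"] that by simp
    have add: "g (\<zero>, x \<oplus>\<^bsub>M\<^esub> y) = g (\<zero>, x) \<oplus> g (\<zero>, y)" if "x \<in> carrier M" "y \<in> carrier M" for x y
      using N.lin_form_add[OF g(1), of "(\<zero>, x)" "(\<zero>, y)"] that by simp
    have smult: "g (\<zero>, a \<odot>\<^bsub>M\<^esub> x) = a \<otimes> g (\<zero>, x)" if "a \<in> carrier R" "x \<in> carrier M" for a x
      using N.lin_form_smult[OF g(1), of a "(\<zero>, x)"] that by simp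
    show "?t \<in> carrier (dual_module R M)"
      using cl add smult by (auto simp: dual_module_carrier lin_form_def)
    fix p assume p: "p \<in> carrier ?N"
    then obtain a m where am: "p = (a, m)" "a \<in> carrier R" "m \<in> carrier M" by auto
    have "g (a, m) = g (a, \<zero>\<^bsub>M\<^esub>) \<oplus> g (\<zero>, m)"
      using N.lin_form_add[OF g(1), of "(a, \<zero>\<^bsub>M\<^esub>)" "(\<zero>, m)"] am by simp
    moreover have "g (a, \<zero>\<^bsub>M\<^esub>) = a \<otimes> g (\<one>, \<zero>\<^bsub>M\<^esub>)"
      using N.lin_form_smult[OF g(1), of a "(\<one>, \<zero>\<^bsub>M\<^esub>)"] am by simp
    ultimately show "g p = ?t (snd p)" using am g cl by simp
  qed
  show ?thesis
  proof (intro transvection_pair.intro transvection_pair_axioms.intro module_ring_plus lin_form_fst I GA)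
    show "(\<one>, \<zero>\<^bsub>M\<^esub>) \<in> carrier ?N" "fst (\<one>, \<zero>\<^bsub>M\<^esub>) = \<one>" by auto
    show "subgroup ?H ?A" by (rule A.incl_subgroup[OF GA HG])
    show "?H \<subseteq> ?G" using subgroup.subset[OF HG] by simp
    show "k \<otimes>\<^bsub>?A\<^esub> h \<otimes>\<^bsub>?A\<^esub> inv\<^bsub>?A\<^esub> k \<in> ?H" if "k \<in> ?G" "h \<in> ?H" for k h
      using conj[OF that] A.m_inv_consistent[OF GA that(1)] by simp
    show "transv R ?N fst u \<in> ?G" if u: "u \<in> carrier ?N" "fst u = \<zero>" for u
    proof -
      obtain m where m: "u = (\<zero>, m)" "m \<in> carrier M" using u by auto
      then have "E_vec R M m \<in> ?G" unfolding ETrans_def by (intro generate.incl) auto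
      then show ?thesis using m by (simp add: E_vec_transv)
    qed
    show "transv R ?N fst (a \<odot>\<^bsub>?N\<^esub> u) \<in> ?H" if u: "u \<in> carrier ?N" "fst u = \<zero>" and a: "a \<in> I" for u a
    proof -
      obtain m where m: "u = (\<zero>, m)" "m \<in> carrier M" using u by auto
      have ac: "a \<in> carrier R" using I a by (rule ideal.Icarr)
      have "a \<odot>\<^bsub>M\<^esub> m \<in> ideal_smult I M" unfolding ideal_smult_def using a m by (intro generate.incl) auto
      then have "E_vec R M (a \<odot>\<^bsub>M\<^esub> m) \<in> ETrans_ideal R I M" unfolding ETrans_ideal_def by (intro generate.incl) auto
      then show ?thesis using gen m ac by (auto simp: E_vec_transv)
    qed
    show "transv R ?N g (\<one>, \<zero>\<^bsub>M\<^esub>) \<in> ?G" if g: "lin_form R ?N g" "g (\<one>, \<zero>\<^bsub>M\<^esub>) = \<zero>" for g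
    proof -
      obtain \<tau> where \<tau>: "\<tau> \<in> carrier (dual_module R M)" "\<forall>p\<in>carrier ?N. g p = \<tau> (snd p)" using form[OF g] by blast
      then have "E_form R M \<tau> \<in> ?G" unfolding ETrans_def by (intro generate.incl) auto
      moreover have "transv R ?N g (\<one>, \<zero>\<^bsub>M\<^esub>) = transv R ?N (\<lambda>p. \<tau> (snd p)) (\<one>, \<zero>\<^bsub>M\<^esub>)"
        using \<tau>(2) by (intro N.transv_cong) auto
      ultimately show ?thesis using \<tau> by (simp add: E_form_transv dual_module_carrier)
    qed
    show "transv R ?N g (a \<odot>\<^bsub>?N\<^esub> (\<one>, \<zero>\<^bsub>M\<^esub>)) \<in> ?H"
      if g: "lin_form R ?N g" "g (\<one>, \<zero>\<^bsub>M\<^esub>) = \<zero>" and a: "a \<in> I" for g a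
    proof -
      obtain \<tau> where \<tau>: "\<tau> \<in> carrier (dual_module R M)" "\<forall>p\<in>carrier ?N. g p = \<tau> (snd p)" using form[OF g] by blast
      have ac: "a \<in> carrier R" using I a by (rule ideal.Icarr)
      have "a \<odot>\<^bsub>dual_module R M\<^esub> \<tau> \<in> ideal_smult I (dual_module R M)"
        unfolding ideal_smult_def using a \<tau> by (intro generate.incl) blast
      then have "E_form R M (a \<odot>\<^bsub>dual_module R M\<^esub> \<tau>) \<in> ETrans_ideal R I M"
        unfolding ETrans_ideal_def by (intro generate.incl UnI2 imageI)
      moreover have "lin_form R M (a \<odot>\<^bsub>dual_module R M\<^esub> \<tau>)"
        using dual_smult_closed[OF ac \<tau>(1)] by (simp only: dual_module_carrier)
      ultimately have "transv R ?N (\<lambda>p. (a \<odot>\<^bsub>dual_module R M\<^esub> \<tau>) (snd p)) (\<one>, \<zero>\<^bsub>M\<^esub>) \<in> ?H"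
        using gen by (auto simp: E_form_transv)
      moreover have "transv R ?N (\<lambda>p. (a \<odot>\<^bsub>dual_module R M\<^esub> \<tau>) (snd p)) (\<one>, \<zero>\<^bsub>M\<^esub>) = transv R ?N (\<lambda>p. a \<otimes> g p) (\<one>, \<zero>\<^bsub>M\<^esub>)"
        using \<tau>(2) by (intro N.transv_cong) auto
      moreover have "\<dots> = transv R ?N g (a \<odot>\<^bsub>?N\<^esub> (\<one>, \<zero>\<^bsub>M\<^esub>))"
        using g ac by (intro N.transv_scale) auto
      ultimately show ?thesis by simp
    qed
  qed
qed

lemma charts_ring_plus:
  assumes fg: "finitely_generated R M" and pr: "projective R M" and rk: "rank_at_least R M 2"
    and I: "ideal I R"
  shows "transvection_pair.charts R (ring_plus R M) (\<one>, \<zero>\<^bsub>M\<^esub>) fst"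
proof -
  let ?N = "ring_plus R M"
  interpret pair: transvection_pair R ?N "(\<one>, \<zero>\<^bsub>M\<^esub>)" fst I "ETrans R M" "ETrans_rel R I M"
    by (rule transvection_pair_ETrans[OF I])
  show ?thesis unfolding pair.charts_def
  proof (intro allI impI)
    fix P assume P: "primeideal P R"
    interpret P: primeideal P R by (rule P)
    have one: "\<one> \<notin> P" using P.I_notcarr P.one_imp_carrier by blast
    interpret S: localization R M "carrier R - P"
      by (intro localization.intro localization_axioms.intro module_axioms)
        (use one P.I_prime in auto)
    obtain n where n: "n \<ge> 2" and fr: "free_of_rank (loc_ring R (carrier R - P)) (loc_module R (carrier R - P) M) n"
      using rk P unfolding rank_at_least_def by blast
    from S.basis_lifts[OF fr fg pr] obtain s f g where s: "s \<in> carrier R - P"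
      and fg_all: "\<forall>i<n. f i \<in> carrier M \<and> lin_form R M (g i)"
      and gf_all: "\<forall>i<n. \<forall>j<n. g i (f j) = (if i = j then s else \<zero>)"
      and sum: "\<forall>q\<in>carrier M. s \<odot>\<^bsub>M\<^esub> q = (\<Oplus>\<^bsub>M\<^esub>i\<in>{..<n}. g i q \<odot>\<^bsub>M\<^esub> f i)"
      by blast
    have fg: "\<And>i. i < n \<Longrightarrow> f i \<in> carrier M" "\<And>i. i < n \<Longrightarrow> lin_form R M (g i)"
      and gf: "\<And>i j. i < n \<Longrightarrow> j < n \<Longrightarrow> g i (f j) = (if i = j then s else \<zero>)"
      using fg_all gf_all by blast+
    have "s \<odot>\<^bsub>?N\<^esub> q = (\<Oplus>\<^bsub>?N\<^esub>i\<in>{..<n}. g i (snd q) \<odot>\<^bsub>?N\<^esub> (\<zero>, f i))" if q: "q \<in> carrier ?N" "fst q = \<zero>" for q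
    proof -
      obtain m where m: "q = (\<zero>, m)" "m \<in> carrier M" using q by auto
      have "(\<Oplus>\<^bsub>?N\<^esub>i\<in>A. g i m \<odot>\<^bsub>?N\<^esub> (\<zero>, f i)) = (\<zero>, \<Oplus>\<^bsub>M\<^esub>i\<in>A. g i m \<odot>\<^bsub>M\<^esub> f i)"
        if "finite A" "A \<subseteq> {..<n}" for A
        using that
      proof (induction A rule: finite_induct)
        case (insert i A)
        have cl: "g i m \<in> carrier R" "f i \<in> carrier M" if "i < n" for i
          using fg that m lin_form_closed by auto
        have i: "i < n" and A: "A \<subseteq> {..<n}" using insert.prems by auto
        have 1: "(\<lambda>i. g i m \<odot>\<^bsub>M\<^esub> f i) \<in> A \<rightarrow> carrier M" "(\<lambda>i. g i m \<odot>\<^bsub>?N\<^esub> (\<zero>, f i)) \<in> A \<rightarrow> carrier ?N"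
          using A cl by auto
        have "(\<Oplus>\<^bsub>?N\<^esub>i\<in>insert i A. g i m \<odot>\<^bsub>?N\<^esub> (\<zero>, f i)) =
            g i m \<odot>\<^bsub>?N\<^esub> (\<zero>, f i) \<oplus>\<^bsub>?N\<^esub> (\<Oplus>\<^bsub>?N\<^esub>i\<in>A. g i m \<odot>\<^bsub>?N\<^esub> (\<zero>, f i))"
          using insert.hyps 1 cl[OF i] by (intro pair.M.finsum_insert) auto
        also have "\<dots> = (\<zero>, \<Oplus>\<^bsub>M\<^esub>i\<in>insert i A. g i m \<odot>\<^bsub>M\<^esub> f i)"
          unfolding insert.IH[OF A] using insert.hyps 1 cl[OF i] by simp
        finally show ?case .
      qed simp
      from this[of "{..<n}"] show ?thesis using m s by (simp add: sum)
    qed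
    then have "pair.chart s n (\<lambda>i. (\<zero>, f i)) (\<lambda>i p. g i (snd p))"
      using s fg gf by (simp add: pair.chart_def lin_form_snd lin_form_zero)
    then show "\<exists>s n f g. s \<notin> P \<and> n \<ge> 2 \<and> pair.chart s n f g" using s n by blast
  qed
qed

end

text \<open>The elements of \<open>Aut(N)\<close> all of whose conjugates lie in \<open>ETrans(N, IN)\<close> form a normal
  subgroup \<open>K\<close> of \<open>Aut(N)\<close> inside \<open>ETrans(N, IN)\<close>. It contains \<open>ETrans(IN)\<close>, as this needs to be
  checked only for generators of \<open>ETrans(IN)\<close>, and there only for additive generators of \<open>I M\<close> and
  \<open>I M\<^sup>*\<close>. As \<open>ETrans(N, IN)\<close> is the smallest normal subgroup of \<open>ETrans(N)\<close> containing
  \<open>ETrans(IN)\<close>, it equals \<open>K\<close>.\<close>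

theorem theorem3p11:
  fixes R :: "('a, 'k) ring_scheme" and M :: "('a, 'b, 'm) module_scheme" and I :: "'a set"
  assumes "cring R"
    and "ideal I R"
    and "module R M"
    and "finitely_generated R M"
    and "projective R M"
    and "rank_at_least R M 2"
  shows "ETrans_rel R I M \<lhd> Aut R (ring_plus R M)"
proof -
  interpret module R M by fact
  let ?N = "ring_plus R M" let ?A = "Aut R ?N" let ?G = "ETrans R M" let ?H = "ETrans_rel R I M"
  note I = \<open>ideal I R\<close>
  interpret pair: transvection_pair R ?N "(\<one>\<^bsub>R\<^esub>, \<zero>\<^bsub>M\<^esub>)" fst I ?G ?H
    by (rule transvection_pair_ETrans[OF I])
  interpret A: group ?A by (rule pair.Aut_group)
  note charts = charts_ring_plus[OF assms(4-6) I]
  define K where "K = {k \<in> carrier ?A. \<forall>\<sigma>\<in>carrier ?A. \<sigma> \<otimes>\<^bsub>?A\<^esub> k \<otimes>\<^bsub>?A\<^esub> inv\<^bsub>?A\<^esub> \<sigma> \<in> ?H}"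
  have K_sub: "subgroup K ?A"
  proof (rule A.subgroupI)
    show "K \<subseteq> carrier ?A" by (auto simp: K_def)
    have "\<one>\<^bsub>?A\<^esub> \<in> K" using subgroup.one_closed[OF pair.H] by (simp add: K_def)
    then show "K \<noteq> {}" by blast
  next
    fix k assume k: "k \<in> K"
    have "\<sigma> \<otimes>\<^bsub>?A\<^esub> inv\<^bsub>?A\<^esub> k \<otimes>\<^bsub>?A\<^esub> inv\<^bsub>?A\<^esub> \<sigma> = inv\<^bsub>?A\<^esub> (\<sigma> \<otimes>\<^bsub>?A\<^esub> k \<otimes>\<^bsub>?A\<^esub> inv\<^bsub>?A\<^esub> \<sigma>)"
      if "\<sigma> \<in> carrier ?A" for \<sigma>
      using that k by (simp add: K_def A.inv_mult_group A.m_assoc)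
    then show "inv\<^bsub>?A\<^esub> k \<in> K"
      using k subgroup.m_inv_closed[OF pair.H] by (simp add: K_def)
  next
    fix k l assume kl: "k \<in> K" "l \<in> K"
    have "\<sigma> \<otimes>\<^bsub>?A\<^esub> (k \<otimes>\<^bsub>?A\<^esub> l) \<otimes>\<^bsub>?A\<^esub> inv\<^bsub>?A\<^esub> \<sigma> =
        (\<sigma> \<otimes>\<^bsub>?A\<^esub> k \<otimes>\<^bsub>?A\<^esub> inv\<^bsub>?A\<^esub> \<sigma>) \<otimes>\<^bsub>?A\<^esub> (\<sigma> \<otimes>\<^bsub>?A\<^esub> l \<otimes>\<^bsub>?A\<^esub> inv\<^bsub>?A\<^esub> \<sigma>)"
      if "\<sigma> \<in> carrier ?A" for \<sigma>
      using that kl by (simp add: K_def A.m_assoc A.inv_solve_left' A.l_inv A.inv_solve_left)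
    then show "k \<otimes>\<^bsub>?A\<^esub> l \<in> K"
      using kl subgroup.m_closed[OF pair.H] by (simp add: K_def)
  qed
  have K_conj: "\<sigma> \<otimes>\<^bsub>?A\<^esub> k \<otimes>\<^bsub>?A\<^esub> inv\<^bsub>?A\<^esub> \<sigma> \<in> K" if k: "k \<in> K" and \<sigma>: "\<sigma> \<in> carrier ?A" for k \<sigma>
  proof -
    have "\<rho> \<otimes>\<^bsub>?A\<^esub> (\<sigma> \<otimes>\<^bsub>?A\<^esub> k \<otimes>\<^bsub>?A\<^esub> inv\<^bsub>?A\<^esub> \<sigma>) \<otimes>\<^bsub>?A\<^esub> inv\<^bsub>?A\<^esub> \<rho> =
        (\<rho> \<otimes>\<^bsub>?A\<^esub> \<sigma>) \<otimes>\<^bsub>?A\<^esub> k \<otimes>\<^bsub>?A\<^esub> inv\<^bsub>?A\<^esub> (\<rho> \<otimes>\<^bsub>?A\<^esub> \<sigma>)" if "\<rho> \<in> carrier ?A" for \<rho>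
      using that k \<sigma> by (simp add: K_def A.inv_mult_group A.m_assoc)
    then show ?thesis using k \<sigma> by (simp add: K_def)
  qed
  have K_H: "K \<subseteq> ?H"
  proof
    fix k assume "k \<in> K"
    then have "\<one>\<^bsub>?A\<^esub> \<otimes>\<^bsub>?A\<^esub> k \<otimes>\<^bsub>?A\<^esub> inv\<^bsub>?A\<^esub> \<one>\<^bsub>?A\<^esub> \<in> ?H" "k \<in> carrier ?A" unfolding K_def by blast+
    then show "k \<in> ?H" by simp
  qed
  interpret V: group_hom "add_monoid M" ?A "E_vec R M" by (rule E_vec_hom)
  interpret F: group_hom "add_monoid (dual_module R M)" ?A "E_form R M" by (rule E_form_hom)
  have vec: "E_vec R M (a \<odot>\<^bsub>M\<^esub> x) \<in> K" if a: "a \<in> I" and x: "x \<in> carrier M" for a x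
  proof -
    have "a \<in> carrier R" using a by (rule pair.I_carrier)
    then show ?thesis
      using pair.conj_vec_H[OF charts, of "(\<zero>\<^bsub>R\<^esub>, x)" a] V.hom_closed[of "a \<odot>\<^bsub>M\<^esub> x"] a x
      by (simp add: K_def E_vec_transv)
  qed
  have form: "E_form R M (a \<odot>\<^bsub>dual_module R M\<^esub> \<xi>) \<in> K"
    if a: "a \<in> I" and \<xi>: "\<xi> \<in> carrier (dual_module R M)" for a \<xi>
  proof -
    have ac: "a \<in> carrier R" using a by (rule pair.I_carrier)
    have \<xi>': "lin_form R M \<xi>" using \<xi> by (simp add: dual_module_carrier)
    have l: "lin_form R M (a \<odot>\<^bsub>dual_module R M\<^esub> \<xi>)"
      using dual_smult_closed[OF ac \<xi>] by (simp only: dual_module_carrier)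
    have "E_form R M (a \<odot>\<^bsub>dual_module R M\<^esub> \<xi>) = transv R ?N (\<lambda>p. a \<otimes>\<^bsub>R\<^esub> \<xi> (snd p)) (\<one>\<^bsub>R\<^esub>, \<zero>\<^bsub>M\<^esub>)"
      unfolding E_form_transv[OF l] by (rule pair.transv_cong) auto
    also have "\<dots> = transv R ?N (\<lambda>p. \<xi> (snd p)) (a \<odot>\<^bsub>?N\<^esub> (\<one>\<^bsub>R\<^esub>, \<zero>\<^bsub>M\<^esub>))"
      using \<xi>' ac by (intro pair.transv_scale lin_form_snd) auto
    finally show ?thesis
      using pair.conj_form_H[OF charts, of "\<lambda>p. \<xi> (snd p)" a] \<xi>' a
        F.hom_closed[of "a \<odot>\<^bsub>dual_module R M\<^esub> \<xi>"] dual_smult_closed[OF ac \<xi>]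
      by (simp add: K_def lin_form_snd lin_form_zero del: dual_module_simps module_sum_simps(3))
  qed
  have "E_vec R M ` ideal_smult I M \<subseteq> K" unfolding ideal_smult_def
    by (rule V.generate_image_subset[OF ideal_smult_generators(1)[OF I] _ K_sub]) (use vec in blast)
  moreover have "E_form R M ` ideal_smult I (dual_module R M) \<subseteq> K" unfolding ideal_smult_def
    by (rule F.generate_image_subset[OF ideal_smult_generators(2)[OF I] _ K_sub]) (use form in blast)
  ultimately have ideal_K: "ETrans_ideal R I M \<subseteq> K"
    unfolding ETrans_ideal_def by (intro A.generate_subgroup_incl K_sub) simp
  interpret G: group "?A\<lparr>carrier := ?G\<rparr>" by (rule A.subgroup_imp_group[OF pair.G])
  have "K \<lhd> ?A\<lparr>carrier := ?G\<rparr>" unfolding G.normal_inv_iff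
  proof (intro conjI ballI)
    show "subgroup K (?A\<lparr>carrier := ?G\<rparr>)"
      by (rule A.subgroup_incl[OF K_sub pair.G]) (use K_H pair.HG in blast)
    fix \<sigma> k assume \<sigma>: "\<sigma> \<in> carrier (?A\<lparr>carrier := ?G\<rparr>)" and k: "k \<in> K"
    then have "\<sigma> \<in> carrier ?A" using subgroup.subset[OF pair.G] by auto
    then show "\<sigma> \<otimes>\<^bsub>?A\<lparr>carrier := ?G\<rparr>\<^esub> k \<otimes>\<^bsub>?A\<lparr>carrier := ?G\<rparr>\<^esub> inv\<^bsub>?A\<lparr>carrier := ?G\<rparr>\<^esub> \<sigma> \<in> K"
      using K_conj[OF k] A.m_inv_consistent[OF pair.G] \<sigma> by simp
  qed
  then have "?H \<subseteq> K" unfolding ETrans_rel_def using ideal_K by (rule normal_closure_minimal)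
  with K_H have "?H = K" by blast
  then show ?thesis using K_sub K_conj by (auto simp: A.normal_inv_iff)
qed

end
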